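(* Let $q^{1/2}$ be a primitive $2N$-th root of unity, $N\ge1$, $t=q^k$ with $k$ arbitrary. Let $V$ be an irreducible finite dimensional $\mathcal H\!\mathcal H$-module with a $Y$-eigenvector of weight $\lambda$. The following list exhausts all possible pairs $\{\lambda,k\}$. (A) Let $\lambda$ be regular. Then $V$ is $Y$-principal if $k\notin\pm2\lambda+\mathbb Z$. Otherwise $k\in\pm2\lambda+\mathbb Z$, so $k\notin\mathbb Z/2$, and up to $\iota$, $\varsigma_y$ and their product, $V$ is one of the irreducible quotients of $\mathcal P$, namely $\mathcal P/(X^{2N}+X^{-2N}+C)$ with $C\ne2$ or $\mathcal P/(X^N+X^{-N})$. The latter quotients are $Y$-principal unless $V=\mathcal P/(X^N+X^{-N})$. (B) Let $\lambda$ be half-singular, i.e. $2\lambda\in1/2+\mathbb Z$, and either $k\notin\mathbb Z/2$ or $k\in\mathbb Z$. Then $V$ is $Y$-semisimple. The dimension can be $2N$ (then the $Y$-spectrum is simple) or $4N$ (then all weights are of multiplicity $2$). (C) Let $\lambda$ be singular, i.e. $2\lambda\in\mathbb Z$, and $k\notin\mathbb Z$. Then the dimension of $V$ is $4N$ and it is not $Y$-semisimple, unless $t=1$. (D) Let $\lambda$ be either half-singular with $k\in1/2+\mathbb Z$, or singular with $k\in\mathbb Z$. Then $V$ is a quotient of $\mathcal P$ or of its image under one of the automorphisms $\iota,\ \varsigma_y,\ \iota\varsigma_y$.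
   Context: Fix compatible fractional (and complex) powers of $q$, so that $q^\lambda$ for $\lambda\in\mathbb C$ depends on $\lambda$ mod $N$ and every nonzero complex number is some $q^\lambda$; $t^{1/2}=q^{k/2}$. Conditions on $\lambda,k$ are understood modulo $N$. The double affine Hecke algebra $\mathcal H\!\mathcal H$ over $\mathbb C$ (type $A_1$) is generated by $X^{\pm1},Y^{\pm1},T$ with relations $TXT=X^{-1}$, $TY^{-1}T=Y$, $Y^{-1}X^{-1}YXT^2q^{1/2}=1$, $(T-t^{1/2})(T+t^{-1/2})=0$. Polynomial representation $\mathcal P=\mathbb C[X^{\pm1}]$: $X$ acts by multiplication, $T=t^{1/2}s+\frac{t^{1/2}-t^{-1/2}}{X^2-1}(s-1)$, $Y=\pi T$, with $s(X)=X^{-1}$, $\pi(X)=q^{1/2}X^{-1}$. $(g)$ is the ideal of $\mathcal P$ generated by $g$. (Auto)morphisms: $\iota$: $T\mapsto-T$, $X\mapsto X$, $Y\mapsto Y$, $q^{1/2}\mapsto q^{1/2}$, $t^{1/2}\mapsto t^{-1/2}$ (so applying $\iota$ turns the polynomial representation for $t^{-1/2}$ into a module for $t^{1/2}$); $\varsigma_y$: $Y\mapsto-Y$, fixing $T,X,q^{1/2},t^{1/2}$. A $Y$-eigenvector $v\ne0$ has weight $\lambda$ if $Yv=q^\lambda v$. A number $\lambda\in\mathbb C$ is called regular if the orbit $O_\lambda=\pm\lambda+\mathbb Z/2\bmod N$ is simple, i.e. contains $4N$ elements; equivalently $2\lambda\notin\mathbb Z/2\bmod N$. Otherwise it is called half-singular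 if $2\lambda\in1/2+\mathbb Z\bmod N$ and singular if $2\lambda\in\mathbb Z\bmod N$. An irreducible representation $V$ of $\mathcal H\!\mathcal H$ is called $Y$-principal if its dimension is $4N$ and $Y$ has a simple spectrum in it. *)

theory Defs
  imports Complex_Main "HOL-Library.Poly_Mapping"
begin

definition primitive_root :: "nat \<Rightarrow> complex \<Rightarrow> bool" where
  "primitive_root n z \<longleftrightarrow> z ^ n = 1 \<and> (\<forall>m. 0 < m \<and> m < n \<longrightarrow> z ^ m \<noteq> 1)"

text \<open>
  A system of compatible powers of the root of unity q whose square root is \<open>qh\<close>; \<open>qpow a\<close>
  stands for \<open>q\<close> to the power \<open>a\<close>.  The powers are multiplicative, the exponent is determined
  exactly modulo \<open>N\<close>, and every nonzero number is a power.  For \<open>qh = exp (pi i / N)\<close> one may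
  take \<open>qpow a = exp (2 pi i a / N)\<close>; for an arbitrary primitive root, compose this with a
  suitable automorphism of the abstract group of nonzero complex numbers.
\<close>
definition compatible_powers :: "nat \<Rightarrow> complex \<Rightarrow> (complex \<Rightarrow> complex) \<Rightarrow> bool" where
  "compatible_powers N qh qpow \<longleftrightarrow>
     qpow (1 / 2) = qh \<and>
     (\<forall>a b. qpow (a + b) = qpow a * qpow b) \<and>
     (\<forall>a b. qpow a = qpow b \<longleftrightarrow> (\<exists>j::int. a - b = of_int j * of_nat N)) \<and>
     (\<forall>z. z \<noteq> 0 \<longrightarrow> (\<exists>a. qpow a = z))"

definition residue_class :: "nat \<Rightarrow> complex \<Rightarrow> complex set" where
  "residue_class N a = {b. \<exists>j::int. b - a = of_int j * of_nat N}"

definition weight_orbit :: "nat \<Rightarrow> complex \<Rightarrow> complex set set" where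
  "weight_orbit N l = residue_class N ` {a. \<exists>j::int. a = l + of_int j / 2 \<or> a = - l + of_int j / 2}"

definition regular :: "nat \<Rightarrow> complex \<Rightarrow> bool" where
  "regular N l \<longleftrightarrow> card (weight_orbit N l) = 4 * N"

text \<open>Reducing modulo \<open>N\<close> does not affect membership in a coset of the integers.\<close>
definition half_singular :: "complex \<Rightarrow> bool" where
  "half_singular l \<longleftrightarrow> 2 * l - 1 / 2 \<in> \<int>"

definition singular :: "complex \<Rightarrow> bool" where
  "singular l \<longleftrightarrow> 2 * l \<in> \<int>"

text \<open>
  A module over the algebra presented by generators and relations is a complex vector space (the
  whole type \<open>'v\<close>, with scalar multiplication \<open>scal\<close>) with operators for the generators that
  satisfy the relations.  The parameters \<open>qh\<close> and \<open>th\<close> are the square roots of \<open>q\<close> and \<open>t\<close>.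
\<close>
record 'v daha_rep =
  scal :: "complex \<Rightarrow> 'v \<Rightarrow> 'v"
  actX :: "'v \<Rightarrow> 'v"
  actY :: "'v \<Rightarrow> 'v"
  actT :: "'v \<Rightarrow> 'v"

definition daha_module :: "complex \<Rightarrow> complex \<Rightarrow> ('v::ab_group_add) daha_rep \<Rightarrow> bool" where
  "daha_module qh th V \<longleftrightarrow>
     vector_space (scal V) \<and>
     Vector_Spaces.linear (scal V) (scal V) (actX V) \<and> bij (actX V) \<and>
     Vector_Spaces.linear (scal V) (scal V) (actY V) \<and> bij (actY V) \<and>
     Vector_Spaces.linear (scal V) (scal V) (actT V) \<and>
     actT V \<circ> actX V \<circ> actT V = inv (actX V) \<and>
     actT V \<circ> inv (actY V) \<circ> actT V = actY V \<and>
     (\<forall>v. scal V qh (inv (actY V) (inv (actX V) (actY V (actX V (actT V (actT V v)))))) = v) \<and>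
     (\<forall>v. actT V (actT V v + scal V (inverse th) v) - scal V th (actT V v + scal V (inverse th) v) = 0)"

definition submodule :: "('v::ab_group_add) daha_rep \<Rightarrow> 'v set \<Rightarrow> bool" where
  "submodule V U \<longleftrightarrow> module.subspace (scal V) U \<and>
     (\<forall>v\<in>U. actX V v \<in> U \<and> inv (actX V) v \<in> U \<and> actY V v \<in> U \<and> inv (actY V) v \<in> U \<and> actT V v \<in> U)"

definition irreducible_daha_module :: "complex \<Rightarrow> complex \<Rightarrow> ('v::ab_group_add) daha_rep \<Rightarrow> bool" where
  "irreducible_daha_module qh th V \<longleftrightarrow>
     daha_module qh th V \<and> (UNIV :: 'v set) \<noteq> {0} \<and>
     (\<forall>U. submodule V U \<longrightarrow> U = {0} \<or> U = UNIV)"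

definition finite_dimensional :: "(complex \<Rightarrow> 'v \<Rightarrow> 'v) \<Rightarrow> ('v::ab_group_add) set \<Rightarrow> bool" where
  "finite_dimensional sc U \<longleftrightarrow> (\<exists>B. finite B \<and> module.span sc B = U)"

definition dimension :: "('v::ab_group_add) daha_rep \<Rightarrow> nat" where
  "dimension V = vector_space.dim (scal V) (UNIV :: 'v set)"

definition intertwiner :: "('v::ab_group_add) daha_rep \<Rightarrow> ('w::ab_group_add) daha_rep \<Rightarrow> ('v \<Rightarrow> 'w) \<Rightarrow> bool" where
  "intertwiner V W f \<longleftrightarrow> Vector_Spaces.linear (scal V) (scal W) f \<and>
     (\<forall>v. f (actX V v) = actX W (f v)) \<and>
     (\<forall>v. f (actY V v) = actY W (f v)) \<and>
     (\<forall>v. f (actT V v) = actT W (f v))"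

definition is_quotient :: "('v::ab_group_add) daha_rep \<Rightarrow> ('w::ab_group_add) daha_rep \<Rightarrow> bool" where
  "is_quotient V W \<longleftrightarrow> (\<exists>f. intertwiner V W f \<and> surj f)"

text \<open>\<open>is_quotient_by V J W\<close>: the module \<open>W\<close> is isomorphic to \<open>V / J\<close>.\<close>
definition is_quotient_by ::
    "('v::ab_group_add) daha_rep \<Rightarrow> 'v set \<Rightarrow> ('w::ab_group_add) daha_rep \<Rightarrow> bool" where
  "is_quotient_by V J W \<longleftrightarrow> (\<exists>f. intertwiner V W f \<and> surj f \<and> {v. f v = 0} = J)"

text \<open>\<open>iota\<close> takes modules with parameter \<open>inverse th\<close> to modules with parameter \<open>th\<close>.\<close>
definition iota :: "('v::ab_group_add) daha_rep \<Rightarrow> 'v daha_rep" where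
  "iota V = V\<lparr>actT := \<lambda>v. - actT V v\<rparr>"

definition varsigma_y :: "('v::ab_group_add) daha_rep \<Rightarrow> 'v daha_rep" where
  "varsigma_y V = V\<lparr>actY := \<lambda>v. - actY V v\<rparr>"

definition Y_eigenspace :: "('v::ab_group_add) daha_rep \<Rightarrow> complex \<Rightarrow> 'v set" where
  "Y_eigenspace V z = {v. actY V v = scal V z v}"

definition Y_eigenvalue :: "('v::ab_group_add) daha_rep \<Rightarrow> complex \<Rightarrow> bool" where
  "Y_eigenvalue V z \<longleftrightarrow> (\<exists>v. v \<noteq> 0 \<and> v \<in> Y_eigenspace V z)"

text \<open>Algebraic multiplicity, i.e. the dimension of the generalized eigenspace.\<close>
definition Y_multiplicity :: "('v::ab_group_add) daha_rep \<Rightarrow> complex \<Rightarrow> nat" where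
  "Y_multiplicity V z =
     vector_space.dim (scal V) {v. \<exists>n. ((\<lambda>w. actY V w - scal V z w) ^^ n) v = 0}"

definition Y_simple_spectrum :: "('v::ab_group_add) daha_rep \<Rightarrow> bool" where
  "Y_simple_spectrum V \<longleftrightarrow> (\<forall>z. Y_eigenvalue V z \<longrightarrow> Y_multiplicity V z = 1)"

definition Y_semisimple :: "('v::ab_group_add) daha_rep \<Rightarrow> bool" where
  "Y_semisimple V \<longleftrightarrow> module.span (scal V) (\<Union>z. Y_eigenspace V z) = UNIV"

definition Y_principal :: "nat \<Rightarrow> complex \<Rightarrow> complex \<Rightarrow> ('v::ab_group_add) daha_rep \<Rightarrow> bool" where
  "Y_principal N qh th V \<longleftrightarrow> irreducible_daha_module qh th V \<and>
     finite_dimensional (scal V) (UNIV :: 'v set) \<and> dimension V = 4 * N \<and> Y_simple_spectrum V"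

type_synonym laurent = "int \<Rightarrow>\<^sub>0 complex"

abbreviation Xpow :: "int \<Rightarrow> laurent" where
  "Xpow n \<equiv> Poly_Mapping.single n 1"

abbreviation const :: "complex \<Rightarrow> laurent" where
  "const c \<equiv> Poly_Mapping.single 0 c"

text \<open>The substitution of \<open>a\<close> times the inverse of \<open>X\<close> for \<open>X\<close>.\<close>
definition invert_var :: "complex \<Rightarrow> laurent \<Rightarrow> laurent" where
  "invert_var a p =
     (\<Sum>n\<in>Poly_Mapping.keys p. Poly_Mapping.single (- n) (Poly_Mapping.lookup p n * a powi n))"

abbreviation refl_s :: "laurent \<Rightarrow> laurent" where
  "refl_s \<equiv> invert_var 1"

abbreviation refl_pi :: "complex \<Rightarrow> laurent \<Rightarrow> laurent" where
  "refl_pi qh \<equiv> invert_var qh"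

text \<open>
  \<open>refl_s p - p\<close> is divisible by \<open>Xpow 2 - 1\<close>, and the quotient is unique since Laurent
  polynomials have no zero divisors.
\<close>
definition demazure :: "laurent \<Rightarrow> laurent" where
  "demazure p = (THE r. (Xpow 2 - 1) * r = refl_s p - p)"

definition poly_T :: "complex \<Rightarrow> laurent \<Rightarrow> laurent" where
  "poly_T th p = const th * refl_s p + const (th - inverse th) * demazure p"

definition poly_rep :: "complex \<Rightarrow> complex \<Rightarrow> laurent daha_rep" where
  "poly_rep qh th =
     \<lparr>scal = (\<lambda>c p. const c * p),
      actX = (\<lambda>p. Xpow 1 * p),
      actY = (\<lambda>p. refl_pi qh (poly_T th p)),
      actT = poly_T th\<rparr>"

text \<open>
  The polynomial representation and its images under \<open>iota\<close>, \<open>varsigma_y\<close> and their product,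
  all of them modules with parameter \<open>th\<close>.
\<close>
definition poly_rep_images :: "complex \<Rightarrow> complex \<Rightarrow> laurent daha_rep set" where
  "poly_rep_images qh th =
     {poly_rep qh th, iota (poly_rep qh (inverse th)),
      varsigma_y (poly_rep qh th), iota (varsigma_y (poly_rep qh (inverse th)))}"

definition principal_ideal :: "laurent \<Rightarrow> laurent set" where
  "principal_ideal g = {p. g dvd p}"

end

theory Submission
  imports Defs "HOL-Computational_Algebra.Fundamental_Theorem_Algebra"
begin

text \<open>
  Besides \<open>T\<close>, two operators move \<open>Y\<close>-eigenvectors: the involution \<open>X T\<close> sends weight \<open>\<lambda>\<close> to
  \<open>- 1/2 - \<lambda>\<close>, and the intertwiner \<open>E = T (Y\<^sup>-\<^sup>2 - 1) + t\<^sup>1\<^sup>/\<^sup>2 - t\<^sup>-\<^sup>1\<^sup>/\<^sup>2\<close> sends \<open>\<lambda>\<close> to \<open>- \<lambda>\<close>, with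
  \<open>E\<^sup>2 = t + t\<^sup>-\<^sup>1 - Y\<^sup>2 - Y\<^sup>-\<^sup>2\<close>.  If \<open>k \<in> \<plusminus>2\<lambda> + \<int>\<close>, the orbit of \<open>\<lambda>\<close> contains a weight at which \<open>E\<close> degenerates;
  this yields a common eigenvector of \<open>T\<close> and \<open>Y\<close>, which generates an image of the polynomial
  representation (up to \<open>\<iota>\<close> and \<open>\<varsigma>\<^sub>y\<close>), and the scalar by which the central \<open>X\<^sup>2\<^sup>N + X\<^sup>-\<^sup>2\<^sup>N\<close> acts
  determines the quotient.  Otherwise \<open>E\<close> is invertible, and so is the shift \<open>G = X T E\<close>.  For
  nonsingular \<open>\<lambda>\<close>, an eigenvector \<open>v\<close> of \<open>G\<^sup>2\<^sup>N\<close> on one weight space makes the span of the vectors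
  \<open>G\<^sup>i v\<close> and \<open>E G\<^sup>i v\<close> a submodule, so the dimension is at most \<open>4N\<close>.  For singular \<open>\<lambda>\<close>, one takes an
  eigenvector \<open>v\<close> of \<open>G\<^sup>-\<^sup>N T G\<^sup>N - T\<close> on the kernel of \<open>Y - 1\<close>; then the vectors \<open>G\<^sup>i v\<close> and \<open>G\<^sup>i T v\<close>
  form a basis.
\<close>

section \<open>Linear algebra over the complex numbers\<close>

text \<open>The regular case is closed by a count. Spanning sets bound the dimension from above;
  distinct weights, reached by walking along the orbit with the involution and \<open>E\<close>,
  bound it from below. The walk can stop only where \<open>E\<close> may vanish, at z^2 = t or z^2 =
  1/t, and starting from such a weight it collects 2N weights first. The negatives of these are the
  rest of the orbit. They are reached through X^N + X^-N, which anticommutes with Y because q^(N/2)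
  = -1, and whose square is X^2N + X^-2N + 2, the scalar 2 - C. For C = 2 this operator is
  nilpotent, hence zero on a simple module: this is the origin of the exceptional quotient of
  dimension 2N. The obstacle at singular weights is that \<open>E\<close> determines T only after
  division by Y^-2 - 1, which fails at the weights 1 and -1. The shift G^N joins these two weights,
  and the choice of v makes T preserve the span of v and T v and its image under G^N
  simultaneously.\<close>

locale complex_vector_space = vector_space sc
  for sc :: "complex \<Rightarrow> 'v::ab_group_add \<Rightarrow> 'v"
begin

abbreviation linear_op :: "('v \<Rightarrow> 'v) \<Rightarrow> bool" where
  "linear_op \<equiv> Vector_Spaces.linear sc sc"

lemma linear_opI:
  assumes "\<And>u v. A (u + v) = A u + A v" and "\<And>a v. A (sc a v) = sc a (A v)"
  shows "linear_op A"
  using assms by (simp add: Vector_Spaces.linear_iff vector_space_axioms)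

lemma linear_op_simps:
  assumes "linear_op A"
  shows "A (u + v) = A u + A v" "A (sc a v) = sc a (A v)" "A 0 = 0" "A (- v) = - A v"
    "A (u - v) = A u - A v" "A (sum f I) = (\<Sum>i\<in>I. A (f i))"
proof -
  interpret A: Vector_Spaces.linear sc sc A by fact
  show "A (u + v) = A u + A v" "A (sc a v) = sc a (A v)" "A 0 = 0" "A (- v) = - A v"
    "A (u - v) = A u - A v" "A (sum f I) = (\<Sum>i\<in>I. A (f i))"
    by (simp_all add: A.add A.scale A.neg A.diff A.sum)
qed

definition eigenspace :: "('v \<Rightarrow> 'v) \<Rightarrow> complex \<Rightarrow> 'v set" where
  "eigenspace A z = {v. A v = sc z v}"

lemma subspace_eigenspace: "linear_op A \<Longrightarrow> subspace (eigenspace A z)"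
  by (rule subspaceI) (simp_all add: eigenspace_def linear_op_simps scale_right_distrib scale_left_commute)

text \<open>Indexed families rather than sets: a repeated vector counts as a dependence, so the
  cardinality of the index set itself bounds the dimension.\<close>

definition independent_family :: "'i set \<Rightarrow> ('i \<Rightarrow> 'v) \<Rightarrow> bool" where
  "independent_family I f \<longleftrightarrow> (\<forall>c. (\<Sum>i\<in>I. sc (c i) (f i)) = 0 \<longrightarrow> (\<forall>i\<in>I. c i = 0))"

lemma independent_family_image:
  assumes "finite I" and "independent_family I f"
  shows "inj_on f I" and "independent (f ` I)"
proof -
  show inj: "inj_on f I"
  proof (rule inj_onI, rule ccontr)
    fix i j assume ij: "i \<in> I" "j \<in> I" "f i = f j" "i \<noteq> j"
    let ?c = "\<lambda>m. if m = i then 1 else if m = j then -1 else (0::complex)"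
    have "(\<Sum>m\<in>I. sc (?c m) (f m)) = (\<Sum>m\<in>{i, j}. sc (?c m) (f m))"
      using ij(1,2) assms(1) by (intro sum.mono_neutral_right) auto
    also have "\<dots> = f i - f j"
      using ij(4) by simp
    also have "\<dots> = 0"
      using ij(3) by simp
    finally have "?c i = 0"
      using assms(2)[unfolded independent_family_def, THEN spec, of ?c] ij(1) by blast
    then show False by simp
  qed
  show "independent (f ` I)"
  proof (rule independent_if_scalars_zero)
    show "finite (f ` I)" using assms(1) by simp
    fix c x assume s: "(\<Sum>x\<in>f ` I. sc (c x) x) = 0" and x: "x \<in> f ` I"
    have "(\<Sum>i\<in>I. sc (c (f i)) (f i)) = 0"
      using s by (simp add: sum.reindex[OF inj])
    then show "c x = 0"
      using assms(2)[unfolded independent_family_def, THEN spec, of "\<lambda>i. c (f i)"] x by blast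
  qed
qed

text \<open>Applying A - a removes the summand at a and multiplies the others by the nonzero z - a.
  Because of this rescaling the induction runs over all families v at once.\<close>

lemma eigenvectors_sum_zero:
  assumes lin: "linear_op A" and "finite Z" and "\<And>z. z \<in> Z \<Longrightarrow> v z \<in> eigenspace A z"
    and "(\<Sum>z\<in>Z. v z) = 0" and "z \<in> Z"
  shows "v z = 0"
  using assms(2-)
proof (induction Z arbitrary: v z rule: finite_induct)
  case (insert a Z)
  have "0 = A (\<Sum>z\<in>insert a Z. v z) - sc a (\<Sum>z\<in>insert a Z. v z)"
    by (simp only: insert.prems(2) linear_op_simps(3)[OF lin] scale_zero_right diff_zero)
  also have "\<dots> = (\<Sum>z\<in>insert a Z. A (v z) - sc a (v z))"
    by (simp only: linear_op_simps[OF lin] scale_sum_right sum_subtractf)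
  also have "\<dots> = (\<Sum>z\<in>insert a Z. sc (z - a) (v z))"
    by (rule sum.cong) (use insert.prems(1) in \<open>auto simp: eigenspace_def scale_left_diff_distrib\<close>)
  also have "\<dots> = (\<Sum>z\<in>Z. sc (z - a) (v z))"
    using insert.hyps by simp
  finally have s: "(\<Sum>z\<in>Z. sc (z - a) (v z)) = 0" by simp
  have z: "v z = 0" if "z \<in> Z" for z
  proof -
    have "sc (z - a) (v z) = 0"
    proof (rule insert.IH[of "\<lambda>z. sc (z - a) (v z)"])
      show "sc (z - a) (v z) \<in> eigenspace A z" if "z \<in> Z" for z
        using insert.prems(1)[of z] subspace_scale[OF subspace_eigenspace[OF lin]] that by auto
    qed (use s that in auto)
    moreover have "z \<noteq> a" using that insert.hyps by auto
    ultimately show ?thesis by simp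
  qed
  then have "v a = 0" using insert.prems(2) insert.hyps by simp
  with z show ?case using insert.prems(3) by auto
qed simp

lemma independent_eigenvectors:
  assumes "linear_op A" and "finite Z"
    and "\<And>z. z \<in> Z \<Longrightarrow> v z \<in> eigenspace A z" and "\<And>z. z \<in> Z \<Longrightarrow> v z \<noteq> 0"
  shows "independent_family Z v"
  unfolding independent_family_def
proof (intro allI impI ballI)
  fix c z assume "(\<Sum>i\<in>Z. sc (c i) (v i)) = 0" "z \<in> Z"
  then have "sc (c z) (v z) = 0"
    using eigenvectors_sum_zero[OF assms(1,2), of "\<lambda>z. sc (c z) (v z)" z] assms(3)
      subspace_scale[OF subspace_eigenspace[OF assms(1)]] by auto
  then show "c z = 0" using assms(4) \<open>z \<in> Z\<close> by auto
qed

lemma eigenvector_decomposition: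
  assumes lin: "linear_op A" and "v \<in> span (\<Union>z. eigenspace A z)"
  shows "\<exists>u Z. finite Z \<and> (\<forall>z\<in>Z. u z \<in> eigenspace A z) \<and> v = (\<Sum>z\<in>Z. u z)"
  using assms(2)
proof (induction rule: span_induct_alt)
  case base
  show ?case by (intro exI[of _ "\<lambda>_. 0"] exI[of _ "{}"]) simp
next
  case (step c x y)
  then obtain a u Z where x: "x \<in> eigenspace A a" and fin: "finite Z"
    and u: "\<forall>z\<in>Z. u z \<in> eigenspace A z" and y: "y = (\<Sum>z\<in>Z. u z)" by blast
  define u' where "u' z = (if z = a then sc c x else 0) + (if z \<in> Z then u z else 0)" for z
  have mem: "u' z \<in> eigenspace A z" for z
    unfolding u'_def using x u subspace_eigenspace[OF lin, of z]
    by (auto intro!: subspace_add subspace_scale subspace_0)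
  have "(\<Sum>z\<in>insert a Z. u' z) = (\<Sum>z\<in>insert a Z. if z = a then sc c x else 0)
      + (\<Sum>z\<in>insert a Z. if z \<in> Z then u z else 0)"
    unfolding u'_def by (rule sum.distrib)
  also have "(\<Sum>z\<in>insert a Z. if z = a then sc c x else 0) = sc c x"
    using fin by (simp add: sum.delta)
  also have "(\<Sum>z\<in>insert a Z. if z \<in> Z then u z else 0) = (\<Sum>z\<in>Z. u z)"
    using fin by (intro sum.mono_neutral_cong_right) auto
  finally have "sc c x + y = (\<Sum>z\<in>insert a Z. u' z)" using y by simp
  then show ?case using fin mem by (intro exI[of _ u'] exI[of _ "insert a Z"]) auto
qed

text \<open>On the component of eigenvalue y the n-th power of A - z is multiplication by (y - z)^n,
  so it kills v only if all components with y \<noteq> z vanish. This turns the algebraic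
  multiplicity \<open>Y_multiplicity\<close> into the dimension of an eigenspace.\<close>

lemma generalized_eigenspace_eq:
  assumes lin: "linear_op A" and ss: "span (\<Union>z. eigenspace A z) = UNIV"
  shows "{v. \<exists>n. ((\<lambda>w. A w - sc z w) ^^ n) v = 0} = eigenspace A z"
proof (intro set_eqI iffI; clarsimp)
  fix v n assume n: "((\<lambda>w. A w - sc z w) ^^ n) v = 0"
  obtain u Z where fin: "finite Z" and u: "\<forall>z\<in>Z. u z \<in> eigenspace A z" and v: "v = (\<Sum>z\<in>Z. u z)"
    using eigenvector_decomposition[OF lin, of v] ss by auto
  have pw: "((\<lambda>w. A w - sc z w) ^^ m) v = (\<Sum>y\<in>Z. sc ((y - z) ^ m) (u y))" for m
  proof (induction m)
    case (Suc m)
    then show ?case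
      using u by (auto simp: linear_op_simps[OF lin] scale_sum_right eigenspace_def
          scale_left_diff_distrib sum_subtractf[symmetric] algebra_simps intro!: sum.cong)
  qed (simp add: v)
  have "u y = 0" if "y \<in> Z" "y \<noteq> z" for y
  proof -
    have "sc ((y - z) ^ n) (u y) = 0"
    proof (rule eigenvectors_sum_zero[OF lin fin, of "\<lambda>y. sc ((y - z) ^ n) (u y)"])
      show "sc ((y - z) ^ n) (u y) \<in> eigenspace A y" if "y \<in> Z" for y
        using u that subspace_scale[OF subspace_eigenspace[OF lin]] by auto
    qed (use n that pw in auto)
    then show ?thesis using that by simp
  qed
  then have "u y \<in> eigenspace A z" if "y \<in> Z" for y
    using u that subspace_0[OF subspace_eigenspace[OF lin]] by (cases "y = z") auto
  then show "v \<in> eigenspace A z"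
    unfolding v by (intro subspace_sum subspace_eigenspace lin)
next
  fix v assume "v \<in> eigenspace A z"
  then have "((\<lambda>w. A w - sc z w) ^^ 1) v = 0" by (simp add: eigenspace_def)
  then show "\<exists>n. ((\<lambda>w. A w - sc z w) ^^ n) v = 0" by blast
qed

end

section \<open>Eigenvectors and dimension counts in finite dimension\<close>

locale findim_complex_vector_space = complex_vector_space sc + finite_dimensional_vector_space sc Basis
  for sc :: "complex \<Rightarrow> 'v::ab_group_add \<Rightarrow> 'v" and Basis
begin

lemma independent_family_card_le:
  assumes "finite I" and "independent_family I f" and "f ` I \<subseteq> U"
  shows "card I \<le> dim U"
  using independent_card_le_dim[OF assms(3) independent_family_image(2)[OF assms(1,2)]]
    card_image[OF independent_family_image(1)[OF assms(1,2)]] by simp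

lemma independent_family_eq_UNIV:
  assumes "finite I" and "independent_family I f" and "f ` I \<subseteq> U" and "subspace U"
    and "dim (UNIV :: 'v set) \<le> card I"
  shows "U = UNIV"
proof -
  have "dim (UNIV :: 'v set) \<le> dim U"
    using independent_family_card_le[OF assms(1-3)] assms(5) by simp
  then show ?thesis
    by (intro subspace_dim_equal[OF assms(4) subspace_UNIV subset_UNIV])
qed

lemma dependent_family:
  assumes "finite I" and "dim (UNIV :: 'v set) < card I"
  obtains c i where "(\<Sum>i\<in>I. sc (c i) (f i)) = 0" "i \<in> I" "c i \<noteq> 0"
proof -
  have "\<not> independent_family I f"
    using independent_family_card_le[OF assms(1) _ subset_UNIV, of f] assms(2) by linarith
  then obtain c where "(\<Sum>i\<in>I. sc (c i) (f i)) = 0" "\<not> (\<forall>i\<in>I. c i = 0)"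
    unfolding independent_family_def by auto
  then show ?thesis using that by auto
qed

text \<open>Among the nonzero p with p(A) w = 0 take one of least degree and split off a root: p =
  (x - r) q. Then q(A) w is nonzero by minimality and is killed by A - r. Working from a single
  vector w keeps everything inside the invariant subspace K.\<close>

lemma exists_eigenvector:
  assumes lin: "linear_op A" and K: "subspace K" "\<And>v. v \<in> K \<Longrightarrow> A v \<in> K" and w: "w \<in> K" "w \<noteq> 0"
  obtains v z where "v \<in> K" "v \<noteq> 0" "A v = sc z v"
proof -
  \<comment> \<open>\<open>P n p\<close> is p(A) w once n exceeds the degree; the explicit bound
    lets p and its factor q be compared term by term.\<close>
  define P where "P n p = (\<Sum>i<n. sc (coeff p i) ((A ^^ i) w))" for n p
  have PK: "P n p \<in> K" for n p
  proof -
    have "(A ^^ i) w \<in> K" for i by (induction i) (simp_all add: w(1) K(2))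
    then show ?thesis unfolding P_def by (intro subspace_sum subspace_scale K(1))
  qed
  let ?Q = "\<lambda>p. p \<noteq> 0 \<and> (\<exists>n>degree p. P n p = 0)"
  have "\<exists>p. ?Q p"
  proof -
    have "finite {..dim (UNIV::'v set)}" "dim (UNIV::'v set) < card {..dim (UNIV::'v set)}"
      by simp_all
    then obtain c i where c: "(\<Sum>i\<in>{..dim (UNIV::'v set)}. sc (c i) ((A ^^ i) w)) = 0"
      "i \<in> {..dim (UNIV::'v set)}" "c i \<noteq> 0"
      by (rule dependent_family)
    define p where "p = (\<Sum>i\<le>dim (UNIV::'v set). monom (c i) i)"
    have co: "coeff p j = (if j \<le> dim (UNIV::'v set) then c j else 0)" for j
      by (simp add: p_def coeff_sum)
    have "p \<noteq> 0" using c(2,3) co[of i] by auto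
    moreover have "degree p < Suc (dim (UNIV::'v set))"
      by (rule le_imp_less_Suc, rule degree_le) (simp add: co)
    moreover have "P (Suc (dim (UNIV::'v set))) p = 0"
      using c(1) by (simp add: P_def co lessThan_Suc_atMost)
    ultimately show ?thesis by blast
  qed
  then obtain p where p: "?Q p" and min: "\<And>q. ?Q q \<Longrightarrow> degree p \<le> degree q"
    using ex_has_least_nat[of ?Q _ degree] by blast
  obtain n where n: "n > degree p" "P n p = 0" using p by blast
  have "degree p \<noteq> 0"
  proof
    assume "degree p = 0"
    then have "P n p = (\<Sum>i\<in>{0}. sc (coeff p i) ((A ^^ i) w))"
      unfolding P_def using n(1)
      by (intro sum.mono_neutral_right) (auto simp: coeff_eq_0)
    then show False
      using n(2) w p \<open>degree p = 0\<close> leading_coeff_0_iff[of p] by simp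
  qed
  then obtain r where r: "poly p r = 0"
    using fundamental_theorem_of_algebra[of p] by (auto simp: constant_degree)
  then obtain q where q: "p = [:-r, 1:] * q" by (auto simp: poly_eq_0_iff_dvd)
  have q0: "q \<noteq> 0" using p q by auto
  have dq: "degree p = Suc (degree q)" using q0 unfolding q by (subst degree_mult_eq) auto
  define u where "u = P n q"
  have pc: "coeff p i = (case i of 0 \<Rightarrow> 0 | Suc j \<Rightarrow> coeff q j) - r * coeff q i" for i
    unfolding q by (simp add: coeff_pCons)
  have "A u = P (Suc n) (pCons 0 q)"
    unfolding u_def P_def sum.lessThan_Suc_shift by (simp add: linear_op_simps[OF lin])
  also have "\<dots> = P n (pCons 0 q)"
    using n dq by (simp add: P_def coeff_pCons coeff_eq_0 split: nat.split)
  finally have "A u - sc r u = P n p"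
    unfolding P_def u_def scale_sum_right sum_subtractf[symmetric] pc
    by (simp add: scale_left_diff_distrib coeff_pCons sum_subtractf)
  then have "A u = sc r u" using n by simp
  moreover have "u \<noteq> 0" 
  proof
    assume "u = 0"
    then have "?Q q" using q0 dq n unfolding u_def by (intro conjI exI[of _ n]) simp_all
    then show False using min[of q] dq by simp
  qed
  ultimately show ?thesis using that[of u r] PK unfolding u_def by blast
qed

lemma independent_Union_eigenbases:
  assumes lin: "linear_op A" and Z: "finite Z"
    and B: "\<And>z. z \<in> Z \<Longrightarrow> B z \<subseteq> eigenspace A z \<and> independent (B z)"
  shows "independent (\<Union>z\<in>Z. B z)" and "card (\<Union>z\<in>Z. B z) = (\<Sum>z\<in>Z. card (B z))"
proof -
  have fin: "finite (B z)" if "z \<in> Z" for z using B that finiteI_independent by blast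
  have disj: "B y \<inter> B z = {}" if "y \<in> Z" "z \<in> Z" "y \<noteq> z" for y z
  proof (rule ccontr)
    assume "B y \<inter> B z \<noteq> {}"
    then obtain x where x: "x \<in> B y" "x \<in> B z" by blast
    then have "x \<in> eigenspace A y" "x \<in> eigenspace A z" using B that by blast+
    then have "sc y x = sc z x" unfolding eigenspace_def by simp
    then have "x = 0" using that by simp
    then show False using B x that dependent_zero by blast
  qed
  show "card (\<Union>z\<in>Z. B z) = (\<Sum>z\<in>Z. card (B z))"
    using Z fin disj by (intro card_UN_disjoint) auto
  show "independent (\<Union>z\<in>Z. B z)"
  proof (rule independent_if_scalars_zero)
    show "finite (\<Union>z\<in>Z. B z)" using Z fin by auto
    fix c x assume s: "(\<Sum>x\<in>(\<Union>z\<in>Z. B z). sc (c x) x) = 0" and x: "x \<in> (\<Union>z\<in>Z. B z)"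
    have "(\<Sum>z\<in>Z. \<Sum>x\<in>B z. sc (c x) x) = 0"
      using s by (subst (asm) sum.UNION_disjoint) (use Z fin disj in auto)
    moreover have "(\<Sum>x\<in>B z. sc (c x) x) \<in> eigenspace A z" if "z \<in> Z" for z
      using B that by (intro subspace_sum subspace_scale subspace_eigenspace lin) auto
    ultimately have "(\<Sum>x\<in>B z. sc (c x) x) = 0" if "z \<in> Z" for z
      using eigenvectors_sum_zero[OF lin Z, of "\<lambda>z. \<Sum>x\<in>B z. sc (c x) x" z] that by blast
    then show "c x = 0" using x B fin independentD[OF _ _ order_refl] by blast
  qed
qed

lemma dim_eq_sum_eigenspaces:
  assumes lin: "linear_op A" and Z: "finite Z" and span: "span (\<Union>z\<in>Z. eigenspace A z) = UNIV"
  shows "dim (UNIV :: 'v set) = (\<Sum>z\<in>Z. dim (eigenspace A z))"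
proof -
  have "\<exists>B. B \<subseteq> eigenspace A z \<and> independent B \<and> eigenspace A z \<subseteq> span B \<and> card B = dim (eigenspace A z)" for z
    by (metis basis_exists)
  then obtain B where B: "\<And>z. B z \<subseteq> eigenspace A z \<and> independent (B z) \<and>
      eigenspace A z \<subseteq> span (B z) \<and> card (B z) = dim (eigenspace A z)" by metis
  have "eigenspace A z \<subseteq> span (\<Union>z\<in>Z. B z)" if "z \<in> Z" for z
    using B[of z] span_mono[of "B z" "\<Union>z\<in>Z. B z"] that by blast
  then have "span (\<Union>z\<in>Z. eigenspace A z) \<subseteq> span (\<Union>z\<in>Z. B z)"
    by (intro span_minimal subspace_span) auto
  then have "span (\<Union>z\<in>Z. B z) = UNIV" using span by auto
  then have "dim (UNIV :: 'v set) = card (\<Union>z\<in>Z. B z)"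
    using independent_Union_eigenbases(1)[OF lin Z, of B] B
    by (metis dim_span_eq_card_independent)
  then show ?thesis
    using independent_Union_eigenbases(2)[OF lin Z, of B] B by simp
qed

lemma dim_eigenspace_pos:
  assumes "linear_op A" and "v \<in> eigenspace A z" and "v \<noteq> 0"
  shows "dim (eigenspace A z) \<ge> 1"
  using independent_card_le_dim[of "{v}" "eigenspace A z"] assms by auto

text \<open>Eigenvectors for the eigenvalues in Z already fill the space. So each eigenspace has
  room for one dimension only, and an eigenvalue outside Z would give one vector too many.\<close>

lemma many_eigenvalues:
  assumes lin: "linear_op A" and Z: "finite Z" and ev: "\<And>z. z \<in> Z \<Longrightarrow> \<exists>v\<in>eigenspace A z. v \<noteq> 0"
    and dim: "dim (UNIV :: 'v set) \<le> card Z"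
  shows "dim (UNIV :: 'v set) = card Z" and "span (\<Union>z. eigenspace A z) = UNIV"
    and "\<And>v z. v \<in> eigenspace A z \<Longrightarrow> v \<noteq> 0 \<Longrightarrow> dim (eigenspace A z) = 1"
proof -
  obtain e where e: "\<And>z. z \<in> Z \<Longrightarrow> e z \<in> eigenspace A z" "\<And>z. z \<in> Z \<Longrightarrow> e z \<noteq> 0"
    using ev by metis
  have ind: "independent_family Z e" by (rule independent_eigenvectors[OF lin Z e])
  show eq: "dim (UNIV :: 'v set) = card Z"
    using independent_family_card_le[OF Z ind, of UNIV] dim by simp
  have span: "span (\<Union>z\<in>Z. eigenspace A z) = UNIV"
    by (rule independent_family_eq_UNIV[OF Z ind _ subspace_span dim])
      (use e in \<open>auto intro!: span_base\<close>)
  then show "span (\<Union>z. eigenspace A z) = UNIV"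
    using span_mono[of "\<Union>z\<in>Z. eigenspace A z" "\<Union>z. eigenspace A z"] by auto
  have pos: "dim (eigenspace A z) \<ge> 1" if "z \<in> Z" for z
    using dim_eigenspace_pos[OF lin] e that by blast
  have one: "dim (eigenspace A z) = 1" if "z \<in> Z" for z
  proof (rule ccontr)
    assume "dim (eigenspace A z) \<noteq> 1"
    then have "(\<Sum>z\<in>Z. 1) < (\<Sum>z\<in>Z. dim (eigenspace A z))"
      using pos that Z by (intro sum_strict_mono_ex1) (auto intro!: bexI[of _ z] simp: le_neq_implies_less)
    then show False using dim_eq_sum_eigenspaces[OF lin Z span] eq by simp
  qed
  show "dim (eigenspace A z) = 1" if v: "v \<in> eigenspace A z" "v \<noteq> 0" for v z
  proof (cases "z \<in> Z")
    case False
    have "independent_family (insert z Z) (e(z := v))"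
      using e v False Z by (intro independent_eigenvectors[OF lin]) auto
    then have "card (insert z Z) \<le> dim (UNIV::'v set)"
      using Z by (intro independent_family_card_le[where f = "e(z := v)"]) auto
    then show ?thesis using False Z dim by simp
  qed (rule one)
qed

end

context findim_complex_vector_space
begin

lemma dim_le_of_injective:
  assumes lin: "linear_op A" and S: "subspace S" and "\<And>v. v \<in> S \<Longrightarrow> A v \<in> S'"
    and inj: "\<And>v. v \<in> S \<Longrightarrow> A v = 0 \<Longrightarrow> v = 0"
  shows "dim S \<le> dim S'"
proof -
  interpret A: Vector_Spaces.linear sc sc A by (rule lin)
  obtain B where B: "B \<subseteq> S" "independent B" "S \<subseteq> span B" "card B = dim S"
    by (rule basis_exists)
  have "span B = S" using B S by (simp add: span_subspace)
  then have "inj_on A (span B)"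
    using inj S by (simp add: A.inj_on_iff_eq_0)
  then have "independent (A ` B)" "inj_on A B"
    using A.independent_injective_image[OF B(2)] span_superset inj_on_subset by blast+
  then have "card (A ` B) \<le> dim S'" "card (A ` B) = card B"
    using B(1) assms(3) by (auto intro!: independent_card_le_dim card_image)
  then show ?thesis using B(4) by simp
qed

text \<open>A dimension count that stands in for the inverses of \<open>E\<close>, of the shift
  \<open>G\<close> and of its powers.\<close>

lemma injective_image_eq:
  assumes lin: "linear_op A" and S: "subspace S" and sub: "\<And>v. v \<in> S \<Longrightarrow> A v \<in> S"
    and inj: "\<And>v. A v = 0 \<Longrightarrow> v = 0" and "v \<in> S"
  obtains u where "u \<in> S" "v = A u"
proof -
  interpret A: Vector_Spaces.linear sc sc A by (rule lin)
  have "dim S \<le> dim (A ` S)"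
    by (rule dim_le_of_injective[OF lin S]) (use inj in auto)
  then have "A ` S = S"
    using sub A.subspace_image[OF S] S by (intro subspace_dim_equal) auto
  then show ?thesis using that assms(5) by blast
qed

end

lemma (in complex_vector_space) span_stable:
  assumes lin: "linear_op A" and "\<And>s. s \<in> S \<Longrightarrow> A s \<in> span S" and "v \<in> span S"
  shows "A v \<in> span S"
  using assms(3)
proof (induction rule: span_induct_alt)
  case (step c x y)
  then show ?case
    using assms(2) by (simp add: linear_op_simps[OF lin] span_add span_scale)
qed (simp add: linear_op_simps[OF lin] span_zero)

lemma (in complex_vector_space) independent_eigenvectors_indexed:
  assumes lin: "linear_op A" and I: "finite I" and e: "inj_on e I"
    and v: "\<And>i. i \<in> I \<Longrightarrow> v i \<in> eigenspace A (e i)" "\<And>i. i \<in> I \<Longrightarrow> v i \<noteq> 0"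
  shows "independent_family I v"
  unfolding independent_family_def
proof (intro allI impI ballI)
  fix c i assume s: "(\<Sum>i\<in>I. sc (c i) (v i)) = 0" and i: "i \<in> I"
  let ?g = "inv_into I e"
  have g: "?g (e i) = i" if "i \<in> I" for i by (rule inv_into_f_f[OF e that])
  have ind: "independent_family (e ` I) (\<lambda>z. v (?g z))"
    by (rule independent_eigenvectors[OF lin]) (use I v g in auto)
  have eq: "(\<Sum>z\<in>e ` I. sc (c (?g z)) (v (?g z))) = (\<Sum>i\<in>I. sc (c i) (v i))"
    unfolding sum.reindex[OF e] o_def by (rule sum.cong) (simp_all only: g)
  have "\<forall>z\<in>e ` I. c (?g z) = 0"
    by (rule ind[unfolded independent_family_def, THEN spec, THEN mp]) (simp only: eq s)
  then have "c (?g (e i)) = 0" using i by blast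
  then show "c i = 0" by (simp only: g[OF i])
qed

section \<open>Modules over the double affine Hecke algebra\<close>

text \<open>The inverses are parameters, so that the polynomial representation and the modules built
  later can supply explicit ones. \<open>XY\<close> is the relation containing q, multiplied by X Y
  from the left, and \<open>TT\<close> is the quadratic relation expanded.\<close>

locale daha = complex_vector_space sc
  for sc :: "complex \<Rightarrow> 'v::ab_group_add \<Rightarrow> 'v" +
  fixes qh th :: complex and X Xi Y Yi T :: "'v \<Rightarrow> 'v"
  assumes qh_nonzero: "qh \<noteq> 0" and th_nonzero: "th \<noteq> 0"
    and lin_X: "Vector_Spaces.linear sc sc X" and lin_Y: "Vector_Spaces.linear sc sc Y"
    and lin_T: "Vector_Spaces.linear sc sc T"
    and X_Xi [simp]: "X (Xi v) = v" and Xi_X [simp]: "Xi (X v) = v"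
    and Y_Yi [simp]: "Y (Yi v) = v" and Yi_Y [simp]: "Yi (Y v) = v"
    and TXT: "T (X (T v)) = Xi v" and TYT: "T (Yi (T v)) = Y v"
    and XY: "X (Y v) = sc qh (Y (X (T (T v))))"
    and TT: "T (T v) = sc (th - inverse th) (T v) + v"
begin

lemma lin_inverse:
  assumes "linear_op A" "\<And>v. A (B v) = v" "\<And>v. B (A v) = v"
  shows "linear_op B"
proof (rule linear_opI)
  show "B (u + v) = B u + B v" for u v
    by (metis assms(2,3) linear_op_simps(1)[OF assms(1)])
  show "B (sc a v) = sc a (B v)" for a v
    by (metis assms(2,3) linear_op_simps(2)[OF assms(1)])
qed

lemma lin_Xi: "linear_op Xi" and lin_Yi: "linear_op Yi"
  by (rule lin_inverse[OF lin_X], simp_all) (rule lin_inverse[OF lin_Y], simp_all)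

lemmas op_simps =
  linear_op_simps[OF lin_X] linear_op_simps[OF lin_Y] linear_op_simps[OF lin_T]
  linear_op_simps[OF lin_Xi] linear_op_simps[OF lin_Yi]

definition \<delta> :: complex where "\<delta> = th - inverse th"

lemma T_T: "T (T v) = sc \<delta> (T v) + v"
  using TT by (simp add: \<delta>_def)

text \<open>Hence T - \<delta> is the inverse of T; throughout, \<open>T v - sc \<delta> v\<close>
  is to be read as T^-1 v.\<close>

lemma T_Ti: "T (T v - sc \<delta> v) = v"
  by (simp add: op_simps T_T)

lemma Ti_T: "T (T v) - sc \<delta> (T v) = v"
  by (simp add: T_T)

lemma Y_T: "Y (T v) = T (Yi v) + sc \<delta> (Y v)"
proof -
  have "T (Yi v) = T (Yi (T (T v - sc \<delta> v)))" by (simp only: T_Ti)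
  also have "\<dots> = Y (T v) - sc \<delta> (Y v)" by (simp only: TYT op_simps)
  finally show ?thesis by simp
qed

lemma Yi_T: "Yi (T v) = T (Y v) - sc \<delta> (Y v)"
  using Ti_T[of "Yi (T v)"] by (simp add: TYT)

lemma T_X: "T (X v) = Xi (T v) - sc \<delta> (Xi v)"
proof -
  have "T (X v) = T (X (T (T v - sc \<delta> v)))" by (simp only: T_Ti)
  also have "\<dots> = Xi (T v) - sc \<delta> (Xi v)" by (simp only: TXT op_simps)
  finally show ?thesis .
qed

lemma T_Xi: "T (Xi v) = X (T v) + sc \<delta> (Xi v)"
  using Ti_T[of "X (T v)"] by (simp add: TXT algebra_simps)

section \<open>The involution X T and the intertwiner\<close>

definition \<Pi> :: "'v \<Rightarrow> 'v" where "\<Pi> v = X (T v)"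

lemma lin_\<Pi>: "linear_op \<Pi>"
  by (rule linear_opI) (simp_all add: \<Pi>_def op_simps)

lemma \<Pi>_\<Pi> [simp]: "\<Pi> (\<Pi> v) = v"
  by (simp add: \<Pi>_def TXT)

text \<open>The relation containing q, applied to T^-1 v: one factor of T^2 remains and combines
  with X to \<Pi>. \<open>daha_from_involution\<close> reads this backwards.\<close>

lemma Y_\<Pi>: "Y (\<Pi> v) = sc (inverse qh) (\<Pi> (Yi v))"
proof -
  have "T (T (T v - sc \<delta> v)) = T v" by (simp only: T_Ti)
  then have "X (Y (T v - sc \<delta> v)) = sc qh (Y (\<Pi> v))"
    using XY[of "T v - sc \<delta> v"] by (simp add: \<Pi>_def)
  moreover have "Y (T v - sc \<delta> v) = T (Yi v)"
    by (simp add: op_simps Y_T)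
  ultimately have "\<Pi> (Yi v) = sc qh (Y (\<Pi> v))" by (simp add: \<Pi>_def)
  then show ?thesis using qh_nonzero by simp
qed

lemma Yi_\<Pi>: "Yi (\<Pi> v) = sc qh (\<Pi> (Y v))"
proof -
  have "Y (sc qh (\<Pi> (Y v))) = \<Pi> v"
    using qh_nonzero by (simp add: op_simps Y_\<Pi>)
  then show ?thesis by (metis Yi_Y)
qed

text \<open>The intertwiner between opposite weights, cleared of its denominator.\<close>
definition E :: "'v \<Rightarrow> 'v" where "E v = T (Yi (Yi v)) - T v + sc \<delta> v"

lemma lin_E: "linear_op E"
  by (rule linear_opI) (simp_all add: E_def op_simps algebra_simps)

lemma Y_E: "Y (E v) = E (Yi v)"
  by (simp add: E_def op_simps Y_T)

lemma Yi_E: "Yi (E v) = E (Y v)"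
  by (metis Y_E Yi_Y)

lemma E_E: "E (E v) = sc (2 + \<delta>\<^sup>2) v - Y (Y v) - Yi (Yi v)"
proof -
  have "E (E v) = T (E (Y (Y v))) - T (E v) + sc \<delta> (E v)"
    by (simp only: E_def[of "E v"] Yi_E)
  also have "\<dots> = T (T v) - T (T (Y (Y v))) + sc \<delta> (T (Y (Y v)))
      - T (T (Yi (Yi v))) + T (T v) - sc \<delta> (T v) + sc \<delta> (T (Yi (Yi v)))
      - sc \<delta> (T v) + sc (\<delta>\<^sup>2) v"
    by (simp add: E_def op_simps algebra_simps power2_eq_square)
  also have "\<dots> = sc (2 + \<delta>\<^sup>2) v - Y (Y v) - Yi (Yi v)"
    using scale_left_distrib[of 1 1 v] by (simp add: T_T algebra_simps)
  finally show ?thesis .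
qed

section \<open>Submodules and their weights\<close>

definition stable :: "'v set \<Rightarrow> bool" where
  "stable U \<longleftrightarrow> subspace U \<and> (\<forall>v\<in>U. X v \<in> U \<and> Xi v \<in> U \<and> Y v \<in> U \<and> Yi v \<in> U \<and> T v \<in> U)"

lemma stable_subspace: "stable U \<Longrightarrow> subspace U"
  and stable_X: "stable U \<Longrightarrow> v \<in> U \<Longrightarrow> X v \<in> U"
  and stable_Xi: "stable U \<Longrightarrow> v \<in> U \<Longrightarrow> Xi v \<in> U"
  and stable_Y: "stable U \<Longrightarrow> v \<in> U \<Longrightarrow> Y v \<in> U"
  and stable_Yi: "stable U \<Longrightarrow> v \<in> U \<Longrightarrow> Yi v \<in> U"
  and stable_T: "stable U \<Longrightarrow> v \<in> U \<Longrightarrow> T v \<in> U"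
  by (auto simp: stable_def)

lemma stable_\<Pi>: "stable U \<Longrightarrow> v \<in> U \<Longrightarrow> \<Pi> v \<in> U"
  by (simp add: \<Pi>_def stable_X stable_T)

lemma stable_E: "stable U \<Longrightarrow> v \<in> U \<Longrightarrow> E v \<in> U"
  by (simp add: E_def stable_Yi stable_T subspace_add subspace_diff subspace_scale stable_subspace)

text \<open>X = \<Pi> T^-1 and X^-1 = T \<Pi>, so stability under the two factors is enough for
  X.\<close>

lemma stableI_\<Pi>:
  assumes U: "subspace U" and \<Pi>: "\<And>v. v \<in> U \<Longrightarrow> \<Pi> v \<in> U" and T: "\<And>v. v \<in> U \<Longrightarrow> T v \<in> U"
    and Y: "\<And>v. v \<in> U \<Longrightarrow> Y v \<in> U" "\<And>v. v \<in> U \<Longrightarrow> Yi v \<in> U"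
  shows "stable U"
proof -
  have "X v \<in> U" if "v \<in> U" for v
  proof -
    have "X v = \<Pi> (T v - sc \<delta> v)" by (simp only: \<Pi>_def T_Ti)
    then show ?thesis using U \<Pi> T that by (simp add: subspace_diff subspace_scale)
  qed
  moreover have "Xi v \<in> U" if "v \<in> U" for v
    using \<Pi> T that by (simp add: TXT[symmetric] \<Pi>_def[symmetric])
  ultimately show ?thesis using assms by (simp add: stable_def)
qed

lemma stable_UNIV: "stable UNIV"
  by (simp add: stable_def)

text \<open>Weights are taken inside a subspace U, because irreducibility of the quotients is proved
  by counting weights in an arbitrary submodule.\<close>

definition spec :: "'v set \<Rightarrow> complex set" where
  "spec U = {y. \<exists>v\<in>U. v \<noteq> 0 \<and> Y v = sc y v}"

lemma eigenvalue_nonzero: "v \<noteq> 0 \<Longrightarrow> Y v = sc y v \<Longrightarrow> y \<noteq> 0"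
  by (metis Yi_Y linear_op_simps(3)[OF lin_Yi] scale_zero_left)

lemma Yi_eigen:
  assumes "Y v = sc y v"
  shows "Yi v = sc (inverse y) v"
proof (cases "v = 0")
  case False
  have "v = sc y (Yi v)" using assms Yi_Y[of v] by (simp add: op_simps)
  then show ?thesis using eigenvalue_nonzero[OF False assms]
    by (metis left_inverse scale_one scale_scale)
qed (simp add: op_simps)

lemma \<Pi>_eigen: "Y v = sc y v \<Longrightarrow> Y (\<Pi> v) = sc (inverse (qh * y)) (\<Pi> v)"
  using Yi_eigen[of v y] by (simp add: Y_\<Pi> linear_op_simps[OF lin_\<Pi>])

lemma E_eigen: "Y v = sc y v \<Longrightarrow> Y (E v) = sc (inverse y) (E v)"
  using Yi_eigen[of v y] by (simp add: Y_E linear_op_simps[OF lin_E])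

lemma \<Pi>_eq_0_iff [simp]: "\<Pi> v = 0 \<longleftrightarrow> v = 0"
  by (metis \<Pi>_\<Pi> linear_op_simps(3)[OF lin_\<Pi>])

lemma E_E_eigen:
  assumes "Y v = sc y v"
  shows "E (E v) = sc (2 + \<delta>\<^sup>2 - y\<^sup>2 - inverse y ^ 2) v"
  using assms Yi_eigen[OF assms]
  by (simp add: E_E op_simps scale_left_diff_distrib power2_eq_square)

lemma two_plus_\<delta>_sq: "2 + \<delta>\<^sup>2 = th\<^sup>2 + inverse th ^ 2"
  using th_nonzero by (simp add: \<delta>_def power2_eq_square field_simps)

lemma E_E_scalar_zero_iff:
  assumes "y \<noteq> 0"
  shows "2 + \<delta>\<^sup>2 - y\<^sup>2 - inverse y ^ 2 = 0 \<longleftrightarrow> y\<^sup>2 = th\<^sup>2 \<or> y\<^sup>2 = inverse (th\<^sup>2)"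
proof -
  have "2 + \<delta>\<^sup>2 - y\<^sup>2 - inverse y ^ 2 = - (y\<^sup>2 - th\<^sup>2) * (y\<^sup>2 - inverse (th\<^sup>2)) / y\<^sup>2"
    using assms th_nonzero unfolding two_plus_\<delta>_sq
    by (simp add: divide_simps power_inverse) (simp add: algebra_simps)
  then show ?thesis using assms by auto
qed

lemma E_eigen_nonzero:
  assumes "Y v = sc y v" "v \<noteq> 0" "y\<^sup>2 \<noteq> th\<^sup>2" "y\<^sup>2 \<noteq> inverse (th\<^sup>2)"
  shows "E v \<noteq> 0"
proof
  assume "E v = 0"
  then have "sc (2 + \<delta>\<^sup>2 - y\<^sup>2 - inverse y ^ 2) v = 0"
    using E_E_eigen[OF assms(1)] by (simp add: linear_op_simps[OF lin_E])
  then show False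
    using assms E_E_scalar_zero_iff eigenvalue_nonzero[OF assms(2,1)] by auto
qed

lemma spec_\<Pi>:
  assumes "stable U" "y \<in> spec U"
  shows "inverse (qh * y) \<in> spec U"
proof -
  obtain v where v: "v \<in> U" "v \<noteq> 0" "Y v = sc y v" using assms(2) by (auto simp: spec_def)
  show ?thesis unfolding spec_def
    using \<Pi>_eigen[OF v(3)] v(2) stable_\<Pi>[OF assms(1) v(1)] by (intro CollectI bexI[of _ "\<Pi> v"]) simp_all
qed

lemma spec_E:
  assumes "stable U" "y \<in> spec U" "y\<^sup>2 \<noteq> th\<^sup>2" "y\<^sup>2 \<noteq> inverse (th\<^sup>2)"
  shows "inverse y \<in> spec U"
proof -
  obtain v where v: "v \<in> U" "v \<noteq> 0" "Y v = sc y v" using assms(2) by (auto simp: spec_def)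
  show ?thesis unfolding spec_def
    using E_eigen[OF v(3)] E_eigen_nonzero[OF v(3,2) assms(3,4)] stable_E[OF assms(1) v(1)] by auto
qed

lemma spec_nonzero: "y \<in> spec U \<Longrightarrow> y \<noteq> 0"
  using eigenvalue_nonzero by (auto simp: spec_def)

end

subsection \<open>The record representation\<close>

abbreviation daha_of :: "complex \<Rightarrow> complex \<Rightarrow> ('v::ab_group_add) daha_rep \<Rightarrow> bool" where
  "daha_of qh th V \<equiv> daha (scal V) qh th (actX V) (inv (actX V)) (actY V) (inv (actY V)) (actT V)"

lemma daha_moduleD:
  assumes "daha_module qh th V" and nz: "qh \<noteq> 0" "th \<noteq> 0"
  shows "daha_of qh th V"
proof -
  from assms(1) have vs: "vector_space (scal V)"
    and lin: "Vector_Spaces.linear (scal V) (scal V) (actX V)"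
      "Vector_Spaces.linear (scal V) (scal V) (actY V)" "Vector_Spaces.linear (scal V) (scal V) (actT V)"
    and bij: "bij (actX V)" "bij (actY V)"
    and TXT: "actT V \<circ> actX V \<circ> actT V = inv (actX V)"
    and TYT: "actT V \<circ> inv (actY V) \<circ> actT V = actY V"
    and XY: "\<And>v. scal V qh (inv (actY V) (inv (actX V) (actY V (actX V (actT V (actT V v)))))) = v"
    and TT: "\<And>v. actT V (actT V v + scal V (inverse th) v)
      - scal V th (actT V v + scal V (inverse th) v) = 0"
    unfolding daha_module_def by blast+
  interpret complex_vector_space "scal V" by (intro complex_vector_space.intro vs)
  note b = bij_is_surj[OF bij(1), THEN surj_f_inv_f] bij_is_surj[OF bij(2), THEN surj_f_inv_f]
    bij_is_inj[OF bij(1), THEN inv_f_f] bij_is_inj[OF bij(2), THEN inv_f_f]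
  show ?thesis
  proof (intro daha.intro daha_axioms.intro complex_vector_space_axioms nz lin)
    show "actT V (actX V (actT V v)) = inv (actX V) v" for v using fun_cong[OF TXT, of v] by simp
    show "actT V (inv (actY V) (actT V v)) = actY V v" for v using fun_cong[OF TYT, of v] by simp
    show "actX V (actY V v) = scal V qh (actY V (actX V (actT V (actT V v))))" for v
    proof -
      have "actX V (actY V (scal V qh (inv (actY V) (inv (actX V) (actY V (actX V (actT V (actT V v)))))))) =
          scal V qh (actY V (actX V (actT V (actT V v))))"
        by (simp only: linear_op_simps[OF lin(1)] linear_op_simps[OF lin(2)] b)
      then show ?thesis by (simp only: XY)
    qed
    show "actT V (actT V v) = scal V (th - inverse th) (actT V v) + v" for v
      using TT[of v] nz by (simp add: linear_op_simps[OF lin(3)] scale_right_distrib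
          scale_left_diff_distrib algebra_simps)
  qed (use b in auto)
qed

lemma (in daha) daha_moduleI:
  shows "daha_module qh th \<lparr>scal = sc, actX = X, actY = Y, actT = T\<rparr>"
    and "inv X = Xi" and "inv Y = Yi"
proof -
  show iX: "inv X = Xi" and iY: "inv Y = Yi" by (auto intro!: inv_equality)
  have "bij X" "bij Y"
    by (auto intro!: o_bij[of Xi X] o_bij[of Yi Y])
  moreover have "sc qh (Yi (Xi (Y (X (T (T v)))))) = v" for v
  proof -
    have "sc qh (Yi (Xi (Y (X (T (T v)))))) = Yi (Xi (sc qh (Y (X (T (T v))))))"
      by (simp add: op_simps)
    then show ?thesis by (simp add: XY[symmetric])
  qed
  moreover have "T (T v + sc (inverse th) v) - sc th (T v + sc (inverse th) v) = 0" for v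
    using th_nonzero by (simp add: op_simps TT scale_right_distrib scale_left_diff_distrib)
  ultimately show "daha_module qh th \<lparr>scal = sc, actX = X, actY = Y, actT = T\<rparr>"
    unfolding daha_module_def
    using vector_space_axioms lin_X lin_Y lin_T by (simp add: iX iY fun_eq_iff TXT TYT)
qed

lemma daha_of_daha_module:
  assumes "daha (scal V) qh th (actX V) Xi (actY V) Yi (actT V)"
  shows "daha_module qh th V"
  using daha.daha_moduleI(1)[OF assms] by (cases V) simp

lemma submodule_iff_stable:
  assumes "daha_of qh th V"
  shows "submodule V U \<longleftrightarrow> daha.stable (scal V) (actX V) (inv (actX V)) (actY V) (inv (actY V)) (actT V) U"
  unfolding submodule_def daha.stable_def[OF assms] ..

section \<open>Laurent polynomials\<close>

lemma laurent_induct [case_names single add]: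
  fixes p :: laurent
  assumes "\<And>n c. P (Poly_Mapping.single n c)" and "\<And>p q. P p \<Longrightarrow> P q \<Longrightarrow> P (p + q)"
  shows "P p"
proof -
  have "P (\<Sum>n\<in>S. Poly_Mapping.single n (Poly_Mapping.lookup p n))" if "finite S" for S
    using that
  proof (induction S rule: finite_induct)
    case empty
    show ?case using assms(1)[of 0 0] by simp
  qed (auto intro: assms)
  moreover have "(\<Sum>n\<in>Poly_Mapping.keys p. Poly_Mapping.single n (Poly_Mapping.lookup p n)) = p"
    by (rule poly_mapping_eqI)
      (auto simp: lookup_sum lookup_single when_def in_keys_iff)
  ultimately show ?thesis by (metis finite_keys)
qed

lemma single_eq_const_mult: "Poly_Mapping.single n c = const c * Xpow n"
  by (simp add: mult_single)

lemma const_add: "const (a + b) = const a + const b"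
  by (simp add: single_add)

lemma const_mult: "const (a * b) = const a * const b"
  by (simp add: mult_single)

lemma const_diff: "const (a - b) = const a - const b"
  by (simp add: single_diff)

lemma invert_var_superset:
  assumes "finite S" "Poly_Mapping.keys p \<subseteq> S"
  shows "invert_var a p = (\<Sum>n\<in>S. Poly_Mapping.single (- n) (Poly_Mapping.lookup p n * a powi n))"
  unfolding invert_var_def using assms
  by (intro sum.mono_neutral_left) (auto simp: in_keys_iff)

lemma invert_var_add: "invert_var a (p + q) = invert_var a p + invert_var a q"
proof -
  let ?S = "Poly_Mapping.keys p \<union> Poly_Mapping.keys q"
  have "finite ?S" by simp
  note * = invert_var_superset[OF this]
  show ?thesis
    using keys_add[of p q]
    by (simp add: *[of p] *[of q] *[of "p + q"] lookup_add sum.distrib[symmetric] single_add distrib_right)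
qed

lemma invert_var_single:
  "invert_var a (Poly_Mapping.single n c) = Poly_Mapping.single (- n) (c * a powi n)"
  by (subst invert_var_superset[of "{n}"]) auto

lemma invert_var_mult:
  assumes "a \<noteq> 0"
  shows "invert_var a (p * q) = invert_var a p * invert_var a q"
proof (induction p rule: laurent_induct)
  case (single n c)
  show ?case
  proof (induction q rule: laurent_induct)
    case (single m d)
    show ?case using assms
      by (simp add: mult_single invert_var_single power_int_add mult_ac add_ac)
  qed (simp add: distrib_left invert_var_add)
qed (simp add: distrib_right invert_var_add)

lemma invert_var_invert_var:
  assumes "a \<noteq> 0"
  shows "invert_var a (invert_var a p) = p"
  by (induction p rule: laurent_induct)
    (use assms in \<open>simp_all add: invert_var_add invert_var_single power_int_minus mult.assoc\<close>)

lemma invert_var_const [simp]: "invert_var a (const c) = const c"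
  by (simp add: invert_var_single)

lemma invert_var_one [simp]: "invert_var a 1 = 1"
  using invert_var_const[of a 1] by simp

lemma invert_var_uminus: "invert_var a (- p) = - invert_var a p"
  using invert_var_add[of a p "- p"] invert_var_const[of a 0] by (simp add: eq_neg_iff_add_eq_0 add.commute)

lemma invert_var_diff: "invert_var a (p - q) = invert_var a p - invert_var a q"
  using invert_var_add[of a p "- q"] by (simp add: invert_var_uminus)

lemmas refl_s_mult = invert_var_mult[of 1, OF one_neq_zero]

lemma Xpow_2: "Xpow 2 = Xpow 1 * Xpow 1"
  by (simp add: mult_single)

lemma Xpow_inverse: "Xpow 1 * Xpow (- 1) = (1 :: laurent)"
  by (simp add: mult_single)

lemma X_sq_minus_1_nonzero: "Xpow 2 - 1 \<noteq> (0 :: laurent)"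
proof
  assume "Xpow 2 - 1 = (0 :: laurent)"
  then have "Poly_Mapping.lookup (Xpow 2) 2 = Poly_Mapping.lookup (1 :: laurent) 2" by simp
  then show False by (simp add: lookup_one)
qed

text \<open>The property passes to products, since s(p q) - p q = s(p) (s(q) - q) + (s(p) - p) q. So
  constants, X and X^-1 suffice.\<close>

lemma demazure_exists: "(Xpow 2 - 1) dvd (refl_s p - p)"
proof (induction p rule: laurent_induct)
  case (single n c)
  let ?P = "\<lambda>p. (Xpow 2 - 1) dvd (refl_s p - p)"
  have mult: "?P (p * q)" if "?P p" "?P q" for p q
  proof -
    have "refl_s (p * q) - p * q = refl_s p * (refl_s q - q) + (refl_s p - p) * q"
      by (simp add: refl_s_mult algebra_simps)
    then show ?thesis using that by simp
  qed
  have one: "?P (Xpow 1)"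
  proof (rule dvdI)
    show "refl_s (Xpow 1) - Xpow 1 = (Xpow 2 - 1) * (- Xpow (- 1))"
      by (simp add: invert_var_single mult_single algebra_simps)
  qed
  have minus_one: "?P (Xpow (- 1))"
  proof (rule dvdI)
    show "refl_s (Xpow (- 1)) - Xpow (- 1) = (Xpow 2 - 1) * Xpow (- 1)"
      by (simp add: invert_var_single mult_single algebra_simps)
  qed
  have "?P (Xpow n)"
  proof (induction n rule: int_induct[where k = 0])
    case base
    show ?case by (simp add: invert_var_single)
  next
    case (step1 i)
    then show ?case using mult[OF step1(2) one] by (simp add: mult_single)
  next
    case (step2 i)
    then show ?case using mult[OF step2(2) minus_one] by (simp add: mult_single)
  qed
  then show ?case
    unfolding single_eq_const_mult[of n c] by (intro mult) simp_all
next
  case (add p q)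
  have "refl_s (p + q) - (p + q) = (refl_s p - p) + (refl_s q - q)"
    by (simp add: invert_var_add)
  then show ?case by (simp only: dvd_add[OF add])
qed

lemma demazure_eqI: "(Xpow 2 - 1) * r = refl_s p - p \<Longrightarrow> demazure p = r"
  unfolding demazure_def
  by (rule the_equality) (use X_sq_minus_1_nonzero in \<open>metis mult_left_cancel\<close>)+

lemma demazure_eq: "(Xpow 2 - 1) * demazure p = refl_s p - p"
  using demazure_exists[of p] demazure_eqI by (metis dvdE)

lemma demazure_add: "demazure (p + q) = demazure p + demazure q"
  by (rule demazure_eqI) (simp add: distrib_left demazure_eq invert_var_add)

lemma demazure_mult: "demazure (p * q) = refl_s p * demazure q + demazure p * q"
proof (rule demazure_eqI)
  have "(Xpow 2 - 1) * (refl_s p * demazure q + demazure p * q)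
      = refl_s p * ((Xpow 2 - 1) * demazure q) + ((Xpow 2 - 1) * demazure p) * q"
    by (simp add: algebra_simps)
  also have "\<dots> = refl_s (p * q) - p * q"
    unfolding demazure_eq by (simp add: refl_s_mult algebra_simps)
  finally show "(Xpow 2 - 1) * (refl_s p * demazure q + demazure p * q) = refl_s (p * q) - p * q" .
qed

lemma demazure_const [simp]: "demazure (const c) = 0"
  by (rule demazure_eqI) simp

lemma demazure_X: "demazure (Xpow 1) = - Xpow (- 1)"
  by (rule demazure_eqI) (simp add: invert_var_single mult_single algebra_simps)

lemma demazure_X_inv: "demazure (Xpow (- 1)) = Xpow (- 1)"
  by (rule demazure_eqI) (simp add: invert_var_single mult_single algebra_simps)

lemma poly_T_add: "poly_T th (p + q) = poly_T th p + poly_T th q"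
  by (simp add: poly_T_def invert_var_add demazure_add algebra_simps)

lemma poly_T_const_mult: "poly_T th (const c * p) = const c * poly_T th p"
  by (simp add: poly_T_def refl_s_mult demazure_mult algebra_simps)

text \<open>Linearity over symmetric polynomials makes the ideal of a symmetric g stable under
  T.\<close>

lemma poly_T_symmetric_mult: "refl_s g = g \<Longrightarrow> poly_T th (g * p) = g * poly_T th p"
proof -
  assume g: "refl_s g = g"
  then have "demazure g = 0" by (intro demazure_eqI) simp
  then show ?thesis by (simp add: poly_T_def refl_s_mult demazure_mult g algebra_simps)
qed

text \<open>Multiplying by X^2 - 1 removes the divided difference: T becomes a combination of p and
  s(p) with polynomial coefficients. Together with the companion for s(T p), this turns the Hecke
  relations into ring identities.\<close>

lemma poly_T_cleared:
  "(Xpow 1 * Xpow 1 - 1) * poly_T th p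
    = (const th * (Xpow 1 * Xpow 1) - const (inverse th)) * refl_s p - (const th - const (inverse th)) * p"
proof -
  have "(Xpow 2 - 1) * poly_T th p
      = const th * (Xpow 2 - 1) * refl_s p + const (th - inverse th) * ((Xpow 2 - 1) * demazure p)"
    by (simp add: poly_T_def algebra_simps)
  then show ?thesis
    unfolding demazure_eq by (simp add: Xpow_2 const_diff algebra_simps)
qed

lemma refl_s_poly_T_cleared:
  "(Xpow 1 * Xpow 1 - 1) * refl_s (poly_T th p)
    = (const th - const (inverse th)) * (Xpow 1 * Xpow 1) * refl_s p
      - (const th - const (inverse th) * (Xpow 1 * Xpow 1)) * p"
proof -
  define a b u ui where "a = (Xpow 1 :: laurent)" and "b = (Xpow (- 1) :: laurent)"
    and "u = const th" and "ui = const (inverse th)"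
  have ab: "a * b = 1" unfolding a_def b_def by (rule Xpow_inverse)
  have s: "refl_s a = b" "refl_s u = u" "refl_s ui = ui"
    by (simp_all add: a_def b_def u_def ui_def invert_var_single)
  \<comment> \<open>Applying s to the cleared identity replaces X^2 - 1 by X^-2 - 1; the relation a
    b = 1 converts it back.\<close>
  have "(b * b - 1) * refl_s (poly_T th p) = (u * (b * b) - ui) * p - (u - ui) * refl_s p"
    using arg_cong[OF poly_T_cleared[of th p], of refl_s]
    by (simp add: refl_s_mult invert_var_diff invert_var_invert_var s
        a_def[symmetric] u_def[symmetric] ui_def[symmetric])
  then show ?thesis
    unfolding a_def[symmetric] u_def[symmetric] ui_def[symmetric]
    using ab by algebra
qed

text \<open>Two factors, one for each of the two applications of T in the relations.\<close>

lemma X_sq_cancel: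
  assumes "(Xpow 1 * Xpow 1 - 1) * ((Xpow 1 * Xpow 1 - 1) * p) = (Xpow 1 * Xpow 1 - 1) * ((Xpow 1 * Xpow 1 - 1) * q)"
  shows "p = (q :: laurent)"
  using assms X_sq_minus_1_nonzero unfolding Xpow_2 by simp

lemma const_inverse: "th \<noteq> 0 \<Longrightarrow> const th * const (inverse th) = 1"
  by (simp add: mult_single)

lemma poly_T_poly_T:
  assumes "th \<noteq> 0"
  shows "poly_T th (poly_T th p) = const (th - inverse th) * poly_T th p + p"
proof (rule X_sq_cancel)
  define a u ui where "a = (Xpow 1 :: laurent)" and "u = const th" and "ui = const (inverse th)"
  have u: "u * ui = 1" unfolding u_def ui_def using assms by (rule const_inverse)
  note * = poly_T_cleared[of th p] poly_T_cleared[of th "poly_T th p"] refl_s_poly_T_cleared[of th p]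
  show "(Xpow 1 * Xpow 1 - 1) * ((Xpow 1 * Xpow 1 - 1) * poly_T th (poly_T th p))
    = (Xpow 1 * Xpow 1 - 1) * ((Xpow 1 * Xpow 1 - 1) * (const (th - inverse th) * poly_T th p + p))"
    using * u unfolding const_diff a_def[symmetric] u_def[symmetric] ui_def[symmetric]
    by algebra
qed

lemma poly_T_X_poly_T:
  assumes "th \<noteq> 0"
  shows "poly_T th (Xpow 1 * poly_T th p) = Xpow (- 1) * p"
proof (rule X_sq_cancel)
  define a b u ui where "a = (Xpow 1 :: laurent)" and "b = (Xpow (- 1) :: laurent)"
    and "u = const th" and "ui = const (inverse th)"
  have u: "u * ui = 1" unfolding u_def ui_def using assms by (rule const_inverse)
  have ab: "a * b = 1" unfolding a_def b_def by (rule Xpow_inverse)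
  have s: "refl_s a = b" by (simp add: a_def b_def invert_var_single)
  have "refl_s (a * poly_T th p) = b * refl_s (poly_T th p)" by (simp add: refl_s_mult s)
  note * = poly_T_cleared[of th p] poly_T_cleared[of th "a * poly_T th p", unfolded this]
    refl_s_poly_T_cleared[of th p]
  show "(Xpow 1 * Xpow 1 - 1) * ((Xpow 1 * Xpow 1 - 1) * poly_T th (Xpow 1 * poly_T th p))
    = (Xpow 1 * Xpow 1 - 1) * ((Xpow 1 * Xpow 1 - 1) * (Xpow (- 1) * p))"
    using * u ab unfolding a_def[symmetric] b_def[symmetric] u_def[symmetric] ui_def[symmetric]
    by algebra
qed

lemma vector_space_laurent: "vector_space (\<lambda>c (p::laurent). const c * p)"
  by unfold_locales (simp_all add: algebra_simps const_add const_mult)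

lemma refl_pi_mult: "qh \<noteq> 0 \<Longrightarrow> refl_pi qh (p * q) = refl_pi qh p * refl_pi qh q"
  by (rule invert_var_mult)

lemma daha_poly_rep:
  assumes "qh \<noteq> 0" "th \<noteq> 0"
  shows "daha (\<lambda>c p. const c * p) qh th (\<lambda>p. Xpow 1 * p) (\<lambda>p. Xpow (- 1) * p)
    (\<lambda>p. refl_pi qh (poly_T th p))
    (\<lambda>p. poly_T th (refl_pi qh p) - const (th - inverse th) * refl_pi qh p) (poly_T th)"
proof -
  interpret complex_vector_space "\<lambda>c (p::laurent). const c * p"
    by (rule complex_vector_space.intro) (rule vector_space_laurent)
  have diff: "poly_T th (p - q) = poly_T th p - poly_T th q" for p q
    using poly_T_add[of th "p - q" q] by simp
  have Ti: "poly_T th (poly_T th p - const (th - inverse th) * p) = p" for p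
    using poly_T_poly_T[OF assms(2), of p] by (simp add: diff poly_T_const_mult)
  have pi: "refl_pi qh (refl_pi qh p) = p" for p
    using assms by (intro invert_var_invert_var)
  show ?thesis
  proof (intro daha.intro daha_axioms.intro complex_vector_space_axioms assms linear_opI)
    show "poly_T th (Xpow 1 * poly_T th v) = Xpow (- 1) * v" for v
      using assms(2) by (rule poly_T_X_poly_T)
    show "poly_T th (poly_T th v) = const (th - inverse th) * poly_T th v + v" for v
      using assms(2) by (rule poly_T_poly_T)
    show "Xpow 1 * (Xpow (- 1) * v) = v" "Xpow (- 1) * (Xpow 1 * v) = v" for v :: laurent
      using Xpow_inverse by (metis mult.assoc mult.commute mult_1)+
    show "refl_pi qh (poly_T th (poly_T th (refl_pi qh v) - const (th - inverse th) * refl_pi qh v)) = v" for v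
      by (simp only: Ti pi)
    show "poly_T th (refl_pi qh (refl_pi qh (poly_T th v)))
        - const (th - inverse th) * refl_pi qh (refl_pi qh (poly_T th v)) = v" for v
      by (simp add: pi poly_T_poly_T[OF assms(2)])
    show "poly_T th (poly_T th (refl_pi qh (poly_T th v)) - const (th - inverse th) * refl_pi qh (poly_T th v))
        = refl_pi qh (poly_T th v)" for v
      by (rule Ti)
    \<comment> \<open>T X T = X^-1 reduces the right-hand side to q^(1/2) times the image of X^-1 T
      v under \<open>refl_pi\<close>, which sends X^-1 to q^(-1/2) X.\<close>
    show "Xpow 1 * refl_pi qh (poly_T th v)
        = const qh * refl_pi qh (poly_T th (Xpow 1 * poly_T th (poly_T th v)))" for v
      using assms by (simp add: poly_T_X_poly_T refl_pi_mult invert_var_single mult.assoc[symmetric] mult_single)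
  qed (simp_all add: distrib_left mult.left_commute poly_T_add poly_T_const_mult invert_var_add refl_pi_mult assms)
qed

lemma poly_rep_simps [simp]:
  "scal (poly_rep qh th) = (\<lambda>c p. const c * p)" "actX (poly_rep qh th) = (\<lambda>p. Xpow 1 * p)"
  "actY (poly_rep qh th) = (\<lambda>p. refl_pi qh (poly_T th p))" "actT (poly_rep qh th) = poly_T th"
  by (simp_all add: poly_rep_def)

section \<open>Division by a trinomial\<close>

abbreviation trinomial :: "int \<Rightarrow> complex \<Rightarrow> laurent" where
  "trinomial m c \<equiv> Xpow m + Xpow (- m) + const c"

text \<open>Both extreme coefficients of the trinomial are 1, so a monomial leaving the window of
  exponents from 1 - m to m on either side folds back into it. The window has 2m exponents, the
  dimension of the quotient by the ideal.\<close>

lemma laurent_division: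
  assumes "m \<ge> 1"
  shows "\<exists>q c. p = trinomial m b * q + (\<Sum>j\<in>{1 - m..m}. Poly_Mapping.single j (c j))"
proof -
  let ?Q = "\<lambda>p. \<exists>q c. p = trinomial m b * q + (\<Sum>j\<in>{1 - m..m}. Poly_Mapping.single j (c j))"
  have add: "?Q (p1 + p2)" if Q1: "?Q p1" and Q2: "?Q p2" for p1 p2
  proof -
    obtain q1 c1 where "p1 = trinomial m b * q1 + (\<Sum>j\<in>{1 - m..m}. Poly_Mapping.single j (c1 j))"
      using Q1 by blast
    moreover obtain q2 c2 where "p2 = trinomial m b * q2 + (\<Sum>j\<in>{1 - m..m}. Poly_Mapping.single j (c2 j))"
      using Q2 by blast
    ultimately have "p1 + p2 = trinomial m b * (q1 + q2) + (\<Sum>j\<in>{1 - m..m}. Poly_Mapping.single j (c1 j + c2 j))"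
      by (simp add: single_add sum.distrib distrib_left)
    then show ?thesis by (intro exI)
  qed
  have ideal: "?Q (trinomial m b * q)" for q
    by (rule exI[of _ q], rule exI[of _ "\<lambda>_. 0"]) simp
  have in_range: "?Q (Poly_Mapping.single i d)" if "i \<in> {1 - m..m}" for i d
  proof (rule exI[of _ 0], rule exI[of _ "\<lambda>j. if j = i then d else 0"])
    have "(\<Sum>j\<in>{1 - m..m}. Poly_Mapping.single j (if j = i then d else 0))
        = (\<Sum>j\<in>{1 - m..m}. if j = i then Poly_Mapping.single i d else 0)"
      by (rule sum.cong) auto
    then show "Poly_Mapping.single i d
        = trinomial m b * 0 + (\<Sum>j\<in>{1 - m..m}. Poly_Mapping.single j (if j = i then d else 0))"
      using that by simp
  qed
  have sum: "?Q (\<Sum>j\<in>J. f j)" if "finite J" "\<And>j. j \<in> J \<Longrightarrow> ?Q (f j)" for J :: "int set" and f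
    using that
  proof (induction J rule: finite_induct)
    case empty
    show ?case using ideal[of 0] by simp
  next
    case (insert a J)
    have "?Q (f a + sum f J)"
      by (rule add) (rule insert.prems, simp, rule insert.IH, rule insert.prems, simp)
    then show ?case by (simp only: sum.insert[OF insert.hyps])
  qed
  have up: "?Q (Xpow 1 * p)" if p: "?Q p" for p
  proof -
    obtain q c where p: "p = trinomial m b * q + (\<Sum>j\<in>{1 - m..m}. Poly_Mapping.single j (c j))"
      using p by blast
    have "?Q (Poly_Mapping.single (1 + j) (c j))" if "j \<in> {1 - m..m}" for j
    proof (cases "j = m")
      case True
      \<comment> \<open>X^(m+1) = X (X^m + X^-m + b) - X^(1-m) - b X.\<close>
      have *: "Poly_Mapping.single (1 + j) (c j)
          = trinomial m b * Poly_Mapping.single 1 (c j) + (Poly_Mapping.single (1 - m) (- c j) +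
          Poly_Mapping.single 1 (- b * c j))"
        unfolding True by (simp add: distrib_right mult_single single_uminus add.commute)
      show ?thesis unfolding * by (intro add ideal in_range) (use assms in auto)
    next
      case False
      then show ?thesis using that by (intro in_range) auto
    qed
    then have "?Q (trinomial m b * (Xpow 1 * q) + (\<Sum>j\<in>{1 - m..m}. Poly_Mapping.single (1 + j) (c j)))"
      by (intro add ideal sum) auto
    moreover have "Xpow 1 * p = trinomial m b * (Xpow 1 * q) + (\<Sum>j\<in>{1 - m..m}. Poly_Mapping.single (1 + j) (c j))"
      unfolding p by (simp only: distrib_left sum_distrib_left mult_single mult_1 mult.left_commute[of "Xpow 1" "trinomial m b"])
    ultimately show ?thesis by (simp only:)
  qed
  have down: "?Q (Xpow (- 1) * p)" if p: "?Q p" for p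
  proof -
    obtain q c where p: "p = trinomial m b * q + (\<Sum>j\<in>{1 - m..m}. Poly_Mapping.single j (c j))"
      using p by blast
    have "?Q (Poly_Mapping.single (- 1 + j) (c j))" if "j \<in> {1 - m..m}" for j
    proof (cases "j = 1 - m")
      case True
      have *: "Poly_Mapping.single (- 1 + j) (c j)
          = trinomial m b * Poly_Mapping.single 0 (c j) + (Poly_Mapping.single m (- c j) +
          Poly_Mapping.single 0 (- b * c j))"
        unfolding True by (simp add: distrib_right mult_single single_uminus add.commute)
      show ?thesis unfolding * by (intro add ideal in_range) (use assms in auto)
    next
      case False
      then show ?thesis using that by (intro in_range) auto
    qed
    then have "?Q (trinomial m b * (Xpow (- 1) * q) + (\<Sum>j\<in>{1 - m..m}. Poly_Mapping.single (- 1 + j) (c j)))"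
      by (intro add ideal sum) auto
    moreover have "Xpow (- 1) * p = trinomial m b * (Xpow (- 1) * q) + (\<Sum>j\<in>{1 - m..m}. Poly_Mapping.single (- 1 + j) (c j))"
      unfolding p by (simp only: distrib_left sum_distrib_left mult_single mult_1 mult.left_commute[of "Xpow (- 1)" "trinomial m b"])
    ultimately show ?thesis by (simp only:)
  qed
  show ?thesis
  proof (induction p rule: laurent_induct)
    case (single n c)
    show ?case
    proof (induction n rule: int_induct[where k = 0])
      case base
      show ?case by (rule in_range) (use assms in auto)
    next
      case (step1 i)
      show ?case using up[OF step1(2)] by (simp only: mult_single mult_1 add.commute)
    next
      case (step2 i)
      have "- 1 + i = i - 1" by simp
      then show ?case using down[OF step2(2)] by (simp only: mult_single mult_1)
    qed
  qed (rule add)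
qed

section \<open>Substituting operators into Laurent polynomials\<close>

locale invertible_op = complex_vector_space sc
  for sc :: "complex \<Rightarrow> 'v::ab_group_add \<Rightarrow> 'v" +
  fixes A Ai :: "'v \<Rightarrow> 'v"
  assumes lin_A: "Vector_Spaces.linear sc sc A"
    and A_Ai [simp]: "A (Ai v) = v" and Ai_A [simp]: "Ai (A v) = v"
begin

lemma lin_Ai: "linear_op Ai"
proof (rule linear_opI)
  show "Ai (u + v) = Ai u + Ai v" for u v
    by (metis A_Ai Ai_A linear_op_simps(1)[OF lin_A])
  show "Ai (sc a v) = sc a (Ai v)" for a v
    by (metis A_Ai Ai_A linear_op_simps(2)[OF lin_A])
qed

definition zpow :: "int \<Rightarrow> 'v \<Rightarrow> 'v" where
  "zpow n = (if 0 \<le> n then A ^^ nat n else Ai ^^ nat (- n))"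

lemma zpow_0 [simp]: "zpow 0 v = v"
  by (simp add: zpow_def)

lemma zpow_1 [simp]: "zpow 1 v = A v" "zpow (- 1) v = Ai v"
  by (simp_all add: zpow_def)

lemma zpow_plus_1: "zpow (n + 1) v = A (zpow n v)"
proof (cases "0 \<le> n")
  case True
  then show ?thesis by (simp add: zpow_def nat_add_distrib)
next
  case False
  then have "nat (- n) = Suc (nat (- (n + 1)))" by simp
  then show ?thesis using False by (auto simp: zpow_def)
qed

lemma zpow_minus_1: "zpow (n - 1) v = Ai (zpow n v)"
  using zpow_plus_1[of "n - 1" v] by simp

lemma zpow_add: "zpow (m + n) v = zpow m (zpow n v)"
proof (induction m rule: int_induct[where k = 0])
  case (step1 i)
  then show ?case using zpow_plus_1[of "i + n" v] zpow_plus_1[of i "zpow n v"] by (simp add: add_ac)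
next
  case (step2 i)
  then show ?case using zpow_minus_1[of "i + n" v] zpow_minus_1[of i "zpow n v"] by (simp add: algebra_simps)
qed simp

lemma lin_zpow: "linear_op (zpow n)"
proof (rule linear_opI)
  show "zpow n (u + v) = zpow n u + zpow n v" for u v
    by (induction n rule: int_induct[where k = 0])
      (simp_all add: zpow_plus_1 zpow_minus_1 linear_op_simps[OF lin_A] linear_op_simps[OF lin_Ai])
  show "zpow n (sc a v) = sc a (zpow n v)" for a v
    by (induction n rule: int_induct[where k = 0])
      (simp_all add: zpow_plus_1 zpow_minus_1 linear_op_simps[OF lin_A] linear_op_simps[OF lin_Ai])
qed

lemma zpow_eigen:
  assumes "A v = sc a v" "Ai v = sc (inverse a) v" "a \<noteq> 0"
  shows "zpow n v = sc (a powi n) v"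
proof (induction n rule: int_induct[where k = 0])
  case (step1 i)
  then show ?case using assms
    by (simp add: zpow_plus_1 linear_op_simps[OF lin_A] power_int_add)
next
  case (step2 i)
  then show ?case using assms
    by (simp add: zpow_minus_1 linear_op_simps[OF lin_Ai] power_int_diff divide_inverse)
qed simp

text \<open>This is p(A) v: the space becomes a module over the Laurent polynomials. With A = X and
  v a suitable eigenvector, p \<mapsto> \<open>ev p v\<close> will be the projection from the
  polynomial representation.\<close>

definition ev :: "laurent \<Rightarrow> 'v \<Rightarrow> 'v" where
  "ev p v = (\<Sum>n\<in>Poly_Mapping.keys p. sc (Poly_Mapping.lookup p n) (zpow n v))"

lemma ev_superset:
  assumes "finite S" "Poly_Mapping.keys p \<subseteq> S"
  shows "ev p v = (\<Sum>n\<in>S. sc (Poly_Mapping.lookup p n) (zpow n v))"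
  unfolding ev_def using assms by (intro sum.mono_neutral_left) (auto simp: in_keys_iff)

lemma ev_single: "ev (Poly_Mapping.single n c) v = sc c (zpow n v)"
  by (subst ev_superset[of "{n}"]) auto

lemma ev_add: "ev (p + q) v = ev p v + ev q v"
proof -
  let ?S = "Poly_Mapping.keys p \<union> Poly_Mapping.keys q"
  have "finite ?S" by simp
  note * = ev_superset[OF this]
  show ?thesis
    using keys_add[of p q]
    by (simp add: *[of p] *[of q] *[of "p + q"] lookup_add sum.distrib[symmetric] scale_left_distrib)
qed

lemma lin_ev: "linear_op (ev p)"
  by (rule linear_opI)
    (simp_all add: ev_def linear_op_simps[OF lin_zpow] scale_right_distrib sum.distrib scale_sum_right
      mult.commute)

lemma ev_mult: "ev (p * q) v = ev p (ev q v)"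
proof (induction p rule: laurent_induct)
  case (single n c)
  show ?case
  proof (induction q rule: laurent_induct)
    case (single m d)
    show ?case
      by (simp add: mult_single ev_single zpow_add linear_op_simps[OF lin_zpow])
  qed (simp add: distrib_left ev_add linear_op_simps[OF lin_ev])
qed (simp add: distrib_right ev_add)

lemma ev_zero [simp]: "ev 0 v = 0"
  by (simp add: ev_def)

lemma ev_one [simp]: "ev 1 v = v"
  using ev_single[of 0 1 v] by simp

lemma ev_const: "ev (const c) v = sc c v"
  by (simp add: ev_single)

lemma ev_const_mult: "ev (const c * p) v = sc c (ev p v)"
  by (simp add: ev_mult ev_const)

lemma ev_uminus: "ev (- p) v = - ev p v"
  using ev_add[of p "- p" v] by (simp add: eq_neg_iff_add_eq_0 add.commute)

lemma ev_sum: "ev (\<Sum>i\<in>I. f i) v = (\<Sum>i\<in>I. ev (f i) v)"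
  by (induction I rule: infinite_finite_induct) (simp_all add: ev_add)

lemma ev_Xpow: "ev (Xpow n) v = zpow n v"
  by (simp add: ev_single)

lemma ev_commute: "ev p (ev q v) = ev q (ev p v)"
  by (metis ev_mult mult.commute)

lemma ev_range_subspace: "subspace (range (\<lambda>p. ev p v))"
proof (rule subspaceI)
  show "0 \<in> range (\<lambda>p. ev p v)" by (rule range_eqI[of _ _ 0]) simp
  show "x + y \<in> range (\<lambda>p. ev p v)" if "x \<in> range (\<lambda>p. ev p v)" "y \<in> range (\<lambda>p. ev p v)" for x y
    using that by (auto simp: ev_add[symmetric])
  show "sc c x \<in> range (\<lambda>p. ev p v)" if "x \<in> range (\<lambda>p. ev p v)" for c x
    using that by (auto simp: ev_const_mult[symmetric])
qed

lemma ev_trinomial_span: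
  assumes "m \<ge> 1" "ev (trinomial m b) v = 0"
  shows "range (\<lambda>p. ev p v) \<subseteq> span ((\<lambda>j. zpow j v) ` {1 - m..m})"
proof clarify
  fix p
  obtain q c where p: "p = trinomial m b * q + (\<Sum>j\<in>{1 - m..m}. Poly_Mapping.single j (c j))"
    using laurent_division[OF assms(1)] by blast
  have "ev (trinomial m b * q) v = 0"
    by (simp only: mult.commute[of "trinomial m b"] ev_mult assms(2) linear_op_simps(3)[OF lin_ev])
  then have "ev p v = (\<Sum>j\<in>{1 - m..m}. sc (c j) (zpow j v))"
    by (simp only: p ev_add[of "trinomial m b * q"] ev_sum ev_single add_0)
  also have "\<dots> \<in> span ((\<lambda>j. zpow j v) ` {1 - m..m})"
    by (rule span_sum, rule span_scale, rule span_base, rule imageI)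
  finally show "ev p v \<in> span ((\<lambda>j. zpow j v) ` {1 - m..m})" .
qed

lemma dim_le_of_trinomial:
  assumes "m \<ge> 1" "ev (trinomial m b) v = 0" "range (\<lambda>p. ev p v) = UNIV"
  shows "dim (UNIV :: 'v set) \<le> nat (2 * m)" and "\<exists>F. finite F \<and> span F = UNIV"
proof -
  let ?F = "(\<lambda>j. zpow j v) ` {1 - m..m}"
  have span: "UNIV \<subseteq> span ?F" using ev_trinomial_span[OF assms(1,2)] assms(3) by simp
  have "dim (UNIV :: 'v set) \<le> card ?F"
    using dim_le_card[OF span] by simp
  also have "\<dots> \<le> card {1 - m..m}" by (rule card_image_le) simp
  finally show "dim (UNIV :: 'v set) \<le> nat (2 * m)" by simp
  show "\<exists>F. finite F \<and> span F = UNIV" using span by (intro exI[of _ ?F]) auto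
qed

text \<open>In dimension 2m the 2m vectors that span the module form a basis, so the remainder of
  any p in the kernel must vanish.\<close>

lemma kernel_ev_trinomial:
  assumes m: "m \<ge> 1" and tri: "ev (trinomial m b) v = 0" and gen: "range (\<lambda>p. ev p v) = UNIV"
    and dim: "dim (UNIV :: 'v set) = nat (2 * m)"
  shows "{p. ev p v = 0} = principal_ideal (trinomial m b)"
proof (intro set_eqI iffI)
  fix p assume "p \<in> {p. ev p v = 0}"
  then have p0: "ev p v = 0" by simp
  obtain q c where p: "p = trinomial m b * q + (\<Sum>j\<in>{1 - m..m}. Poly_Mapping.single j (c j))"
    using laurent_division[OF m] by blast
  have tq: "ev (trinomial m b * q) v = 0"
    by (simp only: mult.commute[of "trinomial m b"] ev_mult tri linear_op_simps(3)[OF lin_ev])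
  have c: "(\<Sum>j\<in>{1 - m..m}. sc (c j) (zpow j v)) = 0"
    using p0 by (simp only: p ev_add[of "trinomial m b * q"] ev_sum ev_single tq add_0)
  let ?F = "(\<lambda>j. zpow j v) ` {1 - m..m}"
  have span: "UNIV \<subseteq> span ?F" using ev_trinomial_span[OF m tri] gen by simp
  obtain B where B: "B \<subseteq> ?F" "independent B" "?F \<subseteq> span B" "card B = dim ?F"
    by (rule basis_exists)
  have dF: "dim ?F = nat (2 * m)"
    using span dim by (metis dim_span top.extremum_uniqueI)
  have cF: "card ?F \<le> card {1 - m..m}" by (rule card_image_le) simp
  have "B = ?F"
    using B(1,4) dF cF by (intro card_seteq) auto
  then have ind: "independent ?F" and card: "card ?F = card {1 - m..m}"
    using B dF by auto
  have inj: "inj_on (\<lambda>j. zpow j v) {1 - m..m}"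
    by (rule eq_card_imp_inj_on) (use card in auto)
  define d where "d x = c (inv_into {1 - m..m} (\<lambda>j. zpow j v) x)" for x
  have d: "d (zpow j v) = c j" if "j \<in> {1 - m..m}" for j
    unfolding d_def by (rule arg_cong[of _ _ c], rule inv_into_f_f[OF inj that])
  have "(\<Sum>x\<in>?F. sc (d x) x) = (\<Sum>j\<in>{1 - m..m}. sc (d (zpow j v)) (zpow j v))"
    unfolding sum.reindex[OF inj] by (simp only: o_def)
  also have "\<dots> = 0" unfolding c[symmetric] by (rule sum.cong) (simp_all only: d)
  finally have *: "(\<Sum>x\<in>?F. sc (d x) x) = 0" .
  have "c j = 0" if "j \<in> {1 - m..m}" for j
    using independentD[OF ind _ order_refl *, of "zpow j v"] that d[OF that] by simp
  then have "(\<Sum>j\<in>{1 - m..m}. Poly_Mapping.single j (c j)) = 0" by (intro sum.neutral) simp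
  then have "p = trinomial m b * q" unfolding p by (simp only: add_0_right)
  then show "p \<in> principal_ideal (trinomial m b)" by (simp add: principal_ideal_def)
next
  fix p assume "p \<in> principal_ideal (trinomial m b)"
  then obtain q where "p = q * trinomial m b"
    unfolding principal_ideal_def by (metis dvdE mem_Collect_eq mult.commute)
  then show "p \<in> {p. ev p v = 0}" by (simp add: ev_mult tri linear_op_simps[OF lin_ev])
qed

end

text \<open>The trinomial has a nonzero complex root z: take w with w^2 + b w + 1 = 0, which cannot
  be 0, and z with z^|m| = w. A unit would not vanish at z. It follows that a vector with this ideal
  as its annihilator is not zero.\<close>

lemma trinomial_not_unit:
  assumes "m \<noteq> 0"
  shows "1 \<notin> principal_ideal (trinomial m b)"
proof
  assume "1 \<in> principal_ideal (trinomial m b)"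
  then obtain q where q: "1 = q * trinomial m b"
    unfolding principal_ideal_def by (metis dvdE mem_Collect_eq mult.commute)
  obtain w where w: "w\<^sup>2 + b * w + 1 = 0"
  proof -
    obtain r where "poly [:1, b, 1:] r = 0"
      using fundamental_theorem_of_algebra[of "[:1, b, 1:]"] by (auto simp: constant_degree)
    then show ?thesis by (intro that[of r]) (simp add: power2_eq_square algebra_simps)
  qed
  then have w0: "w \<noteq> 0" by auto
  obtain z where z: "z ^ nat \<bar>m\<bar> = w"
  proof -
    obtain r where "poly (monom 1 (nat \<bar>m\<bar>) - [:w:]) r = 0"
    proof (rule ccontr)
      assume "\<not> thesis"
      then have "constant (poly (monom 1 (nat \<bar>m\<bar>) - [:w:]))"
        using fundamental_theorem_of_algebra that by blast
      then have "degree (monom 1 (nat \<bar>m\<bar>) - [:w:]) = 0" by (simp add: constant_degree)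
      then have "coeff (monom 1 (nat \<bar>m\<bar>) - [:w:]) (nat \<bar>m\<bar>) = 0"
        using assms by (intro coeff_eq_0) simp
      then show False using assms by (simp add: coeff_pCons split: nat.splits)
    qed
    then show ?thesis by (intro that[of r]) (simp add: poly_monom)
  qed
  have z0: "z \<noteq> 0"
  proof
    assume "z = 0"
    then have "w = 0 ^ nat \<bar>m\<bar>" using z by simp
    then show False using w0 assms by (simp add: power_0_left)
  qed
  \<comment> \<open>Evaluation at z is \<open>ev\<close> on the one-dimensional space of complex
    numbers, with X acting by multiplication by z.\<close>
  interpret complex_vector_space "(*) :: complex \<Rightarrow> complex \<Rightarrow> complex"
    by unfold_locales (simp_all add: distrib_left distrib_right)
  interpret invertible_op "(*) :: complex \<Rightarrow> complex \<Rightarrow> complex" "\<lambda>x. z * x" "\<lambda>x. inverse z * x"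
    by (intro invertible_op.intro invertible_op_axioms.intro complex_vector_space_axioms linear_opI)
      (use z0 in \<open>simp_all add: distrib_left\<close>)
  have "zpow n 1 = z powi n" for n
    using zpow_eigen[of 1 z n] z0 by simp
  moreover have "z powi m + z powi - m = w + inverse w"
  proof (cases "m > 0")
    case True
    then show ?thesis using z by (simp add: power_int_def inverse_eq_divide power_one_over)
  next
    case False
    then show ?thesis using z assms by (simp add: power_int_def inverse_eq_divide power_one_over)
  qed
  moreover have "w + inverse w + b = (w\<^sup>2 + b * w + 1) / w"
    using w0 by (simp add: field_simps power2_eq_square)
  ultimately have "ev (trinomial m b) 1 = 0"
    using w by (simp add: ev_add ev_single)
  then have "ev (q * trinomial m b) 1 = 0"
    by (simp add: ev_mult linear_op_simps(3)[OF lin_ev])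
  then show False unfolding q[symmetric] by simp
qed

section \<open>Cyclic vectors and central elements\<close>

sublocale daha \<subseteq> invertible_op sc X Xi
  by (intro invertible_op.intro invertible_op_axioms.intro complex_vector_space_axioms lin_X X_Xi Xi_X)

sublocale daha \<subseteq> Y: invertible_op sc Y Yi
  by (intro invertible_op.intro invertible_op_axioms.intro complex_vector_space_axioms lin_Y Y_Yi Yi_Y)

context daha
begin

text \<open>Lusztig's relation, valid in every module: moving T across p(X) costs \<delta> times the
  divided difference. It passes to products by the twisted Leibniz rule
  \<open>demazure_mult\<close>, so X and X^-1 suffice.\<close>

lemma T_ev: "T (ev p v) = ev (refl_s p) (T v) + sc \<delta> (ev (demazure p) v)"
proof (induction p arbitrary: v rule: laurent_induct)
  case (single n c)
  let ?Q = "\<lambda>p. \<forall>v. T (ev p v) = ev (refl_s p) (T v) + sc \<delta> (ev (demazure p) v)"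
  have mult: "?Q (p * q)" if "?Q p" "?Q q" for p q
    using that by (simp add: ev_mult refl_s_mult demazure_mult ev_add linear_op_simps[OF lin_ev]
        scale_right_distrib)
  have X: "?Q (Xpow 1)"
    by (simp add: invert_var_single demazure_X ev_uminus ev_Xpow T_X)
  have Xi: "?Q (Xpow (- 1))"
    by (simp add: invert_var_single demazure_X_inv ev_Xpow T_Xi)
  have "?Q (Xpow n)"
  proof (induction n rule: int_induct[where k = 0])
    case base
    show ?case using demazure_const[of 1] by simp
  next
    case (step1 i)
    show ?case using mult[OF step1(2) X] by (simp add: mult_single)
  next
    case (step2 i)
    show ?case using mult[OF step2(2) Xi] by (simp add: mult_single)
  qed
  then have "?Q (const c * Xpow n)"
    by (intro mult) (simp_all add: ev_const op_simps)
  then show ?case by (simp only: single_eq_const_mult[of n c])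
next
  case (add p q)
  then show ?case
    by (simp add: ev_add invert_var_add demazure_add op_simps scale_right_distrib)
qed

text \<open>Y T^-1 plays the role of \<pi> in an arbitrary module: moving it across X turns X into
  q^(1/2) X^-1. This is again the relation \<open>XY\<close>. Writing Y as (Y T^-1) T then gives
  \<open>Y_ev\<close>.\<close>

lemma R_X: "Y (T (X w) - sc \<delta> (X w)) = sc qh (Xi (Y (T w - sc \<delta> w)))"
  and R_Xi: "Y (T (Xi w) - sc \<delta> (Xi w)) = sc (inverse qh) (X (Y (T w - sc \<delta> w)))"
proof -
  have R_Xi: "sc qh (Y (T (Xi w) - sc \<delta> (Xi w))) = X (Y (T w - sc \<delta> w))" for w
  proof -
    have "X (T w) = T (Xi w) - sc \<delta> (Xi w)"
      by (simp add: T_Xi)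
    then show ?thesis
      using XY[of "T w - sc \<delta> w"] by (simp only: T_Ti)
  qed
  then show "Y (T (Xi w) - sc \<delta> (Xi w)) = sc (inverse qh) (X (Y (T w - sc \<delta> w)))"
    using qh_nonzero by (metis left_inverse scale_one scale_scale)
  have "Xi (sc qh (Y (T w - sc \<delta> w))) = Y (T (X w) - sc \<delta> (X w))"
    using R_Xi[of "X w"] by simp
  then show "Y (T (X w) - sc \<delta> (X w)) = sc qh (Xi (Y (T w - sc \<delta> w)))"
    by (simp add: op_simps)
qed

lemma R_ev: "Y (T (ev p v) - sc \<delta> (ev p v)) = ev (refl_pi qh p) (Y (T v - sc \<delta> v))"
proof -
  define R where "R v = Y (T v - sc \<delta> v)" for v
  have lin: "linear_op R"
    by (rule linear_opI) (simp_all add: R_def op_simps scale_right_distrib scale_right_diff_distrib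
        algebra_simps)
  have z: "R (zpow n v) = sc (qh powi n) (zpow (- n) (R v))" for n v
  proof (induction n rule: int_induct[where k = 0])
    case (step1 i)
    have "R (zpow (i + 1) v) = sc qh (Xi (R (zpow i v)))"
      unfolding zpow_plus_1 R_def by (rule R_X)
    then show ?case
      using zpow_minus_1[of "- i" "R v"] qh_nonzero
      by (simp add: step1 op_simps power_int_add)
  next
    case (step2 i)
    have "R (zpow (i - 1) v) = sc (inverse qh) (X (R (zpow i v)))"
      unfolding zpow_minus_1 R_def by (rule R_Xi)
    then show ?case
      using zpow_plus_1[of "- i" "R v"] qh_nonzero
      by (simp add: step2 op_simps power_int_diff divide_inverse)
  qed simp
  have "R (ev p v) = ev (refl_pi qh p) (R v)"
    by (induction p rule: laurent_induct)
      (simp_all add: ev_single invert_var_single linear_op_simps[OF lin] z ev_add invert_var_add)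
  then show ?thesis by (simp add: R_def)
qed

lemma Y_ev: "Y (ev p v) = ev (refl_pi qh (refl_s p)) (Y v)
    + sc \<delta> (ev (refl_pi qh (demazure p)) (Y (T v - sc \<delta> v)))"
proof -
  have "Y (ev p v) = Y (T (T (ev p v)) - sc \<delta> (T (ev p v)))" by (simp only: Ti_T)
  also have "\<dots> = Y (T (ev (refl_s p) (T v)) - sc \<delta> (ev (refl_s p) (T v)))
      + sc \<delta> (Y (T (ev (demazure p) v) - sc \<delta> (ev (demazure p) v)))"
    by (simp add: T_ev[of p] op_simps scale_right_distrib scale_right_diff_distrib algebra_simps)
  finally show ?thesis by (simp only: R_ev Ti_T)
qed

text \<open>The vector 1 of the polynomial representation has T- and Y-eigenvalue t^(1/2), and the
  action on p(X) 1 follows from the relations alone. So the same formulas hold for every vector with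
  these eigenvalues.\<close>

lemma ev_character:
  assumes "T v = sc th v" "Y v = sc th v"
  shows "T (ev p v) = ev (poly_T th p) v" and "Y (ev p v) = ev (refl_pi qh (poly_T th p)) v"
proof -
  show T: "T (ev p v) = ev (poly_T th p) v" for p
    by (simp add: T_ev assms poly_T_def ev_add ev_const_mult linear_op_simps[OF lin_ev] \<delta>_def)
  have "Y (T v - sc \<delta> v) = v"
    using th_nonzero by (simp add: assms \<delta>_def scale_left_diff_distrib[symmetric] op_simps del: scale_left_diff_distrib)
  then have R: "Y (T (ev q v) - sc \<delta> (ev q v)) = ev (refl_pi qh q) v" for q
    by (simp only: R_ev)
  show "Y (ev p v) = ev (refl_pi qh (poly_T th p)) v"
    using R[of "poly_T th p"] by (simp only: T[symmetric] Ti_T)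
qed

lemma symmetric_commutes:
  assumes "refl_s g = g"
  shows "T (ev g v) = ev g (T v)"
proof -
  have "demazure g = 0" using assms by (intro demazure_eqI) simp
  then show ?thesis by (simp add: T_ev assms)
qed

text \<open>For \<kappa> = 1 the element g(X) is central, for \<kappa> = -1 it anticommutes with Y;
  both signs occur below.\<close>

lemma symmetric_semicommutes:
  assumes "refl_s g = g" "refl_pi qh g = const \<kappa> * g"
  shows "Y (ev g v) = sc \<kappa> (ev g (Y v))"
proof -
  have "demazure g = 0" using assms(1) by (intro demazure_eqI) simp
  then show ?thesis by (simp add: Y_ev assms ev_const_mult invert_var_const[of qh 0, simplified] op_simps)
qed

lemma stable_ker_ev:
  assumes "refl_s g = g" "refl_pi qh g = const \<kappa> * g" "\<kappa> \<noteq> 0"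
  shows "stable {v. ev g v = 0}"
proof -
  have "ev g (Yi v) = sc \<kappa> (Yi (ev g v))" for v
  proof -
    have "Y (ev g (Yi v)) = sc \<kappa> (ev g v)"
      using symmetric_semicommutes[OF assms(1,2), of "Yi v"] by simp
    then have "ev g (Yi v) = sc \<kappa> (Yi (ev g v))"
      by (metis Yi_Y linear_op_simps(2)[OF lin_Yi])
    then show ?thesis by simp
  qed
  moreover have "ev g (Y v) = sc (inverse \<kappa>) (Y (ev g v))" for v
    using symmetric_semicommutes[OF assms(1,2), of v] assms(3) by simp
  moreover have "ev g (X v) = X (ev g v)" "ev g (Xi v) = Xi (ev g v)" for v
    using ev_commute[of g "Xpow 1" v] ev_commute[of g "Xpow (- 1)" v] by (simp_all add: ev_Xpow)
  ultimately show ?thesis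
    unfolding stable_def
    by (auto intro!: subspaceI simp: linear_op_simps[OF lin_ev] op_simps symmetric_commutes[OF assms(1), symmetric])
qed

lemma stable_range_ev:
  assumes "T v = sc th v" "Y v = sc th v"
  shows "stable (range (\<lambda>p. ev p v))"
proof -
  note ch = ev_character[OF assms]
  have T: "T w \<in> range (\<lambda>p. ev p v)" if "w \<in> range (\<lambda>p. ev p v)" for w
    using that ch(1) by auto
  have "X w \<in> range (\<lambda>p. ev p v)" if w: "w \<in> range (\<lambda>p. ev p v)" for w
  proof -
    obtain p where "w = ev p v" using w by blast
    then have "X w = ev (Xpow 1 * p) v" by (simp add: ev_mult ev_Xpow)
    then show ?thesis by blast
  qed
  moreover have "Y w \<in> range (\<lambda>p. ev p v)" if "w \<in> range (\<lambda>p. ev p v)" for w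
    using that ch(2) by auto
  moreover have "Yi w \<in> range (\<lambda>p. ev p v)" if rw: "w \<in> range (\<lambda>p. ev p v)" for w
  proof -
    obtain p where w: "w = ev p v" using rw by blast
    define q where "q = poly_T th (refl_pi qh p) - const (th - inverse th) * refl_pi qh p"
    \<comment> \<open>The polynomial representation has an explicit inverse of Y; it supplies the q
      with Y q(X) v = p(X) v.\<close>
    interpret P: daha "\<lambda>c p. const c * p" qh th "\<lambda>p. Xpow 1 * p" "\<lambda>p. Xpow (- 1) * p"
      "\<lambda>p. refl_pi qh (poly_T th p)" "\<lambda>p. poly_T th (refl_pi qh p) - const (th - inverse th) * refl_pi qh p"
      "poly_T th"
      by (rule daha_poly_rep[OF qh_nonzero th_nonzero])
    have "refl_pi qh (poly_T th q) = p" unfolding q_def by (rule P.Y_Yi)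
    then have "Y (ev q v) = w" using ch(2)[of q] w by simp
    then have "Yi w = ev q v" using Yi_Y by metis
    then show ?thesis by blast
  qed
  moreover have "\<Pi> w \<in> range (\<lambda>p. ev p v)" if "w \<in> range (\<lambda>p. ev p v)" for w
    unfolding \<Pi>_def using calculation(1) T that by blast
  ultimately show ?thesis
    using T ev_range_subspace by (intro stableI_\<Pi>) blast+
qed

end

subsection \<open>Simplicity\<close>

locale simple_daha = daha +
  assumes simple: "\<And>U. stable U \<Longrightarrow> U = {0} \<or> U = UNIV"
begin

lemma stable_eq_UNIV: "stable U \<Longrightarrow> v \<in> U \<Longrightarrow> v \<noteq> 0 \<Longrightarrow> U = UNIV"
  using simple[of U] by auto

lemma generated_by_character:
  assumes "T v = sc th v" "Y v = sc th v" "v \<noteq> 0"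
  shows "range (\<lambda>p. ev p v) = UNIV"
  by (rule stable_eq_UNIV[OF stable_range_ev[OF assms(1,2)], of v])
    (use assms in \<open>auto intro!: range_eqI[of _ _ 1]\<close>)

end

lemma (in daha) intertwiner_ev:
  assumes "T v = sc th v" "Y v = sc th v" "scal W = sc" "actX W = X" "actY W = Y" "actT W = T"
  shows "intertwiner (poly_rep qh th) W (\<lambda>p. ev p v)"
  unfolding intertwiner_def poly_rep_simps assms(3-6)
  using ev_character[OF assms(1,2)] vector_space_laurent vector_space_axioms
  by (auto simp: Vector_Spaces.linear_iff ev_add ev_mult ev_const ev_Xpow)

section \<open>Central elements in Y\<close>

context daha
begin

text \<open>For n = 2N this is central, by \<open>Ysym_T\<close> and \<open>Ysym_\<Pi>\<close>; its
  constant value on a simple module confines the weights to one orbit.\<close>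

definition Ysym :: "nat \<Rightarrow> 'v \<Rightarrow> 'v" where "Ysym n v = Y.zpow (int n) v + Y.zpow (- int n) v"

lemma lin_Ysym: "linear_op (Ysym n)"
  by (rule linear_opI) (simp_all add: Ysym_def linear_op_simps[OF Y.lin_zpow] scale_right_distrib)

lemma Ysym_rec: "Ysym (Suc (Suc n)) v = Y (Ysym (Suc n) v) + Yi (Ysym (Suc n) v) - Ysym n v"
  using Y.zpow_plus_1[of "1 + int n" v] Y.zpow_minus_1[of "- 1 - int n" v]
    Y.zpow_plus_1[of "- 1 - int n" v] Y.zpow_minus_1[of "1 + int n" v]
  by (simp add: Ysym_def op_simps add_ac)

lemma T_Y_plus_Yi: "T (Y v + Yi v) = Y (T v) + Yi (T v)"
  by (simp add: Y_T Yi_T op_simps)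

text \<open>T commutes with Y + Y^-1, and the Chebyshev-type recursion \<open>Ysym_rec\<close> makes
  Y^n + Y^-n a polynomial in Y + Y^-1.\<close>

lemma Ysym_T: "Ysym n (T v) = T (Ysym n v)"
proof (induction n arbitrary: v rule: induct_nat_012)
  case 0
  show ?case by (simp add: Ysym_def op_simps)
next
  case 1
  show ?case using T_Y_plus_Yi[of v] by (simp add: Ysym_def)
next
  case (ge2 n)
  then show ?case using T_Y_plus_Yi[of "Ysym (Suc n) v"] by (simp add: Ysym_rec op_simps)
qed

lemma zpow_Y_\<Pi>: "Y.zpow n (\<Pi> v) = sc (qh powi - n) (\<Pi> (Y.zpow (- n) v))"
proof (induction n rule: int_induct[where k = 0])
  case (step1 i)
  then show ?case
    using Y.zpow_minus_1[of "- i" v] qh_nonzero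
    by (simp add: Y.zpow_plus_1 op_simps Y_\<Pi> power_int_diff divide_inverse mult.commute)
next
  case (step2 i)
  then show ?case
    using Y.zpow_plus_1[of "- i" v] power_int_add_1[of qh "- i"] qh_nonzero
    by (simp add: Y.zpow_minus_1 op_simps Yi_\<Pi>)
qed simp

lemma Ysym_\<Pi>:
  assumes "qh ^ n = 1"
  shows "Ysym n (\<Pi> v) = \<Pi> (Ysym n v)"
  using assms by (simp add: Ysym_def zpow_Y_\<Pi> power_int_minus linear_op_simps[OF lin_\<Pi>] add.commute)

lemma Ysym_Y: "Ysym n (Y v) = Y (Ysym n v)" and Ysym_Yi: "Ysym n (Yi v) = Yi (Ysym n v)"
  using Y.zpow_add[of n 1 v] Y.zpow_add[of 1 n v] Y.zpow_add[of n "-1" v] Y.zpow_add[of "-1" n v]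
    Y.zpow_add[of "-n" 1 v] Y.zpow_add[of 1 "-n" v] Y.zpow_add[of "-n" "-1" v] Y.zpow_add[of "-1" "-n" v]
  by (simp_all add: Ysym_def op_simps add.commute)

lemma stable_eigenspace_Ysym:
  assumes "qh ^ n = 1"
  shows "stable (eigenspace (Ysym n) c)"
  by (rule stableI_\<Pi>[OF subspace_eigenspace[OF lin_Ysym]])
    (simp_all add: eigenspace_def Ysym_\<Pi>[OF assms] Ysym_T Ysym_Y Ysym_Yi
      linear_op_simps[OF lin_\<Pi>] op_simps)

lemma Ysym_eigen:
  assumes "Y v = sc y v" "v \<noteq> 0"
  shows "Ysym n v = sc (y ^ n + inverse y ^ n) v"
  using Y.zpow_eigen[OF assms(1) Yi_eigen[OF assms(1)] eigenvalue_nonzero[OF assms(2,1)]]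
  by (simp add: Ysym_def scale_left_distrib power_int_minus power_inverse)

end

section \<open>Orbits of weights\<close>

lemma primitive_root_nonzero: "primitive_root n z \<Longrightarrow> n > 0 \<Longrightarrow> z \<noteq> 0"
  by (auto simp: primitive_root_def power_0_left)

lemma primitive_root_half_power:
  assumes "primitive_root (2 * N) z" "N \<ge> 1"
  shows "z ^ N = - 1"
proof -
  have "(z ^ N)\<^sup>2 = 1"
    using assms(1) by (simp add: primitive_root_def power_mult[symmetric] mult.commute)
  moreover have "z ^ N \<noteq> 1" using assms by (auto simp: primitive_root_def)
  ultimately show ?thesis by (auto simp: power2_eq_1_iff)
qed

lemma primitive_root_power_inj:
  assumes "primitive_root n z" "z ^ i = z ^ j" "i < n" "j < n"
  shows "i = j"
proof -
  have *: "i = j" if "z ^ i = z ^ j" "i \<le> j" "j < n" for i j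
  proof (rule ccontr)
    assume "i \<noteq> j"
    have "z \<noteq> 0" by (rule primitive_root_nonzero[OF assms(1)]) (use that(3) in simp)
    moreover have "z ^ j = z ^ i * z ^ (j - i)" using that(2) by (simp add: power_add[symmetric])
    ultimately have "z ^ (j - i) = 1" using that(1) by simp
    then show False using assms(1) that \<open>i \<noteq> j\<close> unfolding primitive_root_def by auto
  qed
  show ?thesis using *[of i j] *[of j i] assms(2-4) by (metis nat_le_linear)
qed

lemma primitive_root_exists_power:
  assumes "primitive_root n z" "n > 0" "w ^ n = 1"
  obtains j where "j < n" "w = z ^ j"
proof -
  have "inj_on (\<lambda>j. z ^ j) {..<n}"
    using primitive_root_power_inj[OF assms(1)] by (auto intro!: inj_onI)
  then have "card ((\<lambda>j. z ^ j) ` {..<n}) = n" by (simp add: card_image)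
  moreover have "(\<lambda>j. z ^ j) ` {..<n} \<subseteq> {w. w ^ n = 1}"
  proof clarify
    fix j
    have "(z ^ j) ^ n = (z ^ n) ^ j" by (simp only: power_mult[symmetric] mult.commute)
    then show "(z ^ j) ^ n = 1" using assms(1) by (simp add: primitive_root_def)
  qed
  moreover have "card {w::complex. w ^ n = 1} = n" using assms(2) by (rule card_roots_unity_eq)
  moreover have "finite {w::complex. w ^ n = 1}" using assms(2) by (rule finite_nth_roots)
  ultimately have "(\<lambda>j. z ^ j) ` {..<n} = {w. w ^ n = 1}"
    by (intro card_subset_eq) auto
  then show ?thesis using that assms(3) by blast
qed

lemma plus_inverse_eq:
  assumes "(a::complex) + inverse a = b + inverse b" "a \<noteq> 0" "b \<noteq> 0"
  shows "a = b \<or> a = inverse b"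
proof -
  have "(a - b) * (a - inverse b) = a * ((a + inverse a) - (b + inverse b))"
    using assms(2,3) by (simp add: field_simps)
  then show ?thesis using assms(1) by auto
qed

section \<open>Weights when q is a root of unity\<close>

locale findim_daha = daha sc qh th X Xi Y Yi T + findim_complex_vector_space sc Basis
  for sc :: "complex \<Rightarrow> 'v::ab_group_add \<Rightarrow> 'v" and qh th :: complex
    and X Xi Y Yi T :: "'v \<Rightarrow> 'v" and Basis +
  fixes N :: nat
  assumes N_pos: "N \<ge> 1" and prim: "primitive_root (2 * N) qh"
begin

lemma qh_2N: "qh ^ (2 * N) = 1"
  using prim by (simp add: primitive_root_def)

lemma qh_N: "qh ^ N = - 1"
  by (rule primitive_root_half_power[OF prim N_pos])

lemma qh_power_eq_1: "0 < i \<Longrightarrow> i < 2 * N \<Longrightarrow> qh ^ i \<noteq> 1"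
  using prim by (auto simp: primitive_root_def)

lemma spec_nonempty:
  assumes "stable U" "v \<in> U" "v \<noteq> 0"
  obtains y where "y \<in> spec U"
  using exists_eigenvector[OF lin_Y stable_subspace[OF assms(1)] stable_Y[OF assms(1)] assms(2,3)]
  unfolding spec_def by blast

text \<open>The involution followed by E takes the weight y to 1 / (q^(1/2) y) and then to q^(1/2)
  y. The hypothesis covers every weight of U because E must not vanish anywhere along the
  way.\<close>

lemma spec_shift:
  assumes "stable U" and unbroken: "\<And>z. z \<in> spec U \<Longrightarrow> z\<^sup>2 \<noteq> th\<^sup>2 \<and> z\<^sup>2 \<noteq> inverse (th\<^sup>2)"
    and "y \<in> spec U"
  shows "qh ^ j * y \<in> spec U" and "inverse (qh ^ j * y) \<in> spec U"
proof -
  have inv: "inverse z \<in> spec U" if "z \<in> spec U" for z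
    using spec_E[OF assms(1)] unbroken that by blast
  show "qh ^ j * y \<in> spec U"
  proof (induction j)
    case (Suc j)
    then show ?case using inv[OF spec_\<Pi>[OF assms(1) Suc]] by (simp add: mult.assoc)
  qed (simp add: assms(3))
  then show "inverse (qh ^ j * y) \<in> spec U" by (rule inv)
qed

lemma power_eq_imp_shift:
  assumes "z ^ (2 * N) = y ^ (2 * N)" "y \<noteq> 0"
  obtains j where "j < 2 * N" "z = qh ^ j * y"
proof -
  have "(z / y) ^ (2 * N) = 1" using assms by (simp add: power_divide)
  then obtain j where "j < 2 * N" "z / y = qh ^ j"
    using primitive_root_exists_power[OF prim] N_pos by auto
  then show ?thesis using that[of j] assms(2) by (simp add: field_simps)
qed

text \<open>Without degenerate weights the walk of \<open>spec_shift\<close> would lead from y or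
  its inverse to t^(1/2), which is degenerate itself.\<close>

lemma exists_broken:
  assumes "stable U" "y \<in> spec U" "th ^ (2 * N) = y ^ (2 * N) \<or> th ^ (2 * N) * y ^ (2 * N) = 1"
  shows "\<exists>z\<in>spec U. z\<^sup>2 = th\<^sup>2 \<or> z\<^sup>2 = inverse (th\<^sup>2)"
proof (rule ccontr)
  assume "\<not> ?thesis"
  then have unbroken: "\<And>z. z \<in> spec U \<Longrightarrow> z\<^sup>2 \<noteq> th\<^sup>2 \<and> z\<^sup>2 \<noteq> inverse (th\<^sup>2)" by blast
  have y0: "y \<noteq> 0" using assms(2) by (rule spec_nonzero)
  obtain y' where y': "y' \<in> spec U" "th ^ (2 * N) = y' ^ (2 * N)"
  proof (cases "th ^ (2 * N) = y ^ (2 * N)")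
    case False
    then have "th ^ (2 * N) = inverse y ^ (2 * N)"
      using assms(3) y0 by (simp add: power_inverse field_simps)
    moreover have "inverse y \<in> spec U" using spec_E[OF assms(1,2)] unbroken[OF assms(2)] by blast
    ultimately show ?thesis by (intro that)
  next
    case True
    show ?thesis by (rule that[OF assms(2) True])
  qed
  obtain j where "th = qh ^ j * y'"
    by (rule power_eq_imp_shift[OF y'(2) spec_nonzero[OF y'(1)]])
  moreover have "qh ^ j * y' \<in> spec U" using assms(1) unbroken y'(1) by (rule spec_shift)
  ultimately have "th \<in> spec U" by simp
  then show False using unbroken by blast
qed

end

context daha
begin

text \<open>At a weight where the intertwiner degenerates, either the eigenvector or its image spans a
  one-dimensional module over the subalgebra generated by \<open>T\<close> and \<open>Y\<close>.\<close>
lemma broken_character: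
  assumes U: "stable U" and z: "z \<in> spec U" "z\<^sup>2 = th\<^sup>2 \<or> z\<^sup>2 = inverse (th\<^sup>2)"
  obtains w a b where "w \<in> U" "w \<noteq> 0" "a = th \<or> a = - inverse th" "b = a \<or> b = - a"
    "T w = sc a w" "Y w = sc b w"
proof -
  note found = that
  show thesis
  proof (cases "th\<^sup>2 = 1")
    \<comment> \<open>For t = 1 the operator E is T (Y^-2 - 1), which vanishes at z^2 = 1 and says
      nothing about T. But here T^2 = 1 and T preserves the weight space, so v is projected to an
      eigenspace of T instead.\<close>
    case True
    then have th1: "th * th = 1" by (simp add: power2_eq_square)
    note th = th1 inverse_unique[OF th1]
    then have \<delta>: "\<delta> = 0" by (simp add: \<delta>_def)
    obtain v where v: "v \<in> U" "v \<noteq> 0" "Y v = sc z v" using z(1) by (auto simp: spec_def)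
    have "z\<^sup>2 = th\<^sup>2" using z(2) True by auto
    then have zth: "z = th \<or> z = - th" by (simp add: power2_eq_iff)
    have zz: "inverse z = z"
      by (rule inverse_unique) (use zth th1 in auto)
    define w where "w = T v + sc th v"
    have Y_Tv: "Y (T v) = sc z (T v)"
      using Y_T[of v] Yi_eigen[OF v(3)] by (simp add: \<delta> zz op_simps)
    have Tw: "T w = sc th w"
      using T_T[of v] th by (simp add: w_def op_simps \<delta> scale_right_distrib add.commute)
    have Yw: "Y w = sc z w"
      by (simp add: w_def op_simps Y_Tv v(3) scale_right_distrib mult.commute)
    have wU: "w \<in> U" unfolding w_def
      using U v(1) by (intro subspace_add subspace_scale stable_subspace stable_T) auto
    show ?thesis
    proof (cases "w = 0")
      case False
      show ?thesis by (rule that[OF wU False _ zth Tw Yw]) simp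
    next
      case True
      then have "T v = sc (- th) v" by (simp add: w_def eq_neg_iff_add_eq_0)
      show ?thesis
        by (rule that[OF v(1,2) _ _ \<open>T v = sc (- th) v\<close> v(3)]) (use zth th in auto)
    qed
  next
    case False
    have th2: "inverse (th\<^sup>2) - 1 \<noteq> 0" "th\<^sup>2 - 1 \<noteq> 0" using False by auto
    \<comment> \<open>Where E v = 0, the definition of E yields T v after division by z^-2 - 1,
      which is nonzero since t \<noteq> 1.\<close>
    have key: thesis if v: "v \<in> U" "v \<noteq> 0" "Y v = sc z v" "E v = 0"
      and z: "z\<^sup>2 = th\<^sup>2 \<or> z\<^sup>2 = inverse (th\<^sup>2)" for v z
    proof -
      have "sc (inverse (z\<^sup>2) - 1) (T v) + sc \<delta> v = 0"
        using v(4) Yi_eigen[OF v(3)]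
        by (simp add: E_def op_simps scale_left_diff_distrib power2_eq_square)
      then have Tv: "sc (inverse (z\<^sup>2) - 1) (T v) = sc (- \<delta>) v" by (simp add: eq_neg_iff_add_eq_0)
      show thesis
        using z
      proof
        assume z2: "z\<^sup>2 = th\<^sup>2"
        have "- \<delta> = (inverse (th\<^sup>2) - 1) * th"
          using th_nonzero by (simp add: \<delta>_def power2_eq_square field_simps)
        then have "sc (inverse (th\<^sup>2) - 1) (T v) = sc (inverse (th\<^sup>2) - 1) (sc th v)"
          using Tv unfolding z2 by simp
        then have "T v = sc th v" using th2 by (simp only: scale_cancel_left) simp
        moreover have "z = th \<or> z = - th" using z2 by (simp add: power2_eq_iff)
        ultimately show thesis using found[of v th z] v by blast
      next
        assume z2: "z\<^sup>2 = inverse (th\<^sup>2)"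
        then have *: "inverse (z\<^sup>2) = th\<^sup>2" by simp
        have "- \<delta> = (th\<^sup>2 - 1) * (- inverse th)"
          using th_nonzero by (simp add: \<delta>_def power2_eq_square field_simps)
        then have "sc (th\<^sup>2 - 1) (T v) = sc (th\<^sup>2 - 1) (sc (- inverse th) v)"
          using Tv unfolding * by simp
        then have "T v = sc (- inverse th) v" using th2 by (simp only: scale_cancel_left) simp
        moreover have "z\<^sup>2 = (inverse th)\<^sup>2" using z2 by (simp add: power_inverse)
        then have "z = - inverse th \<or> z = - (- inverse th)" by (auto simp only: power2_eq_iff minus_minus)
        ultimately show thesis using found[of v "- inverse th" z] v by blast
      qed
    qed
    obtain v where v: "v \<in> U" "v \<noteq> 0" "Y v = sc z v" using z(1) by (auto simp: spec_def)
    show ?thesis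
    proof (cases "E v = 0")
      case True
      then show ?thesis using key v z(2) by blast
    next
      \<comment> \<open>E^2 vanishes on v, so E v takes the place of v; its weight 1 / z is
        degenerate too.\<close>
      case Ev: False
      have z0: "z \<noteq> 0" using z(1) by (rule spec_nonzero)
      have "E (E v) = 0"
        using E_E_eigen[OF v(3)] E_E_scalar_zero_iff[OF z0] z(2) by simp
      moreover have "(inverse z)\<^sup>2 = th\<^sup>2 \<or> (inverse z)\<^sup>2 = inverse (th\<^sup>2)"
        using z(2) by (auto simp: power_inverse)
      ultimately show ?thesis
        using key[OF stable_E[OF U v(1)] Ev E_eigen[OF v(3)]] by blast
    qed
  qed
qed

end

context findim_daha
begin

definition orbit_point :: "complex \<Rightarrow> bool \<times> nat \<Rightarrow> complex" where
  "orbit_point y = (\<lambda>(b, i). if b then qh ^ i * y else inverse (qh ^ i * y))"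

text \<open>A coincidence within one half contradicts primitivity of q^(1/2); one between the two
  halves, raised to the power 2N, gives y^(4N) = 1.\<close>

lemma orbit_point_inj:
  assumes "y \<noteq> 0" "y ^ (4 * N) \<noteq> 1"
  shows "inj_on (orbit_point y) (UNIV \<times> {..<2 * N})"
proof -
  have pw: "(qh ^ i) ^ (2 * N) = 1" for i
    using qh_2N by (metis mult.commute power_mult power_one)
  have same: "i = j" if "qh ^ i * y = qh ^ j * y" "i < 2 * N" "j < 2 * N" for i j
    using that assms(1) primitive_root_power_inj[OF prim] by simp
  have diff: "qh ^ i * y \<noteq> inverse (qh ^ j * y)" for i j
  proof
    assume "qh ^ i * y = inverse (qh ^ j * y)"
    then have "(qh ^ i * y) ^ (2 * N) = inverse ((qh ^ j * y) ^ (2 * N))"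
      by (simp only: power_inverse)
    then have "y ^ (2 * N) * y ^ (2 * N) = 1"
      using assms(1) unfolding power_mult_distrib pw by (simp add: field_simps)
    then show False using assms(2) by (simp add: power_add[symmetric])
  qed
  show ?thesis
  proof (rule inj_onI, clarify)
    fix b i b' j
    assume ij: "i < 2 * N" "j < 2 * N" and eq: "orbit_point y (b, i) = orbit_point y (b', j)"
    have "b = b'"
      using eq diff[of i j] diff[of j i] by (cases b; cases b') (auto simp: orbit_point_def)
    moreover have "i = j"
      using eq same ij calculation by (cases b') (auto simp: orbit_point_def)
    ultimately show "b = b' \<and> i = j" by blast
  qed
qed

text \<open>From a degenerate weight a, the involution and E are applied alternately. E can vanish
  at 1 / (q^((i+1)/2) a) only if the square of this weight is a^2, which would make a^(4N) = 1, or
  a^-2, which would make q^(i+1) = 1. So 2N weights are reached before the path may stop.\<close>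

lemma character_spec:
  assumes U: "stable U" and "a\<^sup>2 = th\<^sup>2 \<or> a\<^sup>2 = inverse (th\<^sup>2)" "a \<in> spec U" "a ^ (4 * N) \<noteq> 1"
  shows "i < N \<Longrightarrow> qh ^ i * a \<in> spec U \<and> inverse (qh ^ Suc i * a) \<in> spec U"
proof (induction i)
  case 0
  then show ?case using assms(3) spec_\<Pi>[OF U assms(3)] by simp
next
  case (Suc i)
  let ?z = "inverse (qh ^ Suc i * a)"
  have z: "?z \<in> spec U" using Suc by simp
  have pw: "(qh ^ i) ^ (2 * N) = 1" for i
    using qh_2N by (metis mult.commute power_mult power_one)
  have a0: "a \<noteq> 0" using assms(3) by (rule spec_nonzero)
  have sq: "?z\<^sup>2 = inverse ((qh ^ Suc i)\<^sup>2 * a\<^sup>2)"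
    by (simp only: power_inverse power_mult_distrib)
  have z1: "?z\<^sup>2 \<noteq> a\<^sup>2"
  proof
    assume "?z\<^sup>2 = a\<^sup>2"
    then have "(qh ^ Suc i)\<^sup>2 * (a\<^sup>2 * a\<^sup>2) = 1"
      unfolding sq using a0 qh_nonzero by (simp add: field_simps)
    then have "((qh ^ Suc i)\<^sup>2 * (a\<^sup>2 * a\<^sup>2)) ^ N = 1" by simp
    then have "(qh ^ Suc i) ^ (2 * N) * a ^ (4 * N) = 1"
      by (simp only: power_mult_distrib power_add[symmetric] power_mult[symmetric]) (simp add: mult.assoc)
    then show False using pw[of "Suc i"] assms(4) by simp
  qed
  have z2: "?z\<^sup>2 \<noteq> inverse (a\<^sup>2)"
  proof
    assume "?z\<^sup>2 = inverse (a\<^sup>2)"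
    then have "(qh ^ Suc i)\<^sup>2 = 1"
      unfolding sq using a0 by simp
    then have "qh ^ (Suc i * 2) = 1" by (simp only: power_mult)
    then show False using qh_power_eq_1[of "Suc i * 2"] Suc(2) by simp
  qed
  have "?z\<^sup>2 \<noteq> th\<^sup>2" "?z\<^sup>2 \<noteq> inverse (th\<^sup>2)" using z1 z2 assms(2) by auto
  then have "qh ^ Suc i * a \<in> spec U" using spec_E[OF U z] by simp
  then show ?case using spec_\<Pi>[OF U, of "qh ^ Suc i * a"] by (simp add: mult.assoc)
qed

end

section \<open>Modules with a degenerate intertwiner\<close>

lemma refl_s_trinomial: "refl_s (trinomial m c) = trinomial m c"
  by (simp add: invert_var_add invert_var_single add.commute)

text \<open>The sign in the second case comes from q^(N/2) = -1; it makes X^N + X^-N anticommute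
  with Y.\<close>

lemma refl_pi_trinomial:
  assumes "primitive_root (2 * N) qh" "N \<ge> 1"
  shows "refl_pi qh (trinomial (2 * int N) c) = const 1 * trinomial (2 * int N) c"
    and "refl_pi qh (trinomial (int N) 0) = const (- 1) * trinomial (int N) 0"
proof -
  have "qh powi (2 * int N) = 1"
    using assms(1) by (metis primitive_root_def of_nat_mult of_nat_numeral power_int_of_nat)
  then show "refl_pi qh (trinomial (2 * int N) c) = const 1 * trinomial (2 * int N) c"
    by (simp add: invert_var_add invert_var_single power_int_minus add.commute)
  have "qh powi int N = - 1" using primitive_root_half_power[OF assms] by simp
  then show "refl_pi qh (trinomial (int N) 0) = const (- 1) * trinomial (int N) 0"
    by (simp add: invert_var_add invert_var_single power_int_minus mult_single distrib_left add.commute)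
qed

context findim_daha
begin

lemma stable_ker_trinomial:
  "stable {v. ev (trinomial (2 * int N) c) v = 0}" "stable {v. ev (trinomial (int N) 0) v = 0}"
  by (rule stable_ker_ev[OF refl_s_trinomial refl_pi_trinomial(1)[OF prim N_pos]], simp)
    (rule stable_ker_ev[OF refl_s_trinomial refl_pi_trinomial(2)[OF prim N_pos]], simp)

text \<open>The square of X^N + X^-N is X^2N + X^-2N + 2, written here so that the element defining
  the quotient splits off. This is why C = 2 is exceptional.\<close>

lemma ev_trinomial_square:
  "ev (trinomial (int N) 0) (ev (trinomial (int N) 0) v) = ev (trinomial (2 * int N) c) v + sc (2 - c) v"
proof -
  have "trinomial (int N) 0 * trinomial (int N) 0 = trinomial (2 * int N) c + const (2 - c)"
    by (simp add: distrib_left distrib_right mult_single single_diff)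
  then show ?thesis
    by (simp only: ev_mult[of "trinomial (int N) 0" "trinomial (int N) 0", symmetric]
        ev_add[of "trinomial (2 * int N) c"] ev_const)
qed

lemma trinomial_spec:
  assumes U: "stable U" and "v \<in> U" "Y v = sc z v" "ev (trinomial (int N) 0) v \<noteq> 0"
  shows "- z \<in> spec U"
proof -
  let ?w = "ev (trinomial (int N) 0) v"
  have "Y ?w = sc (- z) ?w"
    using symmetric_semicommutes[OF refl_s_trinomial refl_pi_trinomial(2)[OF prim N_pos], of v] assms(3)
    by (simp only: linear_op_simps(2)[OF lin_ev] scale_scale) simp
  moreover have "zpow n v \<in> U" for n
    by (induction n rule: int_induct[where k = 0])
      (simp_all add: assms(2) zpow_plus_1 zpow_minus_1 stable_X[OF U] stable_Xi[OF U])
  then have "?w \<in> U"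
    by (simp add: ev_add ev_single subspace_add[OF stable_subspace[OF U]])
  ultimately show ?thesis using assms(4) unfolding spec_def by blast
qed

lemma character_eigenvalues:
  assumes U: "stable U" and a: "a\<^sup>2 = th\<^sup>2 \<or> a\<^sup>2 = inverse (th\<^sup>2)" "a \<in> spec U" "a ^ (4 * N) \<noteq> 1"
  obtains Z where "finite Z" "Z \<subseteq> spec U" "card Z = 2 * N"
proof -
  \<comment> \<open>The path of \<open>character_spec\<close>: the inverses start at index 1 because
    the involution already shifts by q^(1/2), and index N is still reached.\<close>
  let ?I = "{True} \<times> {..<N} \<union> {False} \<times> {Suc 0..N}"
  let ?Z = "orbit_point a ` ?I"
  have "?I \<subseteq> UNIV \<times> {..<2 * N}" using N_pos by auto
  then have inj: "inj_on (orbit_point a) ?I"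
    using orbit_point_inj[OF spec_nonzero[OF a(2)] a(3)] inj_on_subset by blast
  have "card ?I = 2 * N"
    by (subst card_Un_disjoint) (auto simp: card_cartesian_product)
  then have "card ?Z = 2 * N" using card_image[OF inj] by simp
  moreover have "?Z \<subseteq> spec U"
  proof clarify
    fix b i assume "(b, i) \<in> ?I"
    then consider "b" "i < N" | "\<not> b" "Suc 0 \<le> i" "i \<le> N" by auto
    then show "orbit_point a (b, i) \<in> spec U"
    proof cases
      case 1
      then show ?thesis using character_spec[OF U a(1,2,3)] by (simp add: orbit_point_def)
    next
      case 2
      then obtain j where "i = Suc j" "j < N" by (cases i) auto
      then show ?thesis using character_spec[OF U a(1,2,3), of j] 2(1) by (simp add: orbit_point_def)
    qed
  qed
  ultimately show ?thesis by (intro that[of ?Z]) auto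
qed

text \<open>Since q^(N/2) = -1, the path from -a covers the other half of the orbit of a.\<close>

lemma character_eigenvalues_both:
  assumes U: "stable U" and a: "a\<^sup>2 = th\<^sup>2 \<or> a\<^sup>2 = inverse (th\<^sup>2)" "a \<in> spec U" "a ^ (4 * N) \<noteq> 1"
    and "- a \<in> spec U"
  obtains Z where "finite Z" "Z \<subseteq> spec U" "card Z = 4 * N"
proof -
  let ?I = "UNIV \<times> {..<2 * N}"
  let ?Z = "orbit_point a ` ?I"
  have a': "(- a)\<^sup>2 = th\<^sup>2 \<or> (- a)\<^sup>2 = inverse (th\<^sup>2)" "(- a) ^ (4 * N) \<noteq> 1"
    using a by simp_all
  note c = character_spec[OF U a] and c' = character_spec[OF U a'(1) assms(5) a'(2)]
  have neg: "qh ^ j * (- a) = qh ^ (N + j) * a" for j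
    by (simp add: power_add qh_N)
  have "card ?Z = 4 * N"
    using card_image[OF orbit_point_inj[OF spec_nonzero[OF a(2)] a(3)]]
    by (simp add: card_cartesian_product)
  moreover have "?Z \<subseteq> spec U"
  proof (rule image_subsetI)
    fix x assume "x \<in> (UNIV :: bool set) \<times> {..<2 * N}"
    then obtain b i where x: "x = (b, i)" and i: "i < 2 * N" by auto
    have t: "qh ^ i * a \<in> spec U"
    proof (cases "i < N")
      case False
      then obtain j where j: "i = N + j" "j < N" using i by (metis le_add_diff_inverse nat_add_left_cancel_less mult_2 not_less)
      then show ?thesis using c'[of j] neg[of j] by simp
    qed (use c in blast)
    have f: "inverse (qh ^ i * a) \<in> spec U"
    proof (cases "i = 0")
      case True
      \<comment> \<open>The weight 1 / a is the end of the path from -a, whose last shift by q^(N/2)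
        cancels the sign.\<close>
      have "inverse (qh ^ N * (- a)) \<in> spec U" using c'[of "N - 1"] N_pos by simp
      then show ?thesis using True by (simp add: qh_N)
    next
      case i0: False
      show ?thesis
      proof (cases "i \<le> N")
        case True
        then show ?thesis using c[of "i - 1"] i0 by simp
      next
        case False
        then obtain j where j: "i = N + Suc j" "j < N" using i by (auto simp: less_iff_Suc_add not_le)
        have "inverse (qh ^ Suc j * (- a)) \<in> spec U" using c'[OF j(2)] by blast
        then show ?thesis by (simp only: neg j(1))
      qed
    qed
    show "orbit_point a x \<in> spec U" using t f unfolding x by (simp add: orbit_point_def)
  qed
  ultimately show ?thesis by (intro that[of ?Z]) auto
qed

lemma spec_card_le_dim:
  assumes "finite Z" "Z \<subseteq> spec U"
  shows "card Z \<le> dim U" and "subspace U \<Longrightarrow> dim (UNIV :: 'v set) \<le> card Z \<Longrightarrow> U = UNIV"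
proof -
  have "\<forall>z. \<exists>v. z \<in> Z \<longrightarrow> v \<in> U \<and> v \<noteq> 0 \<and> Y v = sc z v"
    using assms(2) unfolding spec_def by blast
  then obtain e where e: "\<And>z. z \<in> Z \<Longrightarrow> e z \<in> U \<and> e z \<noteq> 0 \<and> Y (e z) = sc z (e z)" by metis
  have ind: "independent_family Z e"
    by (rule independent_eigenvectors[OF lin_Y assms(1)]) (use e in \<open>auto simp: eigenspace_def\<close>)
  have im: "e ` Z \<subseteq> U" using e by auto
  show "card Z \<le> dim U" by (rule independent_family_card_le[OF assms(1) ind im])
  show "U = UNIV" if "subspace U" "dim (UNIV :: 'v set) \<le> card Z"
    by (rule independent_family_eq_UNIV[OF assms(1) ind im that])
qed

definition simple_spectrum :: bool where
  "simple_spectrum \<longleftrightarrow> span (\<Union>z. eigenspace Y z) = UNIV \<and>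
    (\<forall>v z. v \<in> eigenspace Y z \<longrightarrow> v \<noteq> 0 \<longrightarrow> dim (eigenspace Y z) = 1)"

lemma simple_spectrumI:
  assumes "finite Z" "Z \<subseteq> spec UNIV" "dim (UNIV :: 'v set) \<le> card Z"
  shows "dim (UNIV :: 'v set) = card Z" and simple_spectrum
proof -
  have ex: "\<exists>v\<in>eigenspace Y z. v \<noteq> 0" if "z \<in> Z" for z
    using assms(2) that by (auto simp: spec_def eigenspace_def)
  show "dim (UNIV :: 'v set) = card Z" by (rule many_eigenvalues(1)[OF lin_Y assms(1) ex assms(3)])
  show simple_spectrum
    unfolding simple_spectrum_def
    using many_eigenvalues(2,3)[OF lin_Y assms(1) ex assms(3)] by blast
qed

lemma simple_quotient_cases:
  assumes simple: "\<And>U. stable U \<Longrightarrow> U = {0} \<or> U = UNIV"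
    and v: "T v = sc th v" "Y v = sc th v" "v \<noteq> 0" and th: "th ^ (4 * N) \<noteq> 1"
  shows "(\<exists>C. C \<noteq> 2 \<and> {p. ev p v = 0} = principal_ideal (trinomial (2 * int N) C)
      \<and> dim (UNIV :: 'v set) = 4 * N \<and> simple_spectrum)
    \<or> {p. ev p v = 0} = principal_ideal (trinomial (int N) 0) \<and> dim (UNIV :: 'v set) = 2 * N"
proof -
  interpret simple_daha sc qh th X Xi Y Yi T by (unfold_locales) (rule simple)
  have gen: "range (\<lambda>p. ev p v) = UNIV" by (rule generated_by_character[OF v])
  \<comment> \<open>Schur's lemma for the central X^2N + X^-2N: it has an eigenvector, and the
    eigenspace, being stable, is everything. Its value is -C.\<close>
  obtain u c where u: "u \<noteq> 0" "ev (trinomial (2 * int N) 0) u = sc c u"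
    by (rule exists_eigenvector[OF lin_ev subspace_UNIV _ UNIV_I v(3)]) auto
  define C where "C = - c"
  have "ev (trinomial (2 * int N) C) u = ev (trinomial (2 * int N) 0) u + sc C u"
    by (simp add: ev_add ev_single)
  then have "u \<in> {v. ev (trinomial (2 * int N) C) v = 0}"
    using u by (simp add: C_def)
  then have ker: "{v. ev (trinomial (2 * int N) C) v = 0} = UNIV"
    by (rule stable_eq_UNIV[OF stable_ker_trinomial(1) _ u(1)])
  then have tri: "ev (trinomial (2 * int N) C) w = 0" for w by blast
  have th_spec: "th \<in> spec UNIV" using v unfolding spec_def by blast
  show ?thesis
  proof (cases "C = 2")
    case True
    \<comment> \<open>Now X^N + X^-N squares to zero on v, so v or its image is a nonzero vector in
      the kernel, which is stable and hence everything.\<close>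
    have gg: "ev (trinomial (int N) 0) (ev (trinomial (int N) 0) v) = 0"
      unfolding ev_trinomial_square[of v C] tri by (simp add: True)
    have "{v. ev (trinomial (int N) 0) v = 0} = UNIV"
    proof (cases "ev (trinomial (int N) 0) v = 0")
      case True
      then show ?thesis by (intro stable_eq_UNIV[OF stable_ker_trinomial(2) _ v(3)]) (rule CollectI)
    next
      case False
      then show ?thesis
        by (intro stable_eq_UNIV[OF stable_ker_trinomial(2) _ False]) (rule CollectI, rule gg)
    qed
    then have g: "ev (trinomial (int N) 0) v = 0" by blast
    have "dim (UNIV :: 'v set) \<le> 2 * N"
      using dim_le_of_trinomial(1)[OF _ g gen] N_pos by (simp add: nat_mult_distrib)
    moreover obtain Z where "finite Z" "Z \<subseteq> spec UNIV" "card Z = 2 * N"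
      by (rule character_eigenvalues[OF stable_UNIV _ th_spec th]) auto
    ultimately have dim: "dim (UNIV :: 'v set) = 2 * N"
      using spec_card_le_dim(1)[of Z UNIV] by linarith
    moreover have "{p. ev p v = 0} = principal_ideal (trinomial (int N) 0)"
      by (rule kernel_ev_trinomial[OF _ g gen]) (use N_pos dim in \<open>simp_all add: nat_mult_distrib\<close>)
    ultimately show ?thesis by blast
  next
    \<comment> \<open>Otherwise the square is the nonzero scalar 2 - C, so X^N + X^-N moves v to the
      weight -t^(1/2), and all 4N weights occur.\<close>
    case False
    have "ev (trinomial (int N) 0) (ev (trinomial (int N) 0) v) = sc (2 - C) v"
      unfolding ev_trinomial_square[of v C] tri by simp
    then have "ev (trinomial (int N) 0) v \<noteq> 0"
      using False v(3) linear_op_simps(3)[OF lin_ev] by auto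
    then have mth: "- th \<in> spec UNIV" by (rule trinomial_spec[OF stable_UNIV UNIV_I v(2)])
    have "dim (UNIV :: 'v set) \<le> 4 * N"
      using dim_le_of_trinomial(1)[OF _ tri gen] N_pos by (simp add: nat_mult_distrib)
    moreover obtain Z where Z: "finite Z" "Z \<subseteq> spec UNIV" "card Z = 4 * N"
      by (rule character_eigenvalues_both[OF stable_UNIV _ th_spec th mth]) auto
    ultimately have "dim (UNIV :: 'v set) \<le> card Z" by simp
    note ss = simple_spectrumI[OF Z(1,2) this]
    have dim: "dim (UNIV :: 'v set) = 4 * N" using ss(1) Z(3) by simp
    have "{p. ev p v = 0} = principal_ideal (trinomial (2 * int N) C)"
      by (rule kernel_ev_trinomial[OF _ tri gen]) (use N_pos dim in \<open>simp_all add: nat_mult_distrib\<close>)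
    then show ?thesis using False dim ss(2) by blast
  qed
qed

text \<open>The converse of \<open>simple_quotient_cases\<close>: a nonzero submodule contains a
  degenerate weight, hence by the walk from it as many weights as the dimension of the whole module
  allows.\<close>

lemma quotient_simple:
  assumes v: "T v = sc th v" "Y v = sc th v" and th: "th ^ (4 * N) \<noteq> 1"
    and gen: "range (\<lambda>p. ev p v) = UNIV"
  shows "C \<noteq> 2 \<Longrightarrow> {p. ev p v = 0} = principal_ideal (trinomial (2 * int N) C) \<Longrightarrow>
      (\<forall>U. stable U \<longrightarrow> U = {0} \<or> U = UNIV) \<and> v \<noteq> 0 \<and> dim (UNIV :: 'v set) = 4 * N \<and> simple_spectrum"
    and "{p. ev p v = 0} = principal_ideal (trinomial (int N) 0) \<Longrightarrow>
      (\<forall>U. stable U \<longrightarrow> U = {0} \<or> U = UNIV) \<and> v \<noteq> 0 \<and> dim (UNIV :: 'v set) = 2 * N"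
proof -
  have nonzero: "v \<noteq> 0" if "{p. ev p v = 0} = principal_ideal (trinomial m c)" "m \<noteq> 0" for m c
  proof
    assume "v = 0"
    then have "1 \<in> {p. ev p v = 0}" by simp
    then show False using that trinomial_not_unit by blast
  qed
  have broken: "\<exists>z\<in>spec U. (z\<^sup>2 = th\<^sup>2 \<or> z\<^sup>2 = inverse (th\<^sup>2)) \<and> z ^ (4 * N) \<noteq> 1"
    if U: "stable U" "U \<noteq> {0}" and v0: "v \<noteq> 0" for U
  proof -
    \<comment> \<open>The central Y^2N + Y^-2N acts on the whole module by its value on the
      generator v, so the 2N-th power of every weight is that of t^(1/2) or its inverse.\<close>
    let ?c = "th ^ (2 * N) + inverse th ^ (2 * N)"
    have vK: "v \<in> eigenspace (Ysym (2 * N)) ?c"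
      using Ysym_eigen[OF v(2) v0] by (simp add: eigenspace_def)
    have st: "stable (eigenspace (Ysym (2 * N)) ?c)" by (rule stable_eigenspace_Ysym[OF qh_2N])
    have "zpow n v \<in> eigenspace (Ysym (2 * N)) ?c" for n
      by (induction n rule: int_induct[where k = 0])
        (simp_all add: vK zpow_plus_1 zpow_minus_1 stable_X[OF st] stable_Xi[OF st])
    then have ev: "ev p v \<in> eigenspace (Ysym (2 * N)) ?c" for p
      unfolding ev_def by (intro subspace_sum[OF stable_subspace[OF st]] subspace_scale[OF stable_subspace[OF st]])
    have c: "w \<in> eigenspace (Ysym (2 * N)) ?c" for w
    proof -
      obtain p where "w = ev p v" using gen by blast
      then show ?thesis using ev by simp
    qed
    obtain u where "u \<in> U" "u \<noteq> 0" using U subspace_0[OF stable_subspace[OF U(1)]] by blast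
    then obtain y where y: "y \<in> spec U" by (rule spec_nonempty[OF U(1)])
    then obtain w where w: "w \<noteq> 0" "Y w = sc y w" unfolding spec_def by blast
    have y0: "y \<noteq> 0" by (rule spec_nonzero[OF y])
    have "sc (y ^ (2 * N) + inverse y ^ (2 * N)) w = sc ?c w"
      using Ysym_eigen[OF w(2,1)] c[of w] by (simp add: eigenspace_def)
    then have "y ^ (2 * N) + inverse (y ^ (2 * N)) = th ^ (2 * N) + inverse (th ^ (2 * N))"
      using w(1) by (simp add: power_inverse)
    then have "y ^ (2 * N) = th ^ (2 * N) \<or> y ^ (2 * N) = inverse (th ^ (2 * N))"
      by (rule plus_inverse_eq) (use y0 th_nonzero in auto)
    then have "th ^ (2 * N) = y ^ (2 * N) \<or> th ^ (2 * N) * y ^ (2 * N) = 1"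
      using th_nonzero by auto
    then obtain z where z: "z \<in> spec U" "z\<^sup>2 = th\<^sup>2 \<or> z\<^sup>2 = inverse (th\<^sup>2)"
      using exists_broken[OF U(1) y] by blast
    have "z ^ (4 * N) = (z\<^sup>2) ^ (2 * N)" by (simp add: power_mult[symmetric])
    moreover have "th ^ (4 * N) = (th\<^sup>2) ^ (2 * N)" by (simp add: power_mult[symmetric])
    ultimately have "z ^ (4 * N) \<noteq> 1" using z(2) th by (auto simp: power_inverse)
    then show ?thesis using z by blast
  qed
  show "(\<forall>U. stable U \<longrightarrow> U = {0} \<or> U = UNIV) \<and> v \<noteq> 0 \<and> dim (UNIV :: 'v set) = 4 * N \<and> simple_spectrum"
    if C: "C \<noteq> 2" and ker: "{p. ev p v = 0} = principal_ideal (trinomial (2 * int N) C)"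
  proof -
    have v0: "v \<noteq> 0" by (rule nonzero[OF ker]) (use N_pos in simp)
    have "trinomial (2 * int N) C \<in> {p. ev p v = 0}" unfolding ker by (simp add: principal_ideal_def)
    then have triv: "ev (trinomial (2 * int N) C) v = 0" by blast
    have tri: "ev (trinomial (2 * int N) C) w = 0" for w
    proof -
      obtain p where "w = ev p v" using gen by blast
      then show ?thesis
        by (simp only: ev_commute[of _ p] triv linear_op_simps(3)[OF lin_ev])
    qed
    have dim_le: "dim (UNIV :: 'v set) \<le> 4 * N"
      using dim_le_of_trinomial(1)[OF _ triv gen] N_pos by (simp add: nat_mult_distrib)
    have Z: "\<exists>Z. finite Z \<and> Z \<subseteq> spec U \<and> card Z = 4 * N" if U: "stable U" "U \<noteq> {0}" for U
    proof -
      obtain z where z: "z \<in> spec U" "z\<^sup>2 = th\<^sup>2 \<or> z\<^sup>2 = inverse (th\<^sup>2)" "z ^ (4 * N) \<noteq> 1"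
        using broken[OF U v0] by blast
      obtain w where w: "w \<in> U" "w \<noteq> 0" "Y w = sc z w" using z(1) unfolding spec_def by blast
      have "ev (trinomial (int N) 0) (ev (trinomial (int N) 0) w) = sc (2 - C) w"
        unfolding ev_trinomial_square[of w C] tri by simp
      then have "ev (trinomial (int N) 0) w \<noteq> 0"
        using C w(2) linear_op_simps(3)[OF lin_ev] by auto
      then have "- z \<in> spec U" by (rule trinomial_spec[OF U(1) w(1,3)])
      from character_eigenvalues_both[OF U(1) z(2,1,3) this] show ?thesis by metis
    qed
    have "U = {0} \<or> U = UNIV" if U: "stable U" for U
    proof (cases "U = {0}")
      case False
      then obtain Z where "finite Z" "Z \<subseteq> spec U" "card Z = 4 * N" using Z[OF U] by blast
      then show ?thesis using spec_card_le_dim(2)[of Z U] stable_subspace[OF U] dim_le by simp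
    qed simp
    moreover obtain Z where Z: "finite Z" "Z \<subseteq> spec UNIV" "card Z = 4 * N"
      using Z[OF stable_UNIV] v0 by blast
    ultimately show ?thesis
      using simple_spectrumI[OF Z(1,2)] Z(3) v0 dim_le by simp
  qed
  show "(\<forall>U. stable U \<longrightarrow> U = {0} \<or> U = UNIV) \<and> v \<noteq> 0 \<and> dim (UNIV :: 'v set) = 2 * N"
    if ker: "{p. ev p v = 0} = principal_ideal (trinomial (int N) 0)"
  proof -
    have v0: "v \<noteq> 0" by (rule nonzero[OF ker]) (use N_pos in simp)
    have "trinomial (int N) 0 \<in> {p. ev p v = 0}" unfolding ker by (simp add: principal_ideal_def)
    then have triv: "ev (trinomial (int N) 0) v = 0" by blast
    have dim_le: "dim (UNIV :: 'v set) \<le> 2 * N"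
      using dim_le_of_trinomial(1)[OF _ triv gen] N_pos by (simp add: nat_mult_distrib)
    have Z: "\<exists>Z. finite Z \<and> Z \<subseteq> spec U \<and> card Z = 2 * N" if U: "stable U" "U \<noteq> {0}" for U
    proof -
      obtain z where z: "z \<in> spec U" "z\<^sup>2 = th\<^sup>2 \<or> z\<^sup>2 = inverse (th\<^sup>2)" "z ^ (4 * N) \<noteq> 1"
        using broken[OF U v0] by blast
      from character_eigenvalues[OF U(1) z(2,1,3)] show ?thesis by metis
    qed
    have "U = {0} \<or> U = UNIV" if U: "stable U" for U
    proof (cases "U = {0}")
      case False
      then obtain Z where "finite Z" "Z \<subseteq> spec U" "card Z = 2 * N" using Z[OF U] by blast
      then show ?thesis using spec_card_le_dim(2)[of Z U] stable_subspace[OF U] dim_le by simp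
    qed simp
    moreover obtain Z where Z: "finite Z" "Z \<subseteq> spec UNIV" "card Z = 2 * N"
      using Z[OF stable_UNIV] v0 by blast
    ultimately show ?thesis
      using simple_spectrumI(1)[OF Z(1,2)] Z(3) v0 dim_le by simp
  qed
qed

end

section \<open>Modules with invertible intertwiners\<close>

locale unbroken_daha = findim_daha sc qh th X Xi Y Yi T Basis N
  for sc :: "complex \<Rightarrow> 'v::ab_group_add \<Rightarrow> 'v" and qh th :: complex
    and X Xi Y Yi T :: "'v \<Rightarrow> 'v" and Basis N +
  fixes y :: complex
  assumes simple: "\<And>U. stable U \<Longrightarrow> U = {0} \<or> U = UNIV"
    and y_spec: "y \<in> spec UNIV"
    and unbroken: "th ^ (2 * N) \<noteq> y ^ (2 * N)" "th ^ (2 * N) * y ^ (2 * N) \<noteq> 1"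
begin

sublocale simple_daha sc qh th X Xi Y Yi T
  by unfold_locales (rule simple)

lemma y_nonzero: "y \<noteq> 0"
  using y_spec by (rule spec_nonzero)

lemma spec_orbit:
  assumes "z \<in> spec UNIV"
  shows "z ^ (2 * N) = y ^ (2 * N) \<or> z ^ (2 * N) = inverse (y ^ (2 * N))"
proof -
  let ?c = "y ^ (2 * N) + inverse y ^ (2 * N)"
  obtain v where v: "v \<noteq> 0" "Y v = sc y v" using y_spec unfolding spec_def by blast
  have "v \<in> eigenspace (Ysym (2 * N)) ?c"
    using Ysym_eigen[OF v(2,1)] by (simp add: eigenspace_def)
  then have c: "eigenspace (Ysym (2 * N)) ?c = UNIV"
    by (rule stable_eq_UNIV[OF stable_eigenspace_Ysym[OF qh_2N] _ v(1)])
  obtain w where w: "w \<noteq> 0" "Y w = sc z w" using assms unfolding spec_def by blast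
  have "w \<in> eigenspace (Ysym (2 * N)) ?c" unfolding c by simp
  then have "sc (z ^ (2 * N) + inverse z ^ (2 * N)) w = sc ?c w"
    using Ysym_eigen[OF w(2,1)] by (simp add: eigenspace_def)
  then have "z ^ (2 * N) + inverse (z ^ (2 * N)) = y ^ (2 * N) + inverse (y ^ (2 * N))"
    using w(1) by (simp add: power_inverse)
  then show ?thesis
    by (rule plus_inverse_eq) (use y_nonzero spec_nonzero[OF assms] in auto)
qed

lemma spec_unbroken:
  assumes "z \<in> spec UNIV"
  shows "z\<^sup>2 \<noteq> th\<^sup>2" "z\<^sup>2 \<noteq> inverse (th\<^sup>2)"
proof -
  have *: "z ^ (2 * N) = (z\<^sup>2) ^ N" "th ^ (2 * N) = (th\<^sup>2) ^ N" by (simp_all add: power_mult)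
  have o: "z ^ (2 * N) = y ^ (2 * N) \<or> z ^ (2 * N) = inverse (y ^ (2 * N))" by (rule spec_orbit[OF assms])
  have y0: "y ^ (2 * N) \<noteq> 0" and t0: "th ^ (2 * N) \<noteq> 0" using y_nonzero th_nonzero by auto
  show "z\<^sup>2 \<noteq> th\<^sup>2"
  proof
    assume "z\<^sup>2 = th\<^sup>2"
    then have "z ^ (2 * N) = th ^ (2 * N)" using * by simp
    then show False using o unbroken y0 by auto
  qed
  show "z\<^sup>2 \<noteq> inverse (th\<^sup>2)"
  proof
    assume "z\<^sup>2 = inverse (th\<^sup>2)"
    then have "z ^ (2 * N) = inverse (th ^ (2 * N))" using * by (simp add: power_inverse)
    then have e: "th ^ (2 * N) * z ^ (2 * N) = 1" using t0 by (simp only: right_inverse not_False_eq_True)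
    show False
      using o
    proof
      assume "z ^ (2 * N) = y ^ (2 * N)"
      then show False using e unbroken(2) by simp
    next
      assume "z ^ (2 * N) = inverse (y ^ (2 * N))"
      then show False using e unbroken(1) y0 by (simp add: divide_inverse[symmetric])
    qed
  qed
qed

text \<open>The kernel of E is invariant under Y, so it would contain a weight vector, on which E^2
  is a nonzero scalar.\<close>

lemma E_eq_0D:
  assumes "E v = 0"
  shows "v = 0"
proof (rule ccontr)
  assume "v \<noteq> 0"
  have sub: "subspace {v. E v = 0}"
    by (rule subspaceI) (simp_all add: linear_op_simps[OF lin_E])
  have st: "Y u \<in> {v. E v = 0}" if "u \<in> {v. E v = 0}" for u
  proof -
    have "E (Y u) = Yi (E u)" by (simp add: Yi_E)
    then show ?thesis using that by (simp add: op_simps)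
  qed
  obtain w z where w: "w \<in> {v. E v = 0}" "w \<noteq> 0" "Y w = sc z w"
    by (rule exists_eigenvector[OF lin_Y sub st]) (use assms \<open>v \<noteq> 0\<close> in auto)
  have "z \<in> spec UNIV" using w unfolding spec_def by blast
  then show False
    using E_eigen_nonzero[OF w(3,2) spec_unbroken] w(1) by blast
qed

definition G :: "'v \<Rightarrow> 'v" where "G v = \<Pi> (E v)"

lemma lin_G: "linear_op G"
  by (rule linear_opI) (simp_all add: G_def linear_op_simps[OF lin_E] linear_op_simps[OF lin_\<Pi>])

lemma G_eq_0D: "G v = 0 \<Longrightarrow> v = 0"
  by (rule E_eq_0D) (simp add: G_def)

lemma Y_G: "Y (G v) = sc (inverse qh) (G (Y v))"
  by (simp add: G_def Y_\<Pi> Yi_E)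

lemma Yi_G: "Yi (G v) = sc qh (G (Yi v))"
  by (simp add: G_def Yi_\<Pi> Y_E)

lemma G_power_eigen:
  assumes "Y v = sc z v"
  shows "Y ((G ^^ i) v) = sc (inverse qh ^ i * z) ((G ^^ i) v)"
proof (induction i)
  case (Suc i)
  then show ?case by (simp add: Y_G linear_op_simps[OF lin_G] mult.assoc)
qed (simp add: assms)

lemma G_power_nonzero: "v \<noteq> 0 \<Longrightarrow> (G ^^ i) v \<noteq> 0"
  using G_eq_0D by (induction i) auto

lemma lin_G_power: "linear_op (G ^^ i)"
  by (induction i) (simp_all add: linear_opI linear_op_simps[OF lin_G] linear_op_simps)

text \<open>G is injective and moves weights around a cycle of length 2N, so the inequalities
  between dimensions close up to equalities.\<close>

lemma dim_eigenspace_shift: "dim (eigenspace Y (qh ^ j * z)) = dim (eigenspace Y z)"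
proof -
  have step: "dim (eigenspace Y z) \<le> dim (eigenspace Y (inverse qh * z))" for z
    by (rule dim_le_of_injective[OF lin_G subspace_eigenspace[OF lin_Y]])
      (auto simp: eigenspace_def Y_G linear_op_simps[OF lin_G] intro: G_eq_0D)
  have steps: "dim (eigenspace Y z) \<le> dim (eigenspace Y (inverse qh ^ i * z))" for i z
  proof (induction i)
    case (Suc i)
    then show ?case using step[of "inverse qh ^ i * z"] by (simp add: mult.assoc)
  qed simp
  have 1: "dim (eigenspace Y (qh ^ j * z)) \<le> dim (eigenspace Y z)"
  proof -
    have "inverse qh ^ j * (qh ^ j * z) = z" using qh_nonzero by (simp add: power_inverse)
    then show ?thesis using steps[of "qh ^ j * z" j] by (simp only:)
  qed
  \<comment> \<open>G moves weights in one direction only, so the j steps backwards are replaced by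
    2N j - j steps forwards.\<close>
  have "inverse qh ^ (2 * N * j) = 1" using qh_2N by (simp add: power_mult power_inverse)
  moreover have "j \<le> 2 * N * j" using N_pos by simp
  then have "inverse qh ^ (2 * N * j) = inverse qh ^ (2 * N * j - j) * inverse qh ^ j"
    by (metis le_add_diff_inverse2 power_add)
  ultimately have "inverse qh ^ (2 * N * j - j) = qh ^ j"
    using qh_nonzero by (simp add: power_inverse field_simps)
  then have "dim (eigenspace Y z) \<le> dim (eigenspace Y (qh ^ j * z))"
    using steps[of z "2 * N * j - j"] by simp
  with 1 show ?thesis by simp
qed

lemma nonsingular:
  assumes y1: "y ^ (2 * N) \<noteq> 1"
  shows "dim (UNIV :: 'v set) \<le> 4 * N" and "span (\<Union>z. eigenspace Y z) = UNIV"
proof -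
  have sub: "subspace (eigenspace Y y)" by (rule subspace_eigenspace[OF lin_Y])
  obtain v0 where v0: "v0 \<in> eigenspace Y y" "v0 \<noteq> 0"
    using y_spec unfolding spec_def eigenspace_def by blast
  have st: "(G ^^ (2 * N)) u \<in> eigenspace Y y" if "u \<in> eigenspace Y y" for u
    using G_power_eigen[of u y "2 * N"] that qh_2N by (simp add: eigenspace_def power_inverse)
  obtain v c where v: "v \<in> eigenspace Y y" "v \<noteq> 0" "(G ^^ (2 * N)) v = sc c v"
    by (rule exists_eigenvector[OF lin_G_power sub st v0])
  have Yv: "Y v = sc y v" using v(1) by (simp add: eigenspace_def)
  have c0: "c \<noteq> 0" using G_power_nonzero[OF v(2), of "2 * N"] v(3) by auto
  define S where "S = (\<lambda>i. (G ^^ i) v) ` {..<2 * N} \<union> (\<lambda>i. E ((G ^^ i) v)) ` {..<2 * N}"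
  have finS: "finite S" by (simp add: S_def)
  have cardS: "card S \<le> 4 * N"
  proof -
    have "card S \<le> card {..<2 * N} + card {..<2 * N}"
      unfolding S_def by (intro order.trans[OF card_Un_le] add_mono card_image_le) auto
    then show ?thesis by simp
  qed
  have Gv: "(G ^^ i) v \<in> span S" if "i \<le> 2 * N" for i
  proof (cases "i = 2 * N")
    case True
    have "(G ^^ 0) v \<in> S" unfolding S_def by (intro UnI1 imageI) (use N_pos in simp)
    then show ?thesis using True v(3) by (simp add: span_base span_scale)
  next
    case False
    then show ?thesis using that by (intro span_base) (auto simp: S_def)
  qed
  have EGv: "E ((G ^^ i) v) \<in> span S" if "i < 2 * N" for i
    using that by (intro span_base) (auto simp: S_def)
  have eig: "\<exists>z\<in>spec UNIV. Y s = sc z s" if s: "s \<in> S" for s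
  proof -
    have "\<exists>z. Y s = sc z s"
      using s G_power_eigen[OF Yv] E_eigen[OF G_power_eigen[OF Yv]] unfolding S_def by blast
    moreover have "s \<noteq> 0"
      using s unfolding S_def by (auto simp: G_power_nonzero[OF v(2)] dest!: E_eq_0D)
    ultimately show ?thesis unfolding spec_def by blast
  qed
  have Espan: "E s \<in> span S" if s: "s \<in> S" for s
  proof -
    consider i where "i < 2 * N" "s = (G ^^ i) v" | i where "i < 2 * N" "s = E ((G ^^ i) v)"
      using s unfolding S_def by auto
    then show ?thesis
    proof cases
      case 1
      then show ?thesis using EGv by simp
    next
      case 2
      then show ?thesis using E_E_eigen[OF G_power_eigen[OF Yv]] Gv[of i] by (simp add: span_scale)
    qed
  qed
  \<comment> \<open>\<Pi> sends E G^i v to G^(i+1) v and back. Only v itself is not of the form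
    G^(i+1) v; there the relation G^2N v = c v with c \<noteq> 0 closes the cycle.\<close>
  have \<Pi>span: "\<Pi> s \<in> span S" if s: "s \<in> S" for s
  proof -
    consider i where "i < 2 * N" "s = (G ^^ i) v" | i where "i < 2 * N" "s = E ((G ^^ i) v)"
      using s unfolding S_def by auto
    then show ?thesis
    proof cases
      case 1
      show ?thesis
      proof (cases i)
        case 0
        define w where "w = E ((G ^^ (2 * N - 1)) v)"
        have "\<Pi> w = (G ^^ Suc (2 * N - 1)) v" by (simp add: w_def G_def)
        also have "\<dots> = sc c v" using v(3) N_pos by simp
        finally have "\<Pi> (\<Pi> w) = sc c (\<Pi> v)" by (simp only: linear_op_simps(2)[OF lin_\<Pi>])
        then have "\<Pi> v = sc (inverse c) w" using c0 by simp
        moreover have "w \<in> span S" unfolding w_def by (rule EGv) (use N_pos in simp)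
        ultimately show ?thesis using 1(2) 0 by (simp add: span_scale)
      next
        case (Suc j)
        then have "\<Pi> s = E ((G ^^ j) v)" using 1(2) by (simp add: G_def)
        then show ?thesis using EGv[of j] Suc 1(1) by simp
      qed
    next
      case 2
      then have "\<Pi> s = (G ^^ Suc i) v" by (simp add: G_def)
      then show ?thesis using Gv[of "Suc i"] 2(1) by simp
    qed
  qed
  \<comment> \<open>T is recovered from E by dividing by z^-2 - 1; this is where the weights have to
    be nonsingular.\<close>
  have Tspan: "T s \<in> span S" if s: "s \<in> S" for s
  proof -
    obtain z where z: "z \<in> spec UNIV" "Y s = sc z s" using eig[OF s] by blast
    have z0: "z \<noteq> 0" by (rule spec_nonzero[OF z(1)])
    have "z\<^sup>2 \<noteq> 1"
    proof
      assume "z\<^sup>2 = 1"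
      then have "z ^ (2 * N) = 1" by (simp add: power_mult)
      then show False using spec_orbit[OF z(1)] y1 by auto
    qed
    then have ne: "inverse (z\<^sup>2) - 1 \<noteq> 0" by simp
    have "E s = sc (inverse (z\<^sup>2) - 1) (T s) + sc \<delta> s"
      using Yi_eigen[OF z(2)]
      by (simp add: E_def op_simps scale_left_diff_distrib power2_eq_square)
    then have "sc (inverse (z\<^sup>2) - 1) (T s) \<in> span S"
      using span_diff[OF Espan[OF s] span_scale[OF span_base[OF s], of \<delta>]] by simp
    then have "sc (inverse (inverse (z\<^sup>2) - 1)) (sc (inverse (z\<^sup>2) - 1) (T s)) \<in> span S"
      by (rule span_scale)
    then show ?thesis using ne by simp
  qed
  have "stable (span S)"
  proof (rule stableI_\<Pi>)
    show "\<Pi> u \<in> span S" if "u \<in> span S" for u by (rule span_stable[OF lin_\<Pi> \<Pi>span that])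
    show "T u \<in> span S" if "u \<in> span S" for u by (rule span_stable[OF lin_T Tspan that])
    show "Y u \<in> span S" if "u \<in> span S" for u
    proof (rule span_stable[OF lin_Y _ that])
      fix s assume s: "s \<in> S"
      then obtain z where "Y s = sc z s" using eig by blast
      then show "Y s \<in> span S" using span_scale[OF span_base[OF s]] by simp
    qed
    show "Yi u \<in> span S" if "u \<in> span S" for u
    proof (rule span_stable[OF lin_Yi _ that])
      fix s assume s: "s \<in> S"
      then obtain z where "Y s = sc z s" using eig by blast
      then show "Yi s \<in> span S" using span_scale[OF span_base[OF s]] Yi_eigen[of s z] by simp
    qed
  qed simp
  then have UNIV: "span S = UNIV"
    by (rule stable_eq_UNIV[OF _ Gv[of 0]]) (use v(2) in simp_all)
  show "dim (UNIV :: 'v set) \<le> 4 * N"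
    using dim_le_card[of UNIV S] finS cardS UNIV by simp
  have "S \<subseteq> (\<Union>z. eigenspace Y z)" using eig by (auto simp: eigenspace_def)
  then show "span (\<Union>z. eigenspace Y z) = UNIV"
    using span_mono[of S "\<Union>z. eigenspace Y z"] UNIV by auto
qed

lemma regular_case:
  assumes "y ^ (4 * N) \<noteq> 1"
  shows "dim (UNIV :: 'v set) = 4 * N" and simple_spectrum
proof -
  have y1: "y ^ (2 * N) \<noteq> 1"
  proof
    assume "y ^ (2 * N) = 1"
    then have "(y ^ (2 * N))\<^sup>2 = 1" by simp
    then show False using assms by (simp add: power_mult[symmetric])
  qed
  let ?Z = "orbit_point y ` (UNIV \<times> {..<2 * N})"
  have card: "card ?Z = 4 * N"
    using card_image[OF orbit_point_inj[OF y_nonzero assms]] by (simp add: card_cartesian_product)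
  have sub: "?Z \<subseteq> spec UNIV"
  proof (rule image_subsetI)
    fix x assume "x \<in> (UNIV :: bool set) \<times> {..<2 * N}"
    obtain b i where x: "x = (b, i)" by (cases x)
    have sh: "qh ^ i * y \<in> spec UNIV" "inverse (qh ^ i * y) \<in> spec UNIV"
      by (rule spec_shift[OF stable_UNIV _ y_spec]; use spec_unbroken in blast)+
    then show "orbit_point y x \<in> spec UNIV" unfolding x by (simp add: orbit_point_def)
  qed
  have dim: "dim (UNIV :: 'v set) \<le> card ?Z" using nonsingular(1)[OF y1] card by simp
  show "dim (UNIV :: 'v set) = 4 * N" using simple_spectrumI(1)[OF _ sub dim] card by simp
  show simple_spectrum by (rule simple_spectrumI(2)[OF _ sub dim]) simp
qed

text \<open>The orbit collapses to the 2N roots of z^2N = -1. All of them have the same multiplicity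
  d, and the bound 4N on the dimension leaves d \<le> 2.\<close>

lemma half_singular_case:
  assumes "y ^ (2 * N) = - 1"
  shows "\<exists>d. (d = 1 \<or> d = 2) \<and> dim (UNIV :: 'v set) = 2 * N * d
    \<and> (\<forall>z\<in>spec UNIV. dim (eigenspace Y z) = d)"
proof -
  have y1: "y ^ (2 * N) \<noteq> 1" using assms by simp
  let ?O = "{z::complex. z ^ (2 * N) = - 1}"
  define d where "d = dim (eigenspace Y y)"
  have spec: "z \<in> ?O" if "z \<in> spec UNIV" for z
    using spec_orbit[OF that] assms by auto
  have dz: "dim (eigenspace Y z) = d" if "z \<in> ?O" for z
  proof -
    have "z ^ (2 * N) = y ^ (2 * N)" using that assms by simp
    then obtain j where "z = qh ^ j * y" by (rule power_eq_imp_shift[OF _ y_nonzero])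
    then show ?thesis unfolding d_def by (simp add: dim_eigenspace_shift)
  qed
  have fin: "finite ?O" by (rule finite_nth_roots) (use N_pos in simp)
  have card: "card ?O = 2 * N" by (rule card_nth_roots) (use N_pos in simp_all)
  have "(\<Union>z. eigenspace Y z) \<subseteq> insert 0 (\<Union>z\<in>?O. eigenspace Y z)"
    using spec unfolding spec_def eigenspace_def by blast
  then have "span (\<Union>z. eigenspace Y z) \<subseteq> span (insert 0 (\<Union>z\<in>?O. eigenspace Y z))"
    by (rule span_mono)
  then have "span (\<Union>z\<in>?O. eigenspace Y z) = UNIV"
    using nonsingular(2)[OF y1] by auto
  then have "dim (UNIV :: 'v set) = (\<Sum>z\<in>?O. dim (eigenspace Y z))"
    by (rule dim_eq_sum_eigenspaces[OF lin_Y fin])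
  also have "\<dots> = (\<Sum>z\<in>?O. d)" by (rule sum.cong) (simp_all only: dz)
  also have "\<dots> = 2 * N * d" using card by simp
  finally have dim: "dim (UNIV :: 'v set) = 2 * N * d" .
  obtain v where "v \<in> eigenspace Y y" "v \<noteq> 0"
    using y_spec unfolding spec_def eigenspace_def by blast
  then have "d \<ge> 1" unfolding d_def by (intro dim_eigenspace_pos[OF lin_Y])
  moreover have "2 * N * d \<le> 2 * N * 2" using nonsingular(1)[OF y1] dim by simp
  then have "d \<le> 2" using N_pos by simp
  ultimately have "d = 1 \<or> d = 2" by linarith
  moreover have "\<forall>z\<in>spec UNIV. dim (eigenspace Y z) = d" using spec dz by blast
  ultimately show ?thesis using dim by blast
qed

end

section \<open>Singular weights\<close>

context unbroken_daha
begin

text \<open>At singular weights Y^2N will be the unipotent operator that exhibits the Jordan blocks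
  of Y; commuting with G, it is computed on v and T v alone.\<close>

lemma Y_power_G: "(Y ^^ (2 * N)) ((G ^^ i) v) = (G ^^ i) ((Y ^^ (2 * N)) v)"
proof -
  have 1: "(Y ^^ n) (G v) = sc (inverse qh ^ n) (G ((Y ^^ n) v))" for n v
    by (induction n) (simp_all add: op_simps Y_G mult.commute)
  have "(Y ^^ (2 * N)) (G v) = G ((Y ^^ (2 * N)) v)" for v
    using 1[of "2 * N" v] qh_2N by (simp add: power_inverse)
  then show ?thesis by (induction i) simp_all
qed

lemma G_power_Y: "(G ^^ i) (Y v) = sc (qh ^ i) (Y ((G ^^ i) v))"
  and G_power_Yi: "(G ^^ i) (Yi v) = sc (inverse qh ^ i) (Yi ((G ^^ i) v))"
proof -
  have 1: "G (Y v) = sc qh (Y (G v))" "G (Yi v) = sc (inverse qh) (Yi (G v))" for v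
    using qh_nonzero by (simp_all add: Y_G Yi_G)
  show "(G ^^ i) (Y v) = sc (qh ^ i) (Y ((G ^^ i) v))"
    by (induction i) (simp_all add: 1 linear_op_simps[OF lin_G] mult.commute)
  show "(G ^^ i) (Yi v) = sc (inverse qh ^ i) (Yi ((G ^^ i) v))"
    by (induction i) (simp_all add: 1 linear_op_simps[OF lin_G] mult.commute)
qed

text \<open>\<open>E\<close> reverses the direction of the shift \<open>G\<close>, up to polynomials in \<open>Y\<close>.\<close>
lemma G_E_G:
  "G (E (G x)) = sc (2 + \<delta>\<^sup>2) (E x) - sc (inverse (qh\<^sup>2)) (Yi (Yi (E x))) - sc (qh\<^sup>2) (Y (Y (E x)))"
  by (simp add: G_def E_E Y_\<Pi> Yi_\<Pi> linear_op_simps[OF lin_\<Pi>] op_simps power2_eq_square)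

text \<open>W need not be stable under G. But \<open>G_E_G\<close> replaces the inner G E G by E
  followed by a Laurent polynomial in Y, and Y passes through G^i up to a scalar, so the induction
  stays in W.\<close>

lemma G_power_E_G_power:
  assumes W: "subspace W" "\<And>u. u \<in> W \<Longrightarrow> Y u \<in> W" "\<And>u. u \<in> W \<Longrightarrow> Yi u \<in> W"
    and E: "\<And>u. u \<in> W \<Longrightarrow> E u \<in> W" and "u \<in> W"
  shows "(G ^^ i) (E ((G ^^ i) u)) \<in> W"
proof (induction i)
  case (Suc i)
  let ?x = "E ((G ^^ i) u)"
  have Y: "(G ^^ i) (Y z) \<in> W" "(G ^^ i) (Yi z) \<in> W" if "(G ^^ i) z \<in> W" for z
    using W that by (simp_all add: G_power_Y G_power_Yi subspace_scale)
  have "(G ^^ Suc i) (E ((G ^^ Suc i) u)) = (G ^^ i) (G (E (G ((G ^^ i) u))))"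
    by (simp only: funpow_Suc_right o_def) (simp only: funpow_swap1)
  also have "\<dots> = sc (2 + \<delta>\<^sup>2) ((G ^^ i) ?x) - sc (inverse (qh\<^sup>2)) ((G ^^ i) (Yi (Yi ?x)))
      - sc (qh\<^sup>2) ((G ^^ i) (Y (Y ?x)))"
    unfolding G_E_G by (simp only: linear_op_simps[OF lin_G_power])
  also have "\<dots> \<in> W"
    by (intro subspace_diff[OF W(1)] subspace_scale[OF W(1)] Y Suc)
  finally show ?case .
qed (use assms in simp)

text \<open>By finite dimension G maps U onto itself, so injectivity allows factors G to be
  cancelled.\<close>

lemma G_injective_on_stable:
  assumes U: "subspace U" "\<And>u. u \<in> U \<Longrightarrow> G u \<in> U" and "(G ^^ i) x \<in> U"
  shows "x \<in> U"
  using assms(3)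
proof (induction i arbitrary: x)
  case (Suc i)
  then have "(G ^^ i) (G x) \<in> U" by (simp add: funpow_swap1)
  then have Gx: "G x \<in> U" by (rule Suc.IH)
  obtain u where u: "u \<in> U" "G x = G u"
    by (rule injective_image_eq[OF lin_G U(1) U(2) G_eq_0D Gx])
  then have "G (x - u) = 0" by (simp add: linear_op_simps[OF lin_G])
  then have "x - u = 0" by (rule G_eq_0D)
  then show ?case using u(1) by simp
qed simp

lemma singular_case:
  assumes y1: "y ^ (2 * N) = 1"
  shows "dim (UNIV :: 'v set) = 4 * N" and "span (\<Union>z. eigenspace Y z) \<noteq> UNIV"
proof -
  have \<delta>0: "\<delta> \<noteq> 0"
  proof
    assume "\<delta> = 0"
    then have "th = inverse th" by (simp add: \<delta>_def)
    then have "th\<^sup>2 = 1" using th_nonzero by (metis power2_eq_square right_inverse)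
    then have "th ^ (2 * N) = 1" by (simp add: power_mult)
    then show False using unbroken y1 by simp
  qed
  have "1 \<in> spec UNIV"
  proof -
    have "1 ^ (2 * N) = y ^ (2 * N)" using y1 by simp
    then obtain j where "1 = qh ^ j * y" by (rule power_eq_imp_shift[OF _ y_nonzero])
    moreover have "qh ^ j * y \<in> spec UNIV"
      by (rule spec_shift[OF stable_UNIV _ y_spec]) (use spec_unbroken in blast)
    ultimately show ?thesis by simp
  qed
  then obtain v0 where v0: "v0 \<in> eigenspace Y 1" "v0 \<noteq> 0"
    unfolding spec_def eigenspace_def by auto
  \<comment> \<open>G^N joins the weights 1 and -1, exactly those at which E does not determine
    T.\<close>
  define F where "F = G ^^ N"
  have lin_F: "linear_op F" unfolding F_def by (rule lin_G_power)
  have F0: "F x = 0 \<Longrightarrow> x = 0" for x unfolding F_def using G_power_nonzero by blast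
  have F_Y: "F (Y x) = - Y (F x)" and F_Yi: "F (Yi x) = - Yi (F x)" for x
    unfolding F_def G_power_Y G_power_Yi power_inverse qh_N by simp_all
  have "\<exists>z. F z = x" for x
    by (rule injective_image_eq[OF lin_F subspace_UNIV UNIV_I F0 UNIV_I, of x]) metis+
  then obtain Fi where F_Fi: "\<And>x. F (Fi x) = x" by metis
  have F_inj: "a = b" if "F a = F b" for a b
  proof -
    have "F (a - b) = 0" using that by (simp add: linear_op_simps[OF lin_F])
    then have "a - b = 0" by (rule F0)
    then show ?thesis by simp
  qed
  have Fi_F: "Fi (F x) = x" for x by (rule F_inj) (rule F_Fi)
  have lin_Fi: "linear_op Fi" by (rule lin_inverse[OF lin_F F_Fi Fi_F])
  define A where "A x = Fi (T (F x)) - T x" for x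
  have lin_A: "linear_op A"
    by (rule linear_opI)
      (simp_all add: A_def op_simps linear_op_simps[OF lin_F] linear_op_simps[OF lin_Fi] scale_right_diff_distrib)
  \<comment> \<open>On a vector x fixed by Y, both T and its conjugate by F map x to a vector on
    which Y - 1 takes the value \<delta> x; in the difference A these values cancel.\<close>
  have A_st: "A x \<in> eigenspace Y 1" if "x \<in> eigenspace Y 1" for x
  proof -
    have Yx: "Y x = x" using that by (simp add: eigenspace_def)
    then have Yix: "Yi x = x" by (metis Yi_Y)
    have "Y (F x) = - F (Y x)" "Yi (F x) = - F (Yi x)" by (simp_all only: F_Y F_Yi minus_minus)
    then have "Y (F x) = - F x" "Yi (F x) = - F x" by (simp_all only: Yx Yix)
    then have "Y (T (F x)) = - T (F x) - sc \<delta> (F x)"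
      using Y_T[of "F x"] by (simp add: op_simps)
    moreover have "F (Y (Fi (T (F x)))) = - Y (T (F x))" by (simp add: F_Y F_Fi)
    ultimately have "F (Y (Fi (T (F x)))) = F (Fi (T (F x)) + sc \<delta> x)"
      by (simp add: linear_op_simps[OF lin_F] F_Fi)
    then have "Y (Fi (T (F x))) = Fi (T (F x)) + sc \<delta> x" by (rule F_inj)
    moreover have "Y (T x) = T x + sc \<delta> x" using Y_T[of x] Yx Yix by simp
    ultimately show ?thesis by (simp add: eigenspace_def A_def op_simps)
  qed
  obtain v a where v: "v \<in> eigenspace Y 1" "v \<noteq> 0" "A v = sc a v"
    by (rule exists_eigenvector[OF lin_A subspace_eigenspace[OF lin_Y] A_st v0])
  have Yv: "Y v = v" using v(1) by (simp add: eigenspace_def)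
  then have Yiv: "Yi v = v" by (metis Yi_Y)
  define w where "w = T v"
  \<comment> \<open>The eigenvector equation for A is what makes the span of F v and F w stable
    under T.\<close>
  have TFv: "T (F v) = F w + sc a (F v)"
  proof -
    have "Fi (T (F v)) = w + sc a v" using v(3) by (simp add: A_def w_def algebra_simps)
    then have "F (Fi (T (F v))) = F (w + sc a v)" by simp
    then show ?thesis by (simp add: F_Fi linear_op_simps[OF lin_F])
  qed
  have Tw: "T w = sc \<delta> w + v" by (simp add: w_def T_T)
  have TFw: "T (F w) = sc \<delta> (F w + sc a (F v)) + F v - sc a (F w + sc a (F v))"
  proof -
    have "F w = T (F v) - sc a (F v)" using TFv by simp
    then have "T (F w) = T (T (F v)) - sc a (T (F v))" by (simp add: op_simps)
    then show ?thesis by (simp only: T_T) (simp only: TFv)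
  qed
  have Yw: "Y w = w + sc \<delta> v" using Y_T[of v] Yv Yiv by (simp add: w_def)
  have Yiw: "Yi w = w - sc \<delta> v" using Yi_T[of v] Yv by (simp add: w_def)
  have Yiiw: "Yi (Yi w) = w - sc (2 * \<delta>) v"
    using scale_left_distrib[of \<delta> \<delta> v] by (simp add: Yiw op_simps Yiv)
  have Ev: "E v = sc \<delta> v" by (simp add: E_def Yiv)
  have Ew: "E w = sc (- \<delta>) w"
    using scale_left_distrib[of \<delta> \<delta> w] by (simp add: E_def Yiiw op_simps w_def[symmetric] algebra_simps)
  have YiF: "Yi (F x) = - F (Yi x)" for x by (simp only: F_Yi minus_minus)
  have EFv: "E (F v) = sc \<delta> (F v)"
    by (simp add: E_def YiF Yiv op_simps)
  have YiiFw: "Yi (Yi (F w)) = F w - sc (2 * \<delta>) (F v)"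
    by (simp add: YiF op_simps Yiiw linear_op_simps[OF lin_F])
  have EFw: "E (F w) = sc (- \<delta>) (F w) - sc (2 * \<delta> * a) (F v)"
    using scale_left_distrib[of \<delta> \<delta> "F w"]
    by (simp add: E_def YiiFw op_simps TFv scale_right_distrib algebra_simps)
  let ?W = "span {v, w}"
  have vW: "v \<in> ?W" and wW: "w \<in> ?W" by (auto intro: span_base)
  have YW: "Y u \<in> ?W" if "u \<in> ?W" for u
    by (rule span_stable[OF lin_Y _ that]) (use vW wW Yv Yw in \<open>auto intro!: span_add span_scale\<close>)
  have YiW: "Yi u \<in> ?W" if "u \<in> ?W" for u
    by (rule span_stable[OF lin_Yi _ that]) (use vW wW Yiv Yiw in \<open>auto intro!: span_diff span_scale\<close>)
  have EW: "E u \<in> ?W" if "u \<in> ?W" for u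
    by (rule span_stable[OF lin_E _ that]) (use vW wW Ev Ew in \<open>auto intro!: span_scale span_neg\<close>)
  have GEG: "(G ^^ i) (E ((G ^^ i) u)) \<in> ?W" if "u \<in> ?W" for i u
    by (rule G_power_E_G_power[OF subspace_span YW YiW EW that])
  \<comment> \<open>The cycle closes inside W: F E F v lies in W and E F v = \<delta> F v, so
    division by \<delta> \<noteq> 0 puts G^2N v into W.\<close>
  have FFv: "F (F v) \<in> ?W"
  proof -
    have "F (E (F v)) \<in> ?W" unfolding F_def by (rule GEG[OF vW])
    then have "sc \<delta> (F (F v)) \<in> ?W" by (simp add: EFv linear_op_simps[OF lin_F])
    then have "sc (inverse \<delta>) (sc \<delta> (F (F v))) \<in> ?W" by (rule span_scale)
    then show ?thesis using \<delta>0 by simp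
  qed
  have FFw: "F (F w) \<in> ?W"
  proof -
    have "F (E (F w)) \<in> ?W" unfolding F_def by (rule GEG[OF wW])
    then have "sc (- \<delta>) (F (F w)) - sc (2 * \<delta> * a) (F (F v)) \<in> ?W"
      by (simp only: EFw linear_op_simps[OF lin_F])
    then have "sc (- \<delta>) (F (F w)) - sc (2 * \<delta> * a) (F (F v)) + sc (2 * \<delta> * a) (F (F v)) \<in> ?W"
      using FFv by (intro span_add span_scale)
    then have "sc (- \<delta>) (F (F w)) \<in> ?W" by (simp only: diff_add_cancel)
    then have "sc (inverse (- \<delta>)) (sc (- \<delta>) (F (F w))) \<in> ?W" by (rule span_scale)
    then show ?thesis using \<delta>0 by simp
  qed
  have FF: "F (F x) = (G ^^ (2 * N)) x" for x
    unfolding F_def mult_2 funpow_add o_def ..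
  define S where "S = (\<lambda>i. (G ^^ i) v) ` {..<2 * N} \<union> (\<lambda>i. (G ^^ i) w) ` {..<2 * N}"
  have finS: "finite S" by (simp add: S_def)
  have cardS: "card S \<le> 4 * N"
  proof -
    have "card S \<le> card {..<2 * N} + card {..<2 * N}"
      unfolding S_def by (intro order.trans[OF card_Un_le] add_mono card_image_le) auto
    then show ?thesis by simp
  qed
  have Sv: "(G ^^ i) v \<in> span S" and Sw: "(G ^^ i) w \<in> span S" if "i < 2 * N" for i
    using that by (auto intro!: span_base simp: S_def)
  have WS: "u \<in> span S" if "u \<in> ?W" for u
  proof -
    have "{v, w} \<subseteq> span S" using Sv[of 0] Sw[of 0] N_pos by simp
    then have "?W \<subseteq> span S" by (rule span_minimal) simp
    then show ?thesis using that by blast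
  qed
  have S_cases: P if "s \<in> S" "\<And>i. i < 2 * N \<Longrightarrow> s = (G ^^ i) v \<Longrightarrow> P" "\<And>i. i < 2 * N \<Longrightarrow> s = (G ^^ i) w \<Longrightarrow> P" for s P
    using that unfolding S_def by auto
  have GS: "G u \<in> span S" if "u \<in> span S" for u
  proof (rule span_stable[OF lin_G _ that])
    fix s assume "s \<in> S"
    then show "G s \<in> span S"
    proof (rule S_cases)
      fix i assume i: "i < 2 * N" "s = (G ^^ i) v"
      show ?thesis
      proof (cases "Suc i = 2 * N")
        case True
        then have "G s = F (F v)" unfolding FF i(2) by (metis comp_apply funpow.simps(2))
        then show ?thesis using WS[OF FFv] by simp
      next
        case False
        then show ?thesis using Sv[of "Suc i"] i by simp
      qed
    next
      fix i assume i: "i < 2 * N" "s = (G ^^ i) w"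
      show ?thesis
      proof (cases "Suc i = 2 * N")
        case True
        then have "G s = F (F w)" unfolding FF i(2) by (metis comp_apply funpow.simps(2))
        then show ?thesis using WS[OF FFw] by simp
      next
        case False
        then show ?thesis using Sw[of "Suc i"] i by simp
      qed
    qed
  qed
  have GI: "x \<in> span S" if "(G ^^ i) x \<in> span S" for i x
    by (rule G_injective_on_stable[OF subspace_span GS that])
  \<comment> \<open>G^i E G^i v and G^i E G^i w lie in W, and the factor G^i in front is cancelled
    by \<open>GI\<close>.\<close>
  have ES: "E u \<in> span S" if "u \<in> span S" for u
  proof (rule span_stable[OF lin_E _ that])
    fix s assume "s \<in> S"
    then show "E s \<in> span S"
    proof (rule S_cases)
      fix i assume "s = (G ^^ i) v"
      then have "(G ^^ i) (E s) \<in> span S" using WS[OF GEG[OF vW, of i]] by simp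
      then show ?thesis by (rule GI)
    next
      fix i assume "s = (G ^^ i) w"
      then have "(G ^^ i) (E s) \<in> span S" using WS[OF GEG[OF wW, of i]] by simp
      then show ?thesis by (rule GI)
    qed
  qed
  \<comment> \<open>\<Pi> = G E^-1, and E is invertible on the span.\<close>
  have \<Pi>S: "\<Pi> u \<in> span S" if u: "u \<in> span S" for u
  proof -
    obtain x where "x \<in> span S" "u = E x"
      by (rule injective_image_eq[OF lin_E subspace_span ES E_eq_0D u])
    then show ?thesis using GS[of x] by (simp add: G_def)
  qed
  have YiG: "Yi ((G ^^ i) x) = sc (qh ^ i) ((G ^^ i) (Yi x))" for i x
    using qh_nonzero by (simp add: G_power_Yi power_inverse)
  have YG: "Y ((G ^^ i) x) = sc (inverse (qh ^ i)) ((G ^^ i) (Y x))" for i x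
    using qh_nonzero by (simp add: G_power_Y)
  have TG: "T ((G ^^ i) v) \<in> span S \<and> T ((G ^^ i) w) \<in> span S" if i: "i < 2 * N" for i
  proof -
    \<comment> \<open>The weight of G^i v is q^(-i/2), whose square is 1 only for i = 0 and i = N.
      At these two T is known from \<open>w_def\<close>, \<open>Tw\<close>, \<open>TFv\<close> and
      \<open>TFw\<close>; elsewhere E determines it.\<close>
    have "i = 0 \<or> i = N \<or> qh ^ (2 * i) \<noteq> 1"
    proof (cases "qh ^ (2 * i) = 1")
      case True
      then have "(qh ^ i)\<^sup>2 = 1" by (simp add: power_mult[symmetric] mult.commute)
      then have "qh ^ i = qh ^ 0 \<or> qh ^ i = qh ^ N" by (simp add: power2_eq_1_iff qh_N)
      then have "i = 0 \<or> i = N"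
      proof
        assume "qh ^ i = qh ^ 0"
        then have "i = 0" by (rule primitive_root_power_inj[OF prim _ i]) (use N_pos in simp)
        then show ?thesis ..
      next
        assume "qh ^ i = qh ^ N"
        then have "i = N" by (rule primitive_root_power_inj[OF prim _ i]) (use N_pos in simp)
        then show ?thesis ..
      qed
      then show ?thesis by blast
    qed simp
    then consider "i = 0" | "i = N" | "qh ^ (2 * i) \<noteq> 1" by blast
    then show ?thesis
    proof cases
      case 1
      then show ?thesis using WS[OF vW] WS[OF wW] by (simp add: Tw w_def[symmetric] span_add span_scale)
    next
      case 2
      have "N < 2 * N" using N_pos by simp
      then have "F v \<in> span S" "F w \<in> span S" unfolding F_def by (rule Sv, rule Sw)
      then show ?thesis
        unfolding 2 F_def[symmetric] TFv TFw by (simp add: span_add span_diff span_scale)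
    next
      case 3
      have ne: "qh ^ (2 * i) - 1 \<noteq> 0" using 3 by simp
      have div: "x \<in> span S" if "sc (qh ^ (2 * i) - 1) x \<in> span S" for x
        using span_scale[OF that, of "inverse (qh ^ (2 * i) - 1)"] ne by simp
      have q: "qh ^ i * qh ^ i = qh ^ (2 * i)" by (simp add: mult_2 power_add)
      have "E ((G ^^ i) v) = sc (qh ^ (2 * i) - 1) (T ((G ^^ i) v)) + sc \<delta> ((G ^^ i) v)"
        by (simp add: E_def YiG Yiv op_simps q scale_left_diff_distrib)
      then have eqv: "sc (qh ^ (2 * i) - 1) (T ((G ^^ i) v)) = E ((G ^^ i) v) - sc \<delta> ((G ^^ i) v)" by simp
      have Tv: "T ((G ^^ i) v) \<in> span S"
        by (rule div, unfold eqv) (rule span_diff[OF ES[OF Sv[OF i]] span_scale[OF Sv[OF i]]])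
      have "Yi (Yi ((G ^^ i) w)) = sc (qh ^ (2 * i)) ((G ^^ i) w - sc (2 * \<delta>) ((G ^^ i) v))"
        by (simp add: YiG op_simps q Yiiw linear_op_simps[OF lin_G_power] del: funpow.simps)
      then have "E ((G ^^ i) w) = sc (qh ^ (2 * i) - 1) (T ((G ^^ i) w))
          - sc (qh ^ (2 * i) * (2 * \<delta>)) (T ((G ^^ i) v)) + sc \<delta> ((G ^^ i) w)"
        by (simp add: E_def op_simps scale_left_diff_distrib scale_right_diff_distrib)
      then have eqw: "sc (qh ^ (2 * i) - 1) (T ((G ^^ i) w))
          = E ((G ^^ i) w) - sc \<delta> ((G ^^ i) w) + sc (qh ^ (2 * i) * (2 * \<delta>)) (T ((G ^^ i) v))" by simp
      have "T ((G ^^ i) w) \<in> span S"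
        by (rule div, unfold eqw) (rule span_add[OF span_diff[OF ES[OF Sw[OF i]] span_scale[OF Sw[OF i]]] span_scale[OF Tv]])
      then show ?thesis using Tv by blast
    qed
  qed
  have "stable (span S)"
  proof (rule stableI_\<Pi>[OF subspace_span \<Pi>S])
    show "T u \<in> span S" if "u \<in> span S" for u
      by (rule span_stable[OF lin_T _ that]) (erule S_cases; use TG in blast)
    show "Y u \<in> span S" if "u \<in> span S" for u
    proof (rule span_stable[OF lin_Y _ that])
      fix s assume "s \<in> S"
      then show "Y s \<in> span S"
        by (rule S_cases) (use Sv Sw in \<open>simp_all add: YG Yv Yw linear_op_simps[OF lin_G_power] span_add span_scale\<close>)
    qed
    show "Yi u \<in> span S" if "u \<in> span S" for u
    proof (rule span_stable[OF lin_Yi _ that])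
      fix s assume "s \<in> S"
      then show "Yi s \<in> span S"
        by (rule S_cases) (use Sv Sw in \<open>simp_all add: YiG Yiv Yiw linear_op_simps[OF lin_G_power] span_diff span_scale\<close>)
    qed
  qed
  then have UNIV: "span S = UNIV"
    by (rule stable_eq_UNIV[OF _ WS[OF vW] v(2)])
  have dim_le: "dim (UNIV :: 'v set) \<le> 4 * N"
    using dim_le_card[of UNIV S] finS cardS UNIV by simp
  \<comment> \<open>Y^2N fixes each G^i v and adds 2N \<delta> G^i v to G^i w. So Y^2N - 1, applied
    to a linear relation, isolates the coefficients of the G^i w. It is not zero, whereas all
    weights satisfy z^2N = 1, so Y cannot be diagonalizable.\<close>
  let ?P = "Y ^^ (2 * N)"
  have lin_P: "linear_op ?P"
  proof -
    have "linear_op (Y ^^ n)" for n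
      by (induction n) (simp_all add: linear_opI op_simps linear_op_simps)
    then show ?thesis .
  qed
  have Pv: "(Y ^^ n) v = v" for n by (induction n) (simp_all add: Yv)
  have Pw: "(Y ^^ n) w = w + sc (of_nat n * \<delta>) v" for n
    by (induction n) (simp_all add: op_simps Yv Yw algebra_simps)
  have eig: "independent_family {..<2 * N} (\<lambda>i. (G ^^ i) v)"
  proof (rule independent_eigenvectors_indexed[OF lin_Y])
    show "inj_on (\<lambda>i. inverse (qh ^ i)) {..<2 * N}"
      using primitive_root_power_inj[OF prim] by (auto intro!: inj_onI)
  qed (use v(2) in \<open>simp_all add: eigenspace_def YG Yv G_power_nonzero\<close>)
  let ?I = "{..<2 * N}"
  define f where "f x = (if fst x then (G ^^ snd x) v else (G ^^ snd x) w)" for x :: "bool \<times> nat"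
  have "independent_family (UNIV \<times> ?I) f"
    unfolding independent_family_def
  proof (intro allI impI ballI)
    fix c x assume s: "(\<Sum>x\<in>UNIV \<times> ?I. sc (c x) (f x)) = 0" and x: "x \<in> (UNIV :: bool set) \<times> ?I"
    have "(\<Sum>x\<in>UNIV \<times> ?I. sc (c x) (f x)) = (\<Sum>b\<in>UNIV. \<Sum>i\<in>?I. sc (c (b, i)) (f (b, i)))"
      by (simp only: sum.cartesian_product split_def prod.collapse)
    then have s2: "(\<Sum>i\<in>?I. sc (c (True, i)) ((G ^^ i) v)) + (\<Sum>i\<in>?I. sc (c (False, i)) ((G ^^ i) w)) = 0"
      using s by (simp add: UNIV_bool f_def add.commute)
    have "?P (\<Sum>i\<in>?I. sc (c (True, i)) ((G ^^ i) v)) = (\<Sum>i\<in>?I. sc (c (True, i)) ((G ^^ i) v))"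
      by (simp only: linear_op_simps[OF lin_P] Y_power_G Pv)
    moreover have "?P (\<Sum>i\<in>?I. sc (c (False, i)) ((G ^^ i) w)) = (\<Sum>i\<in>?I. sc (c (False, i)) ((G ^^ i) w))
        + (\<Sum>i\<in>?I. sc (c (False, i) * (of_nat (2 * N) * \<delta>)) ((G ^^ i) v))"
      by (simp only: linear_op_simps[OF lin_P] Y_power_G Pw linear_op_simps[OF lin_G_power]
          scale_right_distrib sum.distrib scale_scale)
    ultimately have "?P 0 = 0 + (\<Sum>i\<in>?I. sc (c (False, i) * (of_nat (2 * N) * \<delta>)) ((G ^^ i) v))"
      unfolding s2[symmetric] linear_op_simps(1)[OF lin_P] by (simp add: add.assoc)
    then have "(\<Sum>i\<in>?I. sc (c (False, i) * (of_nat (2 * N) * \<delta>)) ((G ^^ i) v)) = 0"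
      by (simp only: linear_op_simps(3)[OF lin_P] add_0)
    then have "\<forall>i\<in>?I. c (False, i) * (of_nat (2 * N) * \<delta>) = 0"
      by (rule eig[unfolded independent_family_def, THEN spec, THEN mp])
    then have F: "c (False, i) = 0" if "i \<in> ?I" for i using that \<delta>0 N_pos by auto
    then have "(\<Sum>i\<in>?I. sc (c (True, i)) ((G ^^ i) v)) = 0" using s2 by simp
    then have "c (True, i) = 0" if "i \<in> ?I" for i
      using eig[unfolded independent_family_def, THEN spec, of "\<lambda>i. c (True, i)"] that by blast
    then show "c x = 0" using F x by (cases x; cases "fst x") auto
  qed
  then have "card ((UNIV :: bool set) \<times> ?I) \<le> dim (UNIV :: 'v set)"
    by (intro independent_family_card_le) auto
  then show "dim (UNIV :: 'v set) = 4 * N" using dim_le by (simp add: card_cartesian_product)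
  show "span (\<Union>z. eigenspace Y z) \<noteq> UNIV"
  proof
    assume ss: "span (\<Union>z. eigenspace Y z) = UNIV"
    have "x \<in> eigenspace ?P 1" if x: "x \<in> (\<Union>z. eigenspace Y z)" for x
    proof (cases "x = 0")
      case True
      then show ?thesis using subspace_0[OF subspace_eigenspace[OF lin_P]] by simp
    next
      case False
      obtain z where z: "Y x = sc z x" using x by (auto simp: eigenspace_def)
      then have "z \<in> spec UNIV" using False unfolding spec_def by blast
      then have "z ^ (2 * N) = 1" using spec_orbit y1 by fastforce
      moreover have "(Y ^^ n) x = sc (z ^ n) x" for n
        by (induction n) (simp_all add: op_simps z mult.commute)
      ultimately show ?thesis by (simp only: eigenspace_def mem_Collect_eq)
    qed
    then have "span (\<Union>z. eigenspace Y z) \<subseteq> eigenspace ?P 1"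
      by (intro span_minimal subspace_eigenspace[OF lin_P]) blast
    then have "?P w = w" using ss by (auto simp: eigenspace_def)
    then show False using Pw[of "2 * N"] \<delta>0 N_pos v(2) by simp
  qed
qed

end

section \<open>Quotients of the polynomial representation\<close>

text \<open>The relations pass along a surjection; stability of the kernel under the inverses is
  what makes X and Y injective on the quotient.\<close>

lemma daha_quotient:
  assumes D: "daha sc qh th X Xi Y Yi T"
    and f: "Vector_Spaces.linear sc (scal W) f" "surj f"
    and hom: "\<And>v. f (X v) = actX W (f v)" "\<And>v. f (Y v) = actY W (f v)" "\<And>v. f (T v) = actT W (f v)"
    and ker: "\<And>v. f v = 0 \<Longrightarrow> f (Xi v) = 0" "\<And>v. f v = 0 \<Longrightarrow> f (Yi v) = 0"
  shows "daha_of qh th W"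
proof -
  interpret D: daha sc qh th X Xi Y Yi T by (rule D)
  interpret f: Vector_Spaces.linear sc "scal W" f by (rule f(1))
  interpret W: complex_vector_space "scal W" by unfold_locales
  have ex: "\<exists>v. w = f v" for w using f(2) by (metis surjD)
  have lin: "W.linear_op A" if "\<And>v. f (B v) = A (f v)" "D.linear_op B" for A B
  proof (rule W.linear_opI)
    show "A (u + w) = A u + A w" for u w
    proof -
      obtain a b where "u = f a" "w = f b" using ex by metis
      then show ?thesis
        by (simp add: that(1)[symmetric] f.add[symmetric] D.linear_op_simps[OF that(2)])
    qed
    show "A (scal W c w) = scal W c (A w)" for c w
    proof -
      obtain a where "w = f a" using ex by metis
      then show ?thesis
        by (simp add: that(1)[symmetric] f.scale[symmetric] D.linear_op_simps[OF that(2)])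
    qed
  qed
  have bij: "bij A \<and> (\<forall>v. inv A (f v) = f (Bi v))"
    if A: "\<And>v. f (B v) = A (f v)" and B: "D.linear_op B" and i: "\<And>v. B (Bi v) = v" "\<And>v. Bi (B v) = v"
      and k: "\<And>v. f v = 0 \<Longrightarrow> f (Bi v) = 0" for A B Bi
  proof -
    have inj: "inj A"
    proof (rule injI)
      fix u w assume "A u = A w"
      obtain a b where ab: "u = f a" "w = f b" using ex by metis
      then have "f (B (a - b)) = 0"
        using \<open>A u = A w\<close> by (simp add: D.linear_op_simps[OF B] f.diff A)
      then have "f (a - b) = 0" using k[of "B (a - b)"] by (simp add: i)
      then show "u = w" using ab by (simp add: f.diff)
    qed
    have "surj A"
      unfolding surj_def
    proof
      fix w
      obtain v where "w = f v" using ex by metis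
      then have "w = A (f (Bi v))" by (simp add: A[symmetric] i)
      then show "\<exists>u. w = A u" by blast
    qed
    moreover have "inv A (f v) = f (Bi v)" for v
      by (rule inv_f_eq[OF inj]) (simp add: A[symmetric] i)
    ultimately show ?thesis using inj by (simp add: bij_def)
  qed
  note bX = bij[OF hom(1) D.lin_X D.X_Xi D.Xi_X ker(1)] and bY = bij[OF hom(2) D.lin_Y D.Y_Yi D.Yi_Y ker(2)]
  have iX: "inv (actX W) (f v) = f (Xi v)" and iY: "inv (actY W) (f v) = f (Yi v)" for v
    using bX bY by simp_all
  note h = hom[symmetric] iX iY f.scale[symmetric] f.add[symmetric]
  show ?thesis
  proof (intro daha.intro daha_axioms.intro W.complex_vector_space_axioms D.qh_nonzero D.th_nonzero)
    show "W.linear_op (actX W)" "W.linear_op (actY W)" "W.linear_op (actT W)"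
      by (rule lin[OF hom(1) D.lin_X] lin[OF hom(2) D.lin_Y] lin[OF hom(3) D.lin_T])+
    fix w
    obtain v where w: "w = f v" using ex by metis
    show "actX W (inv (actX W) w) = w" "inv (actX W) (actX W w) = w"
      "actY W (inv (actY W) w) = w" "inv (actY W) (actY W w) = w"
      unfolding w by (simp_all add: h)
    show "actT W (actX W (actT W w)) = inv (actX W) w" unfolding w by (simp only: h D.TXT)
    show "actT W (inv (actY W) (actT W w)) = actY W w" unfolding w by (simp only: h D.TYT)
    show "actX W (actY W w) = scal W qh (actY W (actX W (actT W (actT W w))))"
      unfolding w by (simp only: h D.XY)
    show "actT W (actT W w) = scal W (th - inverse th) (actT W w) + w"
      unfolding w by (simp only: h D.TT)
  qed
qed

section \<open>From records to locales\<close>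

lemma finite_dimensional_basis:
  assumes "vector_space sc" "finite_dimensional sc UNIV"
  obtains Basis where "finite_dimensional_vector_space sc Basis"
proof -
  interpret vector_space sc by fact
  obtain F where F: "finite F" "span F = UNIV" using assms(2) unfolding finite_dimensional_def by blast
  obtain B where B: "B \<subseteq> F" "independent B" "F \<subseteq> span B" by (metis basis_exists)
  have "span F \<subseteq> span B" using B(3) by (intro span_minimal subspace_span)
  then have "span B = UNIV" using F(2) by auto
  moreover have "finite B" using B(1) F(1) finite_subset by blast
  ultimately have "finite_dimensional_vector_space sc B"
    using B(2) by unfold_locales
  then show ?thesis by (rule that)
qed

abbreviation findim_daha_of :: "complex \<Rightarrow> complex \<Rightarrow> nat \<Rightarrow> 'v set \<Rightarrow> ('v::ab_group_add) daha_rep \<Rightarrow> bool" where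
  "findim_daha_of qh th N Basis V \<equiv>
    findim_daha (scal V) qh th (actX V) (inv (actX V)) (actY V) (inv (actY V)) (actT V) Basis N"

lemma findim_dahaI:
  assumes "daha_of qh th V" "finite_dimensional (scal V) (UNIV :: 'v::ab_group_add set)"
    "N \<ge> 1" "primitive_root (2 * N) qh"
  obtains Basis where "findim_daha_of qh th N Basis V"
proof -
  interpret daha "scal V" qh th "actX V" "inv (actX V)" "actY V" "inv (actY V)" "actT V" by fact
  obtain B where "finite_dimensional_vector_space (scal V) B"
    by (rule finite_dimensional_basis[OF vector_space_axioms assms(2)])
  then have "findim_daha_of qh th N B V"
    by (intro findim_daha.intro findim_complex_vector_space.intro findim_daha_axioms.intro
        complex_vector_space_axioms assms(1,3,4))
  then show ?thesis by (rule that)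
qed

lemma irreducible_iff:
  fixes V :: "('v::ab_group_add) daha_rep"
  assumes "qh \<noteq> 0" "th \<noteq> 0"
  shows "irreducible_daha_module qh th V \<longleftrightarrow> daha_of qh th V \<and> (\<exists>v. v \<noteq> (0 :: 'v)) \<and>
    (\<forall>U. daha.stable (scal V) (actX V) (inv (actX V)) (actY V) (inv (actY V)) (actT V) U
      \<longrightarrow> U = {0} \<or> U = UNIV)"
proof -
  have dm: "daha_module qh th V \<longleftrightarrow> daha_of qh th V"
    by (rule iffI, rule daha_moduleD[OF _ assms], assumption, rule daha_of_daha_module, assumption)
  have "(UNIV :: 'v set) = {0} \<longleftrightarrow> (\<forall>v::'v. v = 0)" by (simp add: set_eq_iff)
  then have ne: "(UNIV :: 'v set) \<noteq> {0} \<longleftrightarrow> (\<exists>v. v \<noteq> (0 :: 'v))" by simp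
  show ?thesis
  proof (cases "daha_of qh th V")
    case True
    show ?thesis
      unfolding irreducible_daha_module_def dm submodule_iff_stable[OF True] by (simp only: ne)
  next
    case False
    then show ?thesis unfolding irreducible_daha_module_def dm by simp
  qed
qed

text \<open>Stated with eigenspaces only, so that it is visibly preserved by the twists; it implies
  \<open>Y_simple_spectrum\<close>.\<close>

definition Y_split :: "('v::ab_group_add) daha_rep \<Rightarrow> bool" where
  "Y_split V \<longleftrightarrow> Y_semisimple V \<and>
    (\<forall>z. Y_eigenvalue V z \<longrightarrow> vector_space.dim (scal V) (Y_eigenspace V z) = 1)"

context
  fixes V :: "('v::ab_group_add) daha_rep" and qh th N Basis
  assumes V: "findim_daha_of qh th N Basis V"
begin

interpretation findim_daha "scal V" qh th "actX V" "inv (actX V)" "actY V" "inv (actY V)" "actT V" Basis N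
  by (rule V)

lemma Y_eigenspace_eq: "Y_eigenspace V z = eigenspace (actY V) z"
  by (simp add: Y_eigenspace_def eigenspace_def)

lemma Y_eigenvalue_iff: "Y_eigenvalue V z \<longleftrightarrow> z \<in> spec UNIV"
  by (auto simp: Y_eigenvalue_def Y_eigenspace_def spec_def)

lemma Y_semisimple_iff: "Y_semisimple V \<longleftrightarrow> span (\<Union>z. eigenspace (actY V) z) = UNIV"
  by (simp add: Y_semisimple_def Y_eigenspace_eq)

lemma Y_multiplicity_eq: "Y_semisimple V \<Longrightarrow> Y_multiplicity V z = dim (Y_eigenspace V z)"
  unfolding Y_multiplicity_def Y_semisimple_iff Y_eigenspace_eq
  by (simp add: generalized_eigenspace_eq[OF lin_Y])

lemma Y_split_iff: "Y_split V \<longleftrightarrow> simple_spectrum"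
  unfolding Y_split_def simple_spectrum_def Y_semisimple_iff Y_eigenspace_eq Y_eigenvalue_def by blast

lemma Y_split_imp_simple_spectrum: "Y_split V \<Longrightarrow> Y_simple_spectrum V"
  unfolding Y_split_def Y_simple_spectrum_def using Y_multiplicity_eq by simp

lemma dimension_eq: "Defs.dimension V = dim UNIV"
  by (simp add: Defs.dimension_def)

lemma finite_dimensional_V: "finite_dimensional (scal V) UNIV"
  unfolding finite_dimensional_def using finite_Basis span_Basis by blast

end

section \<open>Twists by iota and varsigma_y\<close>

definition twist :: "bool \<Rightarrow> bool \<Rightarrow> ('v::ab_group_add) daha_rep \<Rightarrow> 'v daha_rep" where
  "twist i j V = (if i then iota else id) ((if j then varsigma_y else id) V)"

definition twist_param :: "bool \<Rightarrow> complex \<Rightarrow> complex" where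
  "twist_param i th = (if i then inverse th else th)"

lemma twist_simps [simp]:
  "scal (twist i j V) = scal V" "actX (twist i j V) = actX V"
  "actY (twist i j V) = (\<lambda>v. if j then - actY V v else actY V v)"
  "actT (twist i j V) = (\<lambda>v. if i then - actT V v else actT V v)"
  by (auto simp: twist_def iota_def varsigma_y_def)

lemma twist_twist [simp]: "twist i j (twist i j V) = V"
  by (cases V) (auto simp: twist_def iota_def varsigma_y_def)

lemma twist_param_twist_param [simp]: "twist_param i (twist_param i th) = th"
  by (simp add: twist_param_def)

lemma twist_param_nonzero: "th \<noteq> 0 \<Longrightarrow> twist_param i th \<noteq> 0"
  by (simp add: twist_param_def)

lemma twist_param_power: "th \<noteq> 0 \<Longrightarrow> twist_param i th ^ n = 1 \<longleftrightarrow> th ^ n = 1"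
  by (simp add: twist_param_def power_inverse)

lemma poly_rep_images_eq:
  "poly_rep_images qh th = {twist i j (poly_rep qh (twist_param i th)) |i j. True}"
  by (auto simp: poly_rep_images_def twist_def twist_param_def split: if_splits)

text \<open>T occurs an even number of times in every relation but the quadratic one, where changing
  its sign amounts to inverting t^(1/2). A sign of Y appears on both sides of T Y^-1 T = Y and
  cancels in the relation containing q.\<close>

lemma daha_twist:
  assumes "daha sc qh th X Xi Y Yi T"
  shows "daha sc qh (twist_param i th) X Xi (\<lambda>v. if j then - Y v else Y v)
    (\<lambda>v. if j then - Yi v else Yi v) (\<lambda>v. if i then - T v else T v)"
proof -
  interpret daha sc qh th X Xi Y Yi T by (rule assms)
  note s = op_simps
  have lY: "linear_op (\<lambda>v. if j then - Y v else Y v)"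
    by (rule linear_opI) (simp_all add: s)
  have lT: "linear_op (\<lambda>v. if i then - T v else T v)"
    by (rule linear_opI) (simp_all add: s)
  have dd: "sc (inverse th - th) u = - sc (th - inverse th) u" for u
    by (simp flip: scale_minus_left)
  show ?thesis
    by (intro daha.intro daha_axioms.intro complex_vector_space_axioms lin_X lY lT qh_nonzero
        twist_param_nonzero[OF th_nonzero])
      (auto simp: s TXT TYT XY TT twist_param_def dd)
qed

lemma daha_of_twist:
  assumes "daha_of qh th V"
  shows "daha_of qh (twist_param i th) (twist i j V)"
    and "inv (actY (twist i j V)) = (\<lambda>v. if j then - inv (actY V) v else inv (actY V) v)"
proof -
  note D = daha_twist[OF assms, of i j]
  show *: "inv (actY (twist i j V)) = (\<lambda>v. if j then - inv (actY V) v else inv (actY V) v)"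
    using daha.daha_moduleI(3)[OF D] by simp
  show "daha_of qh (twist_param i th) (twist i j V)"
    unfolding * unfolding twist_simps by (rule D)
qed

lemma irreducible_twist:
  fixes V :: "('a::ab_group_add) daha_rep"
  assumes "qh \<noteq> 0" "th \<noteq> 0" "irreducible_daha_module qh th V"
  shows "irreducible_daha_module qh (twist_param i th) (twist i j V)"
proof -
  have D: "daha_of qh th V" and ne: "\<exists>v. v \<noteq> (0 :: 'a)"
    and S: "\<And>U. daha.stable (scal V) (actX V) (inv (actX V)) (actY V) (inv (actY V)) (actT V) U \<Longrightarrow> U = {0} \<or> U = UNIV"
    using irreducible_iff[OF assms(1,2), of V] assms(3) by blast+
  note D' = daha_of_twist[OF D, of i j]
  interpret D: daha "scal V" qh th "actX V" "inv (actX V)" "actY V" "inv (actY V)" "actT V" by (rule D)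
  have "D.stable U" if "daha.stable (scal (twist i j V)) (actX (twist i j V)) (inv (actX (twist i j V)))
      (actY (twist i j V)) (inv (actY (twist i j V))) (actT (twist i j V)) U" for U
  proof -
    note st = that[unfolded daha.stable_def[OF D'(1)], unfolded D'(2), unfolded twist_simps]
    then have sub: "D.subspace U" by blast
    have neg: "- x \<in> U \<longleftrightarrow> x \<in> U" for x
      using D.subspace_neg[OF sub, of x] D.subspace_neg[OF sub, of "- x"] by auto
    show ?thesis
      using st unfolding D.stable_def by (cases i; cases j) (simp_all add: neg)
  qed
  then show ?thesis
    unfolding irreducible_iff[OF assms(1) twist_param_nonzero[OF assms(2)]]
    using D'(1) ne S by blast
qed

lemma Y_split_twist:
  assumes "daha_of qh th V" "Y_split V"
  shows "Y_split (twist i j V)"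
proof -
  interpret daha "scal V" qh th "actX V" "inv (actX V)" "actY V" "inv (actY V)" "actT V" by fact
  have e: "Y_eigenspace (twist i j V) z = Y_eigenspace V (if j then - z else z)" for z
    by (auto simp: Y_eigenspace_def minus_equation_iff) (metis minus_minus)+
  have ev: "Y_eigenvalue (twist i j V) z = Y_eigenvalue V (if j then - z else z)" for z
    unfolding Y_eigenvalue_def e ..
  have "(\<Union>z. Y_eigenspace (twist i j V) z) = (\<Union>z. Y_eigenspace V z)"
  proof (intro equalityI UN_least)
    fix z
    show "Y_eigenspace V z \<subseteq> (\<Union>z. Y_eigenspace (twist i j V) z)"
      using e[of "if j then - z else z"] by (cases j) auto
  qed (use e in blast)
  then show ?thesis
    using assms(2) unfolding Y_split_def Y_semisimple_def by (simp add: e ev)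
qed

lemma intertwiner_twist:
  assumes "intertwiner V W f"
  shows "intertwiner (twist i j V) (twist i j W) f"
proof -
  have lin: "Vector_Spaces.linear (scal V) (scal W) f" using assms by (simp add: intertwiner_def)
  then interpret f: Vector_Spaces.linear "scal V" "scal W" f .
  show ?thesis using assms unfolding intertwiner_def by (simp add: f.neg)
qed

text \<open>Twists are involutions and keep intertwiners, so a twist can be moved from the
  polynomial representation to V. This reduces its four images to the untwisted one.\<close>

lemma is_quotient_by_twist:
  "is_quotient_by (twist i j P) J V \<longleftrightarrow> is_quotient_by P J (twist i j V)"
  unfolding is_quotient_by_def
  using intertwiner_twist[of "twist i j P" V _ i j] intertwiner_twist[of P "twist i j V" _ i j] by fastforce

lemma is_quotient_twist:
  "is_quotient (twist i j P) V \<longleftrightarrow> is_quotient P (twist i j V)"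
  unfolding is_quotient_def
  using intertwiner_twist[of "twist i j P" V _ i j] intertwiner_twist[of P "twist i j V" _ i j] by fastforce

text \<open>The four eigenvalue pairs (a, b) correspond to the four twists: iota turns -t^(-1/2)
  into t^(-1/2), the parameter of the twisted module, and varsigma_y corrects the sign of b.\<close>

lemma exists_twist_character:
  assumes "daha_of qh th V" and "a = th \<or> a = - inverse th" "b = a \<or> b = - a"
    "actT V w = scal V a w" "actY V w = scal V b w"
  shows "\<exists>i j. actT (twist i j V) w = scal V (twist_param i th) w \<and>
    actY (twist i j V) w = scal V (twist_param i th) w"
proof -
  interpret daha "scal V" qh th "actX V" "inv (actX V)" "actY V" "inv (actY V)" "actT V" by fact
  show ?thesis
    using assms(2)
  proof
    assume "a = th"
    then show ?thesis using assms(3-5)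
      by (intro exI[of _ False] exI[of _ "b \<noteq> a"]) (auto simp: twist_param_def)
  next
    assume "a = - inverse th"
    then show ?thesis using assms(3-5)
      by (intro exI[of _ True] exI[of _ "b = a"]) (auto simp: twist_param_def)
  qed
qed

lemma is_quotient_of_poly_rep:
  fixes V :: "('v::ab_group_add) daha_rep"
  assumes nz: "qh \<noteq> 0" "th \<noteq> 0" and V: "irreducible_daha_module qh th V"
    and w: "actT V w = scal V th w" "actY V w = scal V th w" "w \<noteq> 0"
  shows "is_quotient (poly_rep qh th) V"
proof -
  have D: "daha_of qh th V"
    and S: "\<And>U. daha.stable (scal V) (actX V) (inv (actX V)) (actY V) (inv (actY V)) (actT V) U \<Longrightarrow> U = {0} \<or> U = UNIV"
    using irreducible_iff[OF nz, of V] V by blast+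
  interpret daha "scal V" qh th "actX V" "inv (actX V)" "actY V" "inv (actY V)" "actT V" by (rule D)
  interpret simple_daha "scal V" qh th "actX V" "inv (actX V)" "actY V" "inv (actY V)" "actT V"
    by unfold_locales (rule S)
  show ?thesis
    unfolding is_quotient_def
    using intertwiner_ev[OF w(1,2) refl refl refl refl] generated_by_character[OF w] by blast
qed

lemma irreducible_quotient_cases:
  fixes V :: "('v::ab_group_add) daha_rep"
  assumes nz: "qh \<noteq> 0" "th \<noteq> 0" and V: "irreducible_daha_module qh th V"
    and fin: "finite_dimensional (scal V) (UNIV :: 'v set)"
    and N: "N \<ge> 1" "primitive_root (2 * N) qh"
    and w: "actT V w = scal V th w" "actY V w = scal V th w" "w \<noteq> 0" and th: "th ^ (4 * N) \<noteq> 1"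
  shows "(\<exists>C. C \<noteq> 2 \<and> is_quotient_by (poly_rep qh th) (principal_ideal (trinomial (2 * int N) C)) V
      \<and> dimension V = 4 * N \<and> Y_split V)
    \<or> is_quotient_by (poly_rep qh th) (principal_ideal (trinomial (int N) 0)) V \<and> dimension V = 2 * N"
proof -
  have D: "daha_of qh th V"
    and S: "\<And>U. daha.stable (scal V) (actX V) (inv (actX V)) (actY V) (inv (actY V)) (actT V) U \<Longrightarrow> U = {0} \<or> U = UNIV"
    using irreducible_iff[OF nz, of V] V by blast+
  obtain Basis where F: "findim_daha_of qh th N Basis V" by (rule findim_dahaI[OF D fin N])
  interpret findim_daha "scal V" qh th "actX V" "inv (actX V)" "actY V" "inv (actY V)" "actT V" Basis N
    by (rule F)
  interpret simple_daha "scal V" qh th "actX V" "inv (actX V)" "actY V" "inv (actY V)" "actT V"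
    by unfold_locales (rule S)
  have q: "is_quotient_by (poly_rep qh th) {p. ev p w = 0} V"
    unfolding is_quotient_by_def
    using intertwiner_ev[OF w(1,2) refl refl refl refl] generated_by_character[OF w] by blast
  show ?thesis
    using simple_quotient_cases[OF S w th]
  proof
    assume "\<exists>C. C \<noteq> 2 \<and> {p. ev p w = 0} = principal_ideal (trinomial (2 * int N) C)
      \<and> dim (UNIV :: 'v set) = 4 * N \<and> simple_spectrum"
    then obtain C where "C \<noteq> 2" "{p. ev p w = 0} = principal_ideal (trinomial (2 * int N) C)"
      "dim (UNIV :: 'v set) = 4 * N" simple_spectrum by blast
    then show ?thesis
      using q Y_split_iff[OF F] dimension_eq[OF F] by (intro disjI1 exI[of _ C]) simp
  next
    assume "{p. ev p w = 0} = principal_ideal (trinomial (int N) 0) \<and> dim (UNIV :: 'v set) = 2 * N"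
    then show ?thesis using q dimension_eq[OF F] by (intro disjI2) simp
  qed
qed

lemma quotient_by_trinomial:
  fixes W :: "('w::ab_group_add) daha_rep"
  assumes nz: "th \<noteq> 0" and N: "N \<ge> 1" "primitive_root (2 * N) qh" and th: "th ^ (4 * N) \<noteq> 1"
  shows "C \<noteq> 2 \<Longrightarrow> is_quotient_by (poly_rep qh th) (principal_ideal (trinomial (2 * int N) C)) W \<Longrightarrow>
      irreducible_daha_module qh th W \<and> finite_dimensional (scal W) (UNIV :: 'w set)
      \<and> dimension W = 4 * N \<and> Y_split W"
    and "is_quotient_by (poly_rep qh th) (principal_ideal (trinomial (int N) 0)) W \<Longrightarrow>
      irreducible_daha_module qh th W \<and> dimension W = 2 * N"
proof -
  have qh0: "qh \<noteq> 0" by (rule primitive_root_nonzero[OF N(2)]) (use N(1) in simp)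
  note pi = refl_pi_trinomial[OF N(2,1)]
  note P = daha_poly_rep[OF qh0 nz]
  have main: "\<exists>Basis v. findim_daha_of qh th N Basis W \<and> actT W v = scal W th v \<and> actY W v = scal W th v
      \<and> range (\<lambda>p. invertible_op.ev (scal W) (actX W) (inv (actX W)) p v) = UNIV
      \<and> {p. invertible_op.ev (scal W) (actX W) (inv (actX W)) p v = 0} = principal_ideal (trinomial m c)"
    if q: "is_quotient_by (poly_rep qh th) (principal_ideal (trinomial m c)) W"
      and m: "m \<ge> 1" and pi: "refl_pi qh (trinomial m c) = const \<kappa> * trinomial m c" for m c \<kappa>
  proof -
    let ?J = "principal_ideal (trinomial m c)"
    obtain f where f: "intertwiner (poly_rep qh th) W f" "surj f" "{p. f p = 0} = ?J"
      using q unfolding is_quotient_by_def by blast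
    have ker: "f p = 0 \<longleftrightarrow> trinomial m c dvd p" for p
      using f(3) unfolding principal_ideal_def by blast
    have lin: "Vector_Spaces.linear (\<lambda>c (p::laurent). const c * p) (scal W) f"
      and X: "\<And>p. f (Xpow 1 * p) = actX W (f p)"
      and Y: "\<And>p. f (refl_pi qh (poly_T th p)) = actY W (f p)" and T: "\<And>p. f (poly_T th p) = actT W (f p)"
      using f(1) unfolding intertwiner_def by simp_all
    have D: "daha_of qh th W"
    proof (rule daha_quotient[OF P lin f(2) X Y T])
      show "f (Xpow (- 1) * p) = 0" if "f p = 0" for p
        using that unfolding ker by (rule dvd_mult)
      \<comment> \<open>The ideal is stable under Y^-1, which is \<open>refl_pi\<close> followed by
        T^-1: its generator is symmetric and an eigenvector of \<open>refl_pi\<close>.\<close>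
      show "f (poly_T th (refl_pi qh p) - const (th - inverse th) * refl_pi qh p) = 0" if p0: "f p = 0" for p
      proof -
        obtain r where p: "p = trinomial m c * r" using p0 unfolding ker by (rule dvdE)
        have rp: "refl_pi qh p = trinomial m c * (const \<kappa> * refl_pi qh r)"
          unfolding p refl_pi_mult[OF qh0] pi by (simp only: mult_ac)
        have "poly_T th (refl_pi qh p) = trinomial m c * poly_T th (const \<kappa> * refl_pi qh r)"
          unfolding rp by (rule poly_T_symmetric_mult[OF refl_s_trinomial])
        then show ?thesis
          unfolding ker using rp by (intro dvd_diff dvd_mult) simp_all
      qed
    qed
    interpret daha "scal W" qh th "actX W" "inv (actX W)" "actY W" "inv (actY W)" "actT W" by (rule D)
    interpret f: Vector_Spaces.linear "\<lambda>c (p::laurent). const c * p" "scal W" f by (rule lin)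
    \<comment> \<open>The projection sends p to p(X) applied to the image of 1, so W is generated by
      a vector with the eigenvalues of 1.\<close>
    let ?v = "f 1"
    have z: "f (Xpow n) = zpow n ?v" for n
    proof (induction n rule: int_induct[where k = 0])
      case (step1 i)
      have "f (Xpow (i + 1)) = actX W (f (Xpow i))"
        unfolding X[symmetric] by (simp add: mult_single add.commute)
      then show ?case by (simp add: step1 zpow_plus_1)
    next
      case (step2 i)
      have "actX W (f (Xpow (i - 1))) = f (Xpow i)"
        unfolding X[symmetric] by (simp add: mult_single)
      then have "f (Xpow (i - 1)) = inv (actX W) (f (Xpow i))" by (metis Xi_X)
      then show ?case by (simp add: step2 zpow_minus_1)
    qed simp
    have fev: "f p = ev p ?v" for p
    proof (induction p rule: laurent_induct)
      case (single n c)
      have "f (const c * Xpow n) = scal W c (f (Xpow n))" by (rule f.scale)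
      then show ?case by (simp add: mult_single ev_single z)
    qed (simp add: f.add ev_add)
    have T1: "poly_T th 1 = const th * 1"
      using demazure_const[of 1] by (simp add: poly_T_def)
    have Tv: "actT W ?v = scal W th ?v" unfolding T[symmetric] T1 by (rule f.scale)
    have Yv: "actY W ?v = scal W th ?v"
      unfolding Y[symmetric] T1 using f.scale[of th 1] by simp
    have gen: "range (\<lambda>p. ev p ?v) = UNIV" using f(2) by (simp only: fev[symmetric])
    have kev: "{p. ev p ?v = 0} = ?J" using f(3) by (simp only: fev[symmetric])
    have tv: "ev (trinomial m c) ?v = 0" unfolding fev[symmetric] ker by (rule dvd_refl)
    have "finite_dimensional (scal W) UNIV"
      unfolding finite_dimensional_def by (rule dim_le_of_trinomial(2)[OF m tv gen])
    then obtain Basis where "findim_daha_of qh th N Basis W" by (rule findim_dahaI[OF D _ N])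
    then show ?thesis using Tv Yv gen kev by blast
  qed
  show "irreducible_daha_module qh th W \<and> finite_dimensional (scal W) (UNIV :: 'w set)
      \<and> dimension W = 4 * N \<and> Y_split W"
    if C: "C \<noteq> 2" and q: "is_quotient_by (poly_rep qh th) (principal_ideal (trinomial (2 * int N) C)) W"
  proof -
    obtain Basis v where F: "findim_daha_of qh th N Basis W"
      and v: "actT W v = scal W th v" "actY W v = scal W th v"
        "range (\<lambda>p. invertible_op.ev (scal W) (actX W) (inv (actX W)) p v) = UNIV"
        "{p. invertible_op.ev (scal W) (actX W) (inv (actX W)) p v = 0} = principal_ideal (trinomial (2 * int N) C)"
      using main[OF q _ pi(1)] N(1) by auto
    interpret findim_daha "scal W" qh th "actX W" "inv (actX W)" "actY W" "inv (actY W)" "actT W" Basis N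
      by (rule F)
    have Q: "(\<forall>U. stable U \<longrightarrow> U = {0} \<or> U = UNIV) \<and> v \<noteq> 0 \<and> dim (UNIV :: 'w set) = 4 * N \<and> simple_spectrum"
      by (rule quotient_simple(1)[OF v(1,2) th v(3) C v(4)])
    then have "irreducible_daha_module qh th W"
      unfolding irreducible_iff[OF qh0 nz] using daha_axioms by blast
    then show ?thesis using Q Y_split_iff[OF F] dimension_eq[OF F] finite_dimensional_V[OF F] by simp
  qed
  show "irreducible_daha_module qh th W \<and> dimension W = 2 * N"
    if q: "is_quotient_by (poly_rep qh th) (principal_ideal (trinomial (int N) 0)) W"
  proof -
    obtain Basis v where F: "findim_daha_of qh th N Basis W"
      and v: "actT W v = scal W th v" "actY W v = scal W th v"
        "range (\<lambda>p. invertible_op.ev (scal W) (actX W) (inv (actX W)) p v) = UNIV"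
        "{p. invertible_op.ev (scal W) (actX W) (inv (actX W)) p v = 0} = principal_ideal (trinomial (int N) 0)"
      using main[OF q _ pi(2)] N(1) by auto
    interpret findim_daha "scal W" qh th "actX W" "inv (actX W)" "actY W" "inv (actY W)" "actT W" Basis N
      by (rule F)
    have Q: "(\<forall>U. stable U \<longrightarrow> U = {0} \<or> U = UNIV) \<and> v \<noteq> 0 \<and> dim (UNIV :: 'w set) = 2 * N"
      by (rule quotient_simple(2)[OF v(1,2) th v(3) v(4)])
    then have "irreducible_daha_module qh th W"
      unfolding irreducible_iff[OF qh0 nz] using daha_axioms by blast
    then show ?thesis using Q dimension_eq[OF F] by simp
  qed
qed

lemma exists_twisted_character:
  fixes V :: "('v::ab_group_add) daha_rep"
  assumes nz: "qh \<noteq> 0" "th \<noteq> 0" and V: "irreducible_daha_module qh th V"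
    and fin: "finite_dimensional (scal V) (UNIV :: 'v set)"
    and N: "N \<ge> 1" "primitive_root (2 * N) qh"
    and y: "Y_eigenvalue V y" "th ^ (2 * N) = y ^ (2 * N) \<or> th ^ (2 * N) * y ^ (2 * N) = 1"
  shows "\<exists>i j w. w \<noteq> 0 \<and> actT (twist i j V) w = scal V (twist_param i th) w \<and>
    actY (twist i j V) w = scal V (twist_param i th) w"
proof -
  have D: "daha_of qh th V" using irreducible_iff[OF nz, of V] V by blast
  obtain Basis where F: "findim_daha_of qh th N Basis V" by (rule findim_dahaI[OF D fin N])
  interpret findim_daha "scal V" qh th "actX V" "inv (actX V)" "actY V" "inv (actY V)" "actT V" Basis N
    by (rule F)
  have "y \<in> spec UNIV" using y(1) Y_eigenvalue_iff[OF F] by simp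
  then obtain z where z: "z \<in> spec UNIV" "z\<^sup>2 = th\<^sup>2 \<or> z\<^sup>2 = inverse (th\<^sup>2)"
    using exists_broken[OF stable_UNIV _ y(2)] by blast
  obtain w a b where w: "w \<noteq> 0" "a = th \<or> a = - inverse th" "b = a \<or> b = - a"
    "actT V w = scal V a w" "actY V w = scal V b w"
    by (rule broken_character[OF stable_UNIV z])
  show ?thesis using exists_twist_character[OF D w(2-5)] w(1) by blast
qed

section \<open>Modules of half-singular weight\<close>

text \<open>With the involution P in place of X, the relations become two rules for moving Y across
  T and P; X is recovered as P T^-1 and its inverse as T P. In this form a module with diagonal Y
  can be written down weight by weight.\<close>

lemma (in complex_vector_space) daha_from_involution:
  assumes nz: "qh \<noteq> 0" "th \<noteq> 0"
    and lin: "linear_op P" "linear_op T" "linear_op Y"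
    and Y: "\<And>v. Y (Yi v) = v" "\<And>v. Yi (Y v) = v" and PP: "\<And>v. P (P v) = v"
    and TT: "\<And>v. T (T v) = sc (th - inverse th) (T v) + v"
    and YT: "\<And>v. Y (T v) = T (Yi v) + sc (th - inverse th) (Y v)"
    and YP: "\<And>v. Y (P v) = sc (inverse qh) (P (Yi v))"
  shows "daha sc qh th (\<lambda>v. P (T v - sc (th - inverse th) v)) (\<lambda>v. T (P v)) Y Yi T"
proof (intro daha.intro daha_axioms.intro complex_vector_space_axioms nz lin)
  define d where "d = th - inverse th"
  note l = linear_op_simps[OF lin(1)] linear_op_simps[OF lin(2)] linear_op_simps[OF lin(3)]
  have TT': "T (T v) = sc d (T v) + v" for v using TT by (simp only: d_def)
  have YT': "Y (T v) = T (Yi v) + sc d (Y v)" for v using YT by (simp only: d_def)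
  show "linear_op (\<lambda>v. P (T v - sc (th - inverse th) v))"
    unfolding d_def[symmetric] by (rule linear_opI) (simp_all add: l scale_right_distrib scale_right_diff_distrib algebra_simps)
  fix v
  have TYT: "T (Yi (T v)) = Y v" using YT'[of "T v"] by (simp add: TT' l)
  have YiT: "Yi (T v) = T (Y v) - sc d (Y v)"
    using TT'[of "Yi (T v)"] by (simp add: TYT)
  show "P (T (T (P v)) - sc (th - inverse th) (T (P v))) = v"
    unfolding d_def[symmetric] by (simp add: TT' PP)
  show "T (P (P (T v - sc (th - inverse th) v))) = v"
    unfolding d_def[symmetric] by (simp add: PP l TT')
  show "T (P (T (T v) - sc (th - inverse th) (T v))) = T (P v)"
    unfolding d_def[symmetric] by (simp add: TT')
  show "P (T (Y v) - sc (th - inverse th) (Y v))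
      = sc qh (Y (P (T (T (T v)) - sc (th - inverse th) (T (T v)))))"
    unfolding d_def[symmetric] YiT[symmetric] using nz by (simp add: TT'[of "T v"] YP)
  show "T (Yi (T v)) = Y v" by (rule TYT)
qed (rule Y TT)+

text \<open>The module consists of \<open>d\<close> copies of the functions on the orbit \<open>z\<^sup>2\<^sup>N = -1\<close> of weights, on which
  \<open>T\<close> acts by Demazure-Lusztig operators.  The involution fixes the two weights \<open>\<plusminus>z0\<close>; for \<open>d = 2\<close>
  it is twisted there by \<open>diag (1, -1)\<close> and by the swap, which have no common eigenvector.\<close>
lemma exists_half_singular_module:
  fixes sc :: "complex \<Rightarrow> 'w::ab_group_add \<Rightarrow> 'w"
  assumes vs: "vector_space sc" and fin: "finite_dimensional sc (UNIV :: 'w set)"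
    and dim: "vector_space.dim sc (UNIV :: 'w set) \<in> {2 * N, 4 * N}"
    and N: "N \<ge> 1" "primitive_root (2 * N) qh" and nz: "qh \<noteq> 0" "th \<noteq> 0"
    and th: "th ^ (2 * N) \<noteq> - 1" and y: "y ^ (2 * N) = - 1"
  shows "\<exists>W. scal W = sc \<and> irreducible_daha_module qh th W \<and> Y_eigenvalue W y"
proof -
  interpret complex_vector_space sc by (intro complex_vector_space.intro vs)
  interpret pair: vector_space_pair sc sc by unfold_locales
  obtain d where d: "d = 1 \<or> d = 2" "vector_space.dim sc (UNIV :: 'w set) = 2 * N * d"
    using dim by (auto intro: that[of 1] that[of 2])
  let ?R = "{z::complex. z ^ (2 * N) = - 1}"
  let ?I = "?R \<times> {..<d}"
  obtain Bas where Bas: "finite_dimensional_vector_space sc Bas"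
    by (rule finite_dimensional_basis[OF vs fin])
  interpret finite_dimensional_vector_space sc Bas by (rule Bas)
  have cardB: "card Bas = 2 * N * d" using d(2) dim_UNIV by simp
  have finR: "finite ?R" by (rule finite_nth_roots) (use N in simp)
  have cardR: "card ?R = 2 * N" by (rule card_nth_roots) (use N in simp_all)
  have "finite ?I" "card ?I = card Bas"
    using finR cardR cardB by (simp_all add: card_cartesian_product)
  then obtain b where b: "bij_betw b ?I Bas"
    using finite_same_card_bij[OF \<open>finite ?I\<close> finite_Basis] by blast
  have b_inj: "inj_on b ?I" and b_im: "b ` ?I = Bas" using b by (auto simp: bij_betw_def)
  have lin_ext: "\<exists>L. linear_op L \<and> (\<forall>x\<in>?I. L (b x) = g x)" for g :: "complex \<times> nat \<Rightarrow> 'w"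
  proof -
    obtain L where L: "linear_op L" "\<forall>x\<in>Bas. L x = g (inv_into ?I b x)"
      using pair.linear_independent_extend[OF independent_Basis, of "\<lambda>x. g (inv_into ?I b x)"] by blast
    have "L (b x) = g x" if "x \<in> ?I" for x
    proof -
      have "b x \<in> Bas" using that b_im by blast
      then have "L (b x) = g (inv_into ?I b (b x))" using L(2) by blast
      then show ?thesis by (simp only: inv_into_f_f[OF b_inj that])
    qed
    then show ?thesis using L(1) by blast
  qed
  have lin_eq: "A v = A' v"
    if lin: "linear_op A" "linear_op A'" and eq: "\<And>z e. z \<in> ?R \<Longrightarrow> e < d \<Longrightarrow> A (b (z, e)) = A' (b (z, e))" for A A' v
  proof -
    have "v \<in> span Bas" using span_Basis by simp
    then show ?thesis
    proof (induction rule: span_induct_alt)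
      case (step c x y)
      obtain z e where "x = b (z, e)" "z \<in> ?R" "e < d" using step(1) unfolding b_im[symmetric] by auto
      then show ?case using step eq by (simp only: linear_op_simps[OF lin(1)] linear_op_simps[OF lin(2)])
    qed (simp only: linear_op_simps[OF lin(1)] linear_op_simps[OF lin(2)])
  qed
  \<comment> \<open>The points \<plusminus>z0 are the fixed points of the reflection z \<mapsto> 1 /
    (q^(1/2) z) by which the involution moves weights.\<close>
  obtain z0 where z0: "z0\<^sup>2 = inverse qh" using power2_csqrt by blast
  define dl where "dl = th - inverse th"
  \<comment> \<open>Forced by Y T = T Y^-1 + \<delta> Y: comparing the multiples of b(z, e) gives
    \<gamma> (z^-2 - 1) = \<delta>.\<close>
  define \<gamma> where "\<gamma> z = dl / (inverse (z\<^sup>2) - 1)" for z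
  define sg :: "complex \<Rightarrow> nat \<Rightarrow> complex" where "sg z e = (if d = 2 \<and> z = z0 \<and> e = 1 then - 1 else 1)" for z e
  define sw :: "complex \<Rightarrow> nat \<Rightarrow> nat" where "sw z e = (if d = 2 \<and> z = - z0 then 1 - e else e)" for z e
  define rf where "rf z = inverse (qh * z)" for z
  obtain T where lT: "linear_op T"
    and T: "\<And>z e. z \<in> ?R \<Longrightarrow> e < d \<Longrightarrow> T (b (z, e)) = sc (th + \<gamma> z) (b (inverse z, e)) - sc (\<gamma> z) (b (z, e))"
    using lin_ext[of "\<lambda>(z, e). sc (th + \<gamma> z) (b (inverse z, e)) - sc (\<gamma> z) (b (z, e))"] by auto
  obtain Y where lY: "linear_op Y" and Y: "\<And>z e. z \<in> ?R \<Longrightarrow> e < d \<Longrightarrow> Y (b (z, e)) = sc z (b (z, e))"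
    using lin_ext[of "\<lambda>(z, e). sc z (b (z, e))"] by auto
  obtain Yi where lYi: "linear_op Yi" and Yi: "\<And>z e. z \<in> ?R \<Longrightarrow> e < d \<Longrightarrow> Yi (b (z, e)) = sc (inverse z) (b (z, e))"
    using lin_ext[of "\<lambda>(z, e). sc (inverse z) (b (z, e))"] by auto
  obtain P where lP: "linear_op P"
    and P: "\<And>z e. z \<in> ?R \<Longrightarrow> e < d \<Longrightarrow> P (b (z, e)) = sc (sg z e) (b (rf z, sw z e))"
    using lin_ext[of "\<lambda>(z, e). sc (sg z e) (b (rf z, sw z e))"] by auto
  note l = linear_op_simps[OF lT] linear_op_simps[OF lY] linear_op_simps[OF lYi] linear_op_simps[OF lP]
  have qN: "qh ^ (2 * N) = 1" using N(2) by (simp add: primitive_root_def)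
  have R0: "z \<noteq> 0" if "z \<in> ?R" for z using that N(1) by (auto simp: power_0_left)
  have Rinv: "inverse z \<in> ?R" if "z \<in> ?R" for z using that by (simp add: power_inverse)
  have Rrf: "rf z \<in> ?R" if "z \<in> ?R" for z using that qN by (simp add: rf_def power_inverse power_mult_distrib)
  have R1: "z\<^sup>2 \<noteq> 1" if "z \<in> ?R" for z
  proof
    assume "z\<^sup>2 = 1"
    then have "z ^ (2 * N) = 1" by (simp add: power_mult)
    then show False using that by simp
  qed
  have Rth: "z\<^sup>2 \<noteq> th\<^sup>2" if "z \<in> ?R" for z
  proof
    assume "z\<^sup>2 = th\<^sup>2"
    then have "z ^ (2 * N) = th ^ (2 * N)" by (simp add: power_mult)
    then show False using that th by simp
  qed
  have rfrf: "rf (rf z) = z" if "z \<noteq> 0" for z using that nz by (simp add: rf_def)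
  have rf_fix: "rf z = z \<longleftrightarrow> z = z0 \<or> z = - z0" if "z \<noteq> 0" for z
  proof -
    have "rf z = z \<longleftrightarrow> z\<^sup>2 = inverse qh" using that nz by (simp add: rf_def power2_eq_square field_simps)
    also have "\<dots> \<longleftrightarrow> z = z0 \<or> z = - z0" unfolding z0[symmetric] by (rule power2_eq_iff)
    finally show ?thesis .
  qed
  have z00: "z0 \<noteq> 0" using z0 nz by auto
  then have z0m: "z0 \<noteq> - z0" by simp
  have z0R: "z0 \<in> ?R" "- z0 \<in> ?R"
  proof -
    have qN1: "qh ^ N = - 1" by (rule primitive_root_half_power[OF N(2,1)])
    have "z0 ^ (2 * N) = (z0\<^sup>2) ^ N" by (simp add: power_mult)
    also have "\<dots> = - 1" unfolding z0 power_inverse qN1 by simp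
    finally show "z0 \<in> ?R" "- z0 \<in> ?R" by simp_all
  qed
  have sw_lt: "sw z e < d" if "e < d" for z e using that d(1) by (auto simp: sw_def)
  have PP: "P (P v) = v" for v
  proof (rule lin_eq[of "\<lambda>v. P (P v)" "\<lambda>v. v"])
    fix z e assume z: "z \<in> ?R" and e: "e < d"
    have "P (P (b (z, e))) = sc (sg z e * sg (rf z) (sw z e)) (b (rf (rf z), sw (rf z) (sw z e)))"
      using z e by (simp add: P Rrf sw_lt l del: mem_Collect_eq)
    also have "\<dots> = b (z, e)"
    proof (cases "z = z0 \<or> z = - z0")
      case True
      then have "rf z = z" using rf_fix[OF R0[OF z]] by blast
      then show ?thesis using True z0m e d(1) by (auto simp: sg_def sw_def)
    next
      case False
      then have "rf z \<noteq> z" using rf_fix[OF R0[OF z]] by blast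
      then have "\<not> (rf z = z0 \<or> rf z = - z0)"
        using rf_fix[OF R0[OF Rrf[OF z]]] rfrf[OF R0[OF z]] by metis
      then show ?thesis using False rfrf[OF R0[OF z]] by (simp add: sg_def sw_def)
    qed
    finally show "P (P (b (z, e))) = b (z, e)" .
  qed (rule linear_opI, simp_all add: l)+
  have YYi: "Y (Yi v) = v" for v
    by (rule lin_eq[of "\<lambda>v. Y (Yi v)" "\<lambda>v. v"]) (rule linear_opI, simp_all add: l Y Yi R0 del: mem_Collect_eq)+
  have YiY: "Yi (Y v) = v" for v
    by (rule lin_eq[of "\<lambda>v. Yi (Y v)" "\<lambda>v. v"]) (rule linear_opI, simp_all add: l Y Yi R0 del: mem_Collect_eq)+
  have \<gamma>: "\<gamma> z * (inverse (z\<^sup>2) - 1) = dl" "\<gamma> (inverse z) = - dl - \<gamma> z" if z: "z \<in> ?R" for z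
  proof -
    have n: "inverse (z\<^sup>2) - 1 \<noteq> 0" using R1[OF z] by simp
    then show 1: "\<gamma> z * (inverse (z\<^sup>2) - 1) = dl" by (simp add: \<gamma>_def)
    have n2: "z\<^sup>2 - 1 \<noteq> 0" using R1[OF z] by simp
    have "\<gamma> (inverse z) = dl / (z\<^sup>2 - 1)" by (simp add: \<gamma>_def power_inverse)
    also have "\<dots> = - dl - dl / (inverse (z\<^sup>2) - 1)"
      using n n2 R0[OF z] by (simp add: field_simps)
    finally show "\<gamma> (inverse z) = - dl - \<gamma> z" by (simp add: \<gamma>_def)
  qed
  have TT: "T (T v) = sc (th - inverse th) (T v) + v" for v
  proof (rule lin_eq[of "\<lambda>v. T (T v)" "\<lambda>v. sc (th - inverse th) (T v) + v"])
    fix z e assume z: "z \<in> ?R" and e: "e < d"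
    define g where "g = \<gamma> z"
    have g': "\<gamma> (inverse z) = - dl - g" using \<gamma>(2)[OF z] by (simp add: g_def)
    have c: "(th + g) * (th + (- dl - g)) = 1 - dl * g - g * g"
      using nz by (simp add: dl_def algebra_simps)
    have c': "- ((th + g) * (- dl - g)) - g * (th + g) = dl * (th + g)"
      by (simp add: algebra_simps)
    have comb: "sc p x - sc q y - (sc r y - sc s x) = sc (p + s) x + sc (- q - r) y" for p q r s x y
      by (simp add: scale_left_distrib scale_left_diff_distrib)
    have T1: "T (b (z, e)) = sc (th + g) (b (inverse z, e)) - sc g (b (z, e))"
      using T[OF z e] by (simp only: g_def)
    have T2: "T (b (inverse z, e)) = sc (th + (- dl - g)) (b (z, e)) - sc (- dl - g) (b (inverse z, e))"
      using T[OF Rinv[OF z] e] by (simp only: g' inverse_inverse_eq)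
    have "T (T (b (z, e))) = sc (th + g) (T (b (inverse z, e))) - sc g (T (b (z, e)))"
      by (subst T1) (simp only: l)
    also have "\<dots> = sc ((th + g) * (th + (- dl - g)) + g * g) (b (z, e)) + sc (dl * (th + g)) (b (inverse z, e))"
      unfolding T2 unfolding T1 scale_right_diff_distrib scale_scale comb c' ..
    also have "(th + g) * (th + (- dl - g)) + g * g = 1 - dl * g" unfolding c by simp
    also have "sc (1 - dl * g) (b (z, e)) + sc (dl * (th + g)) (b (inverse z, e)) = sc dl (T (b (z, e))) + b (z, e)"
      unfolding T1 scale_right_diff_distrib scale_scale scale_left_diff_distrib by simp
    finally show "T (T (b (z, e))) = sc (th - inverse th) (T (b (z, e))) + b (z, e)"
      by (simp only: dl_def)
  qed (rule linear_opI, simp_all add: l scale_right_distrib mult.commute add_ac)+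
  have YT: "Y (T v) = T (Yi v) + sc (th - inverse th) (Y v)" for v
  proof (rule lin_eq[of "\<lambda>v. Y (T v)" "\<lambda>v. T (Yi v) + sc (th - inverse th) (Y v)"])
    fix z e assume z: "z \<in> ?R" and e: "e < d"
    have "\<gamma> z * inverse z - \<gamma> z * z = (\<gamma> z * (inverse (z\<^sup>2) - 1)) * z"
      using R0[OF z] by (simp add: field_simps power2_eq_square)
    then have c: "dl * z - \<gamma> z * inverse z = - (\<gamma> z * z)" unfolding \<gamma>(1)[OF z] by (simp add: algebra_simps)
    have "T (Yi (b (z, e))) + sc dl (Y (b (z, e)))
        = sc (inverse z * (th + \<gamma> z)) (b (inverse z, e)) + sc (dl * z - \<gamma> z * inverse z) (b (z, e))"
      using T[OF z e] Y[OF z e] Yi[OF z e]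
      by (simp add: l scale_right_diff_distrib scale_left_diff_distrib mult.commute)
    also have "\<dots> = Y (T (b (z, e)))"
      unfolding c using T[OF z e] Y[OF z e] Y[OF Rinv[OF z] e]
      by (simp add: l mult.commute)
    finally show "Y (T (b (z, e))) = T (Yi (b (z, e))) + sc (th - inverse th) (Y (b (z, e)))"
      by (simp only: dl_def)
  qed (rule linear_opI, simp_all add: l scale_right_distrib mult.commute add_ac)+
  have YP: "Y (P v) = sc (inverse qh) (P (Yi v))" for v
  proof (rule lin_eq[of "\<lambda>v. Y (P v)" "\<lambda>v. sc (inverse qh) (P (Yi v))"])
    fix z e assume z: "z \<in> ?R" and e: "e < d"
    show "Y (P (b (z, e))) = sc (inverse qh) (P (Yi (b (z, e))))"
      using P[OF z e] Yi[OF z e] Y[OF Rrf[OF z] sw_lt[OF e]]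
      by (simp add: l rf_def mult_ac)
  qed (rule linear_opI, simp_all add: l scale_right_distrib mult.commute add_ac)+
  note D = daha_from_involution[OF nz lP lT lY YYi YiY PP TT YT YP]
  let ?X = "\<lambda>v. P (T v - sc (th - inverse th) v)"
  define W where "W = \<lparr>scal = sc, actX = ?X, actY = Y, actT = T\<rparr>"
  interpret daha sc qh th ?X "\<lambda>v. T (P v)" Y Yi T by (rule D)
  interpret findim_daha sc qh th ?X "\<lambda>v. T (P v)" Y Yi T Bas N
    by (intro findim_daha.intro findim_complex_vector_space.intro findim_daha_axioms.intro D Bas N
        complex_vector_space_axioms)
  have Pi: "\<Pi> v = P v" for v
    using T_T[of v] by (simp add: \<Pi>_def \<delta>_def)
  have dl: "\<delta> = dl" by (simp add: \<delta>_def dl_def)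
  \<comment> \<open>The coefficient of E equals (t - z^2) / (t^(1/2) z^2). It vanishes only at z^2 =
    t, which the hypothesis on \<open>th\<close> keeps off the orbit.\<close>
  define \<epsilon> where "\<epsilon> z = (inverse (z\<^sup>2) - 1) * (th + \<gamma> z)" for z
  have E: "E (b (z, e)) = sc (\<epsilon> z) (b (inverse z, e))" if z: "z \<in> ?R" and e: "e < d" for z e
  proof -
    have "E (b (z, e)) = sc (inverse (z\<^sup>2) - 1) (T (b (z, e))) + sc dl (b (z, e))"
      using Yi[OF z e] by (simp add: E_def dl op_simps scale_left_diff_distrib power2_eq_square)
    also have "\<dots> = sc (\<epsilon> z) (b (inverse z, e)) + sc (dl - \<gamma> z * (inverse (z\<^sup>2) - 1)) (b (z, e))"
      unfolding T[OF z e] \<epsilon>_def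
      by (simp add: scale_right_diff_distrib scale_left_diff_distrib mult.commute)
    finally show ?thesis unfolding \<gamma>(1)[OF z] by simp
  qed
  have \<epsilon>: "\<epsilon> z \<noteq> 0" if z: "z \<in> ?R" for z
  proof -
    have "\<epsilon> z = th * (inverse (z\<^sup>2) - 1) + \<gamma> z * (inverse (z\<^sup>2) - 1)"
      by (simp add: \<epsilon>_def algebra_simps)
    also have "\<dots> = th * (inverse (z\<^sup>2) - 1) + dl" unfolding \<gamma>(1)[OF z] ..
    also have "\<dots> = (th\<^sup>2 - z\<^sup>2) / (th * z\<^sup>2)"
      using nz R0[OF z] by (simp add: dl_def field_simps power2_eq_square)
    finally show ?thesis using Rth[OF z] nz R0[OF z] by simp
  qed
  have "U = {0} \<or> U = UNIV" if U: "stable U" for U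
  proof (cases "U = {0}")
    case False
    then obtain u0 where "u0 \<in> U" "u0 \<noteq> 0" using subspace_0[OF stable_subspace[OF U]] by blast
    then obtain z where "z \<in> spec U" by (rule spec_nonempty[OF U])
    then obtain v where v: "v \<in> U" "v \<noteq> 0" "Y v = sc z v" unfolding spec_def by blast
    note subU = stable_subspace[OF U]
    define u where "u c z = (\<Sum>e<d. sc (c e) (b (z, e)))" for c :: "nat \<Rightarrow> complex" and z
    \<comment> \<open>A vector is carried with unchanged coefficients c from one weight to all
      others: E never mixes the copies, and the involution does so only at its fixed points, where
      no step is made.\<close>
    have spread: "u c x \<in> U" if ucz: "u c z \<in> U" "z \<in> ?R" and x: "x \<in> ?R" for c z x
    proof -
      have Eu: "E (u c z) = sc (\<epsilon> z) (u c (inverse z))" if "z \<in> ?R" for z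
        using E[OF that] by (simp add: u_def linear_op_simps[OF lin_E] scale_sum_right mult.commute)
      have Einv: "u c (inverse z) \<in> U" if "u c z \<in> U" "z \<in> ?R" for z
      proof -
        have "sc (inverse (\<epsilon> z)) (E (u c z)) \<in> U"
          using that by (intro subspace_scale[OF subU] stable_E[OF U])
        then show ?thesis using Eu[OF that(2)] \<epsilon>[OF that(2)] by simp
      qed
      have Prf: "u c (rf z) \<in> U" if "u c z \<in> U" "z \<in> ?R" for z
      proof (cases "rf z = z")
        case False
        then have "\<not> (z = z0 \<or> z = - z0)" using rf_fix[OF R0[OF that(2)]] by blast
        then have "P (u c z) = u c (rf z)"
          using P[OF that(2)] by (simp add: u_def l sg_def sw_def)
        then show ?thesis using stable_\<Pi>[OF U that(1)] by (simp add: Pi)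
      qed (use that in simp)
      have step: "u c (qh * z) \<in> U" if "u c z \<in> U" "z \<in> ?R" for z
        using Einv[OF Prf[OF that] Rrf[OF that(2)]] by (simp add: rf_def)
      have "x ^ (2 * N) = z ^ (2 * N)" using ucz(2) x by simp
      then obtain j where j: "x = qh ^ j * z" by (rule power_eq_imp_shift[OF _ R0[OF ucz(2)]])
      have "u c (qh ^ j * z) \<in> U \<and> qh ^ j * z \<in> ?R" for j
      proof (induction j)
        case (Suc j)
        moreover have "qh * (qh ^ j * z) \<in> ?R" using Suc qN by (simp add: power_mult_distrib)
        ultimately show ?case using step[of "qh ^ j * z"] by (simp add: mult.assoc)
      qed (use ucz in simp)
      then show ?thesis using j by simp
    qed
    have ub: "u (\<lambda>i. if i = e then 1 else 0) z = b (z, e)" if "e < d" for e z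
    proof -
      have "u (\<lambda>i. if i = e then 1 else 0) z = (\<Sum>i<d. if i = e then b (z, e) else 0)"
        unfolding u_def by (rule sum.cong) auto
      then show ?thesis using that by simp
    qed
    have spread_b: "b (x, e) \<in> U" if "b (z, e) \<in> U" "z \<in> ?R" "x \<in> ?R" "e < d" for x z e
      using spread[of "\<lambda>i. if i = e then 1 else 0" z x] that by (simp only: ub)
    \<comment> \<open>Y is diagonal in the basis, so the weight vector v involves only the copies
      over its own weight.\<close>
    obtain c where c: "u c z \<in> U" "z \<in> ?R" "u c z \<noteq> 0"
    proof -
      have "v \<in> span (b ` ?I)" using span_Basis b_im by simp
      then obtain a' where "v = (\<Sum>x\<in>b ` ?I. sc (a' x) x)"
        using span_finite[of "b ` ?I"] \<open>finite ?I\<close> by auto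
      then have va: "v = (\<Sum>x\<in>?I. sc (a' (b x)) (b x))" by (simp only: sum.reindex[OF b_inj] o_def)
      have "Y v - sc z v = (\<Sum>x\<in>?I. sc ((fst x - z) * a' (b x)) (b x))"
      proof -
        have "Y v - sc z v = (\<Sum>x\<in>?I. Y (sc (a' (b x)) (b x)) - sc z (sc (a' (b x)) (b x)))"
          unfolding va by (simp only: l scale_sum_right sum_subtractf)
        also have "\<dots> = (\<Sum>x\<in>?I. sc ((fst x - z) * a' (b x)) (b x))"
        proof (rule sum.cong[OF refl])
          fix x assume "x \<in> ?I"
          then obtain y e where "x = (y, e)" "y \<in> ?R" "e < d" by auto
          then show "Y (sc (a' (b x)) (b x)) - sc z (sc (a' (b x)) (b x)) = sc ((fst x - z) * a' (b x)) (b x)"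
            using Y[of y e] by (simp add: l left_diff_distrib scale_left_diff_distrib mult.commute)
        qed
        finally show ?thesis .
      qed
      then have s0: "(\<Sum>x\<in>?I. sc ((fst x - z) * a' (b x)) (b x)) = 0" using v(3) by simp
      define h where "h w = (fst (inv_into ?I b w) - z) * a' w" for w
      have hb: "h (b x) = (fst x - z) * a' (b x)" if "x \<in> ?I" for x
        unfolding h_def inv_into_f_f[OF b_inj that] ..
      have "(\<Sum>w\<in>Bas. sc (h w) w) = (\<Sum>x\<in>?I. sc (h (b x)) (b x))"
        unfolding b_im[symmetric] by (simp only: sum.reindex[OF b_inj] o_def)
      also have "\<dots> = 0" unfolding s0[symmetric] by (rule sum.cong) (simp_all only: hb)
      finally have "h w = 0" if "w \<in> Bas" for w
        using independentD[OF independent_Basis finite_Basis order_refl _ that, of h] by blast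
      then have a0: "a' (b x) = 0" if "x \<in> ?I" "fst x \<noteq> z" for x
        using hb[OF that(1)] that b_im by auto
      show thesis
      proof (cases "z \<in> ?R")
        case True
        define c where "c e = a' (b (z, e))" for e
        have "v = (\<Sum>x\<in>{z} \<times> {..<d}. sc (a' (b x)) (b x))"
          unfolding va
        proof (rule sum.mono_neutral_right[OF \<open>finite ?I\<close>])
          show "{z} \<times> {..<d} \<subseteq> ?I" using True by auto
          show "\<forall>x\<in>?I - {z} \<times> {..<d}. sc (a' (b x)) (b x) = 0"
          proof
            fix x assume x: "x \<in> ?I - {z} \<times> {..<d}"
            then have "fst x \<noteq> z" by (cases x) auto
            moreover have "x \<in> ?I" using x by blast
            ultimately have "a' (b x) = 0" using a0 by blast
            then show "sc (a' (b x)) (b x) = 0" by (simp only: scale_zero_left)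
          qed
        qed
        also have "\<dots> = (\<Sum>y\<in>{z}. \<Sum>e<d. sc (a' (b (y, e))) (b (y, e)))"
          by (simp only: sum.cartesian_product split_def prod.collapse)
        also have "\<dots> = u c z" by (simp add: u_def c_def)
        finally have "v = u c z" .
        then show thesis using that[of c] True v by simp
      next
        case False
        have "v = 0" unfolding va
        proof (rule sum.neutral, rule ballI)
          fix x assume x: "x \<in> ?I"
          then have "fst x \<noteq> z" using False by (cases x) auto
          with x have "a' (b x) = 0" using a0 by blast
          then show "sc (a' (b x)) (b x) = 0" by (simp only: scale_zero_left)
        qed
        then show thesis using v(2) by simp
      qed
    qed
    have all: "b (x, e) \<in> U" if x: "x \<in> ?R" and e: "e < d" for x e
    proof (cases "d = 1")
      case True
      have "u c z = sc (c 0) (b (z, 0))" unfolding u_def True by simp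
      then have "sc (c 0) (b (z, 0)) \<in> U" "c 0 \<noteq> 0" using c by auto
      then have "b (z, 0) \<in> U"
        using subspace_scale[OF subU, of "sc (c 0) (b (z, 0))" "inverse (c 0)"] by simp
      then show ?thesis using spread_b[OF _ c(2) x, of 0] True e by simp
    next
      \<comment> \<open>At z0 the involution is diag(1, -1), which separates the components and
        leaves a basis vector in U. Carried to -z0, it is exchanged by the swap with the other
        one.\<close>
      case False
      then have d2: "d = 2" using d(1) by simp
      have u2: "u c x = sc (c 0) (b (x, 0)) + sc (c 1) (b (x, 1))" for x
        unfolding u_def d2 by (simp add: numeral_2_eq_2)
      have uz0: "u c z0 \<in> U" by (rule spread[OF c(1,2) z0R(1)])
      have rz0: "rf z0 = z0" "rf (- z0) = - z0" using rf_fix[of z0] rf_fix[of "- z0"] z00 by auto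
      have Pz0: "P (u c z0) = sc (c 0) (b (z0, 0)) - sc (c 1) (b (z0, 1))"
        unfolding u2 using P[OF z0R(1), of 0] P[OF z0R(1), of 1] z0m d2
        by (simp add: l sg_def sw_def rz0)
      have PU: "P w \<in> U" if "w \<in> U" for w using stable_\<Pi>[OF U that] by (simp only: Pi)
      have half: "w \<in> U" if "w + w \<in> U" for w
      proof -
        have "w + w = sc 2 w" using scale_left_distrib[of 1 1 w] by simp
        then show ?thesis using subspace_scale[OF subU that, of "inverse 2"] by simp
      qed
      have c01: "sc (c 0) (b (z0, 0)) \<in> U" "sc (c 1) (b (z0, 1)) \<in> U"
      proof -
        define p where "p = sc (c 0) (b (z0, 0))"
        define q where "q = sc (c 1) (b (z0, 1))"
        have pq: "p + q \<in> U" using uz0 unfolding u2 p_def q_def .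
        have pmq: "p - q \<in> U" using PU[OF uz0] unfolding Pz0 p_def q_def .
        have "(p + q) + (p - q) = p + p" "(p + q) - (p - q) = q + q" by simp_all
        then have pp: "p + p \<in> U" and qq: "q + q \<in> U"
          using subspace_add[OF subU pq pmq] subspace_diff[OF subU pq pmq] by simp_all
        show "sc (c 0) (b (z0, 0)) \<in> U" using half[OF pp] by (simp only: p_def)
        show "sc (c 1) (b (z0, 1)) \<in> U" using half[OF qq] by (simp only: q_def)
      qed
      have "c 0 \<noteq> 0 \<or> c 1 \<noteq> 0" using c(3) unfolding u2 by auto
      then obtain i where i: "i < d" "b (z0, i) \<in> U"
      proof
        assume "c 0 \<noteq> 0"
        then have "b (z0, 0) \<in> U" using subspace_scale[OF subU c01(1), of "inverse (c 0)"] by simp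
        then show ?thesis using that[of 0] d2 by simp
      next
        assume "c 1 \<noteq> 0"
        then have "b (z0, 1) \<in> U" using subspace_scale[OF subU c01(2), of "inverse (c 1)"] by simp
        then show ?thesis using that[of 1] d2 by simp
      qed
      have i': "b (- z0, i) \<in> U" by (rule spread_b[OF i(2) z0R i(1)])
      have "P (b (- z0, i)) = b (- z0, 1 - i)"
        using P[OF z0R(2) i(1)] z0m d2 by (auto simp: sg_def sw_def rz0)
      then have "b (- z0, 1 - i) \<in> U" using PU[OF i'] by simp
      then have "b (- z0, e) \<in> U" using i' i(1) e d2 by (cases "e = i") (auto simp: less_2_cases_iff)
      then show ?thesis by (rule spread_b[OF _ z0R(2) x e])
    qed
    have "Bas \<subseteq> U" unfolding b_im[symmetric] using all by auto
    then have "span Bas \<subseteq> U" by (rule span_minimal[OF _ subU])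
    then show ?thesis using span_Basis by auto
  qed simp
  moreover have "\<exists>v. v \<noteq> (0 :: 'w)"
  proof -
    have "(z0, 0) \<in> ?I" using z0R(1) d(1) by auto
    then have "b (z0, 0) \<in> Bas" using b_im by blast
    then have "b (z0, 0) \<noteq> 0" using independent_Basis dependent_zero by metis
    then show ?thesis by blast
  qed
  moreover have iX: "inv (actX W) = (\<lambda>v. T (P v))" and iY: "inv (actY W) = Yi"
    using daha_moduleI(2,3) by (simp_all add: W_def)
  have "daha_of qh th W" unfolding iX iY using D by (simp add: W_def)
  ultimately have "irreducible_daha_module qh th W"
    unfolding irreducible_iff[OF nz] iX iY by (simp add: W_def)
  moreover have "Y_eigenvalue W y"
  proof -
    have yI: "y \<in> ?R" "0 < d" using y d(1) by auto
    then have "b (y, 0) \<in> Bas" using b_im by blast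
    then have "b (y, 0) \<noteq> 0" using independent_Basis dependent_zero by metis
    then show ?thesis
      unfolding Y_eigenvalue_def Y_eigenspace_def using Y[OF yI] by (auto simp: W_def)
  qed
  ultimately show ?thesis by (intro exI[of _ W]) (simp add: W_def)
qed

section \<open>Translation into exponents\<close>

context
  fixes N :: nat and qh :: complex and qpow :: "complex \<Rightarrow> complex"
  assumes N: "N \<ge> 1" "primitive_root (2 * N) qh" and q: "compatible_powers N qh qpow"
begin

lemma qpow_add: "qpow (a + b) = qpow a * qpow b"
  and qpow_eq_iff: "qpow a = qpow b \<longleftrightarrow> (\<exists>j::int. a - b = of_int j * of_nat N)"
  and qpow_half: "qpow (1 / 2) = qh"
  using q unfolding compatible_powers_def by blast+

lemma qpow_surj:
  assumes "z \<noteq> 0"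
  obtains a where "qpow a = z"
  using q assms unfolding compatible_powers_def by blast

lemma qpow_0: "qpow 0 = 1"
proof -
  obtain a where a: "qpow a = 1" using qpow_surj[of 1] by auto
  then show ?thesis using qpow_add[of a 0] by simp
qed

lemma qpow_nonzero: "qpow a \<noteq> 0"
  using qpow_add[of a "- a"] qpow_0 by auto

lemma qpow_of_nat_mult: "qpow (of_nat n * a) = qpow a ^ n"
  by (induction n) (simp_all add: qpow_0 qpow_add distrib_right)

text \<open>The N-th power multiplies exponents by N, so equality modulo N turns into equality
  modulo the integers.\<close>

lemma qpow_power_N_eq_iff: "qpow a ^ N = qpow b ^ N \<longleftrightarrow> a - b \<in> \<int>"
proof -
  have N0: "(of_nat N :: complex) \<noteq> 0" using N(1) by simp
  have "qpow a ^ N = qpow b ^ N \<longleftrightarrow> (\<exists>j::int. of_nat N * a - of_nat N * b = of_int j * of_nat N)"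
    unfolding qpow_of_nat_mult[symmetric] by (rule qpow_eq_iff)
  also have "\<dots> \<longleftrightarrow> (\<exists>j::int. a - b = of_int j)"
  proof (rule arg_cong[of _ _ Ex], rule ext)
    fix j :: int
    have "of_nat N * a - of_nat N * b = of_nat N * (a - b)" by (simp add: right_diff_distrib)
    then show "(of_nat N * a - of_nat N * b = of_int j * of_nat N) = (a - b = of_int j)"
      using N0 by (simp add: mult.commute)
  qed
  also have "\<dots> \<longleftrightarrow> a - b \<in> \<int>" by (auto elim: Ints_cases)
  finally show ?thesis .
qed

lemma qpow_double_power: "qpow a ^ (2 * N) = qpow (2 * a) ^ N"
  using qpow_of_nat_mult[of 2 a] by (simp add: power_mult)

lemma qh_power_N: "qpow (1 / 2) ^ N = - 1"
  unfolding qpow_half by (rule primitive_root_half_power[OF N(2,1)])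

lemma qpow_2N_eq_iff: "qpow a ^ (2 * N) = qpow b ^ (2 * N) \<longleftrightarrow> 2 * a - 2 * b \<in> \<int>"
  unfolding qpow_double_power by (rule qpow_power_N_eq_iff)

lemma qpow_2N_mult_eq_1_iff: "qpow a ^ (2 * N) * qpow b ^ (2 * N) = 1 \<longleftrightarrow> 2 * a + 2 * b \<in> \<int>"
proof -
  have "qpow a ^ (2 * N) * qpow b ^ (2 * N) = qpow (a + b) ^ (2 * N)"
    by (simp add: qpow_add power_mult_distrib)
  moreover have "qpow 0 ^ (2 * N) = 1" by (simp add: qpow_0)
  ultimately show ?thesis using qpow_2N_eq_iff[of "a + b" 0] by (simp add: distrib_left)
qed

lemma qpow_2N_eq_1_iff: "qpow a ^ (2 * N) = 1 \<longleftrightarrow> 2 * a \<in> \<int>"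
  using qpow_2N_eq_iff[of a 0] by (simp add: qpow_0)

lemma qpow_2N_eq_minus_1_iff: "qpow a ^ (2 * N) = - 1 \<longleftrightarrow> 2 * a - 1 / 2 \<in> \<int>"
  unfolding qpow_double_power qh_power_N[symmetric] by (rule qpow_power_N_eq_iff)

lemma qpow_4N_eq_1_iff: "qpow a ^ (4 * N) = 1 \<longleftrightarrow> qpow a ^ (2 * N) = 1 \<or> qpow a ^ (2 * N) = - 1"
proof -
  have "qpow a ^ (4 * N) = (qpow a ^ (2 * N))\<^sup>2" by (simp add: power_mult[symmetric])
  then show ?thesis by (simp add: power2_eq_1_iff)
qed

text \<open>Under \<open>qpow\<close> the orbit becomes the set of roots of z^2N = c and z^2N = 1 /
  c, where c is the 2N-th power of the weight. These are 4N distinct numbers unless c^2 = 1.\<close>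

lemma regular_iff: "regular N l \<longleftrightarrow> qpow l ^ (4 * N) \<noteq> 1"
proof -
  define A where "A = {a. \<exists>j::int. a = l + of_int j / 2 \<or> a = - l + of_int j / 2}"
  define c where "c = qpow l ^ (2 * N)"
  have c0: "c \<noteq> 0" using qpow_nonzero by (simp add: c_def)
  let ?Rt = "\<lambda>c::complex. {z. z ^ (2 * N) = c}"
  have rc: "residue_class N a = qpow -` {qpow a}" for a
    unfolding residue_class_def by (auto simp: qpow_eq_iff)
  \<comment> \<open>Residue classes modulo N are the fibres of \<open>qpow\<close>, so they may be
    counted by their values.\<close>
  have inj: "inj_on (\<lambda>z. qpow -` {z}) (qpow ` A)"
  proof (rule inj_onI)
    fix z w assume "z \<in> qpow ` A" and eq: "qpow -` {z} = qpow -` {w}"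
    then obtain a where "qpow a = z" by blast
    then have "a \<in> qpow -` {z}" by simp
    then show "z = w" using eq \<open>qpow a = z\<close> by simp
  qed
  have "weight_orbit N l = (\<lambda>z. qpow -` {z}) ` (qpow ` A)"
    unfolding weight_orbit_def A_def[symmetric] image_image by (rule image_cong) (simp_all add: rc)
  then have card: "card (weight_orbit N l) = card (qpow ` A)"
    by (simp add: card_image[OF inj])
  have im: "qpow ` A = ?Rt c \<union> ?Rt (inverse c)"
  proof (intro equalityI subsetI)
    fix z assume "z \<in> qpow ` A"
    then obtain a j where a: "z = qpow a" "a = l + of_int j / 2 \<or> a = - l + of_int j / 2"
      unfolding A_def by blast
    from a(2) show "z \<in> ?Rt c \<union> ?Rt (inverse c)"
    proof
      assume "a = l + of_int j / 2"
      then have "2 * a - 2 * l \<in> \<int>" by (simp add: distrib_left)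
      then show ?thesis using qpow_2N_eq_iff[of a l] by (simp add: a(1) c_def)
    next
      assume "a = - l + of_int j / 2"
      then have "2 * a + 2 * l \<in> \<int>" by (simp add: distrib_left)
      then have "z ^ (2 * N) * c = 1" using qpow_2N_mult_eq_1_iff[of a l] by (simp add: a(1) c_def)
      then show ?thesis using c0 by (simp add: field_simps)
    qed
  next
    fix z assume z: "z \<in> ?Rt c \<union> ?Rt (inverse c)"
    then have "z \<noteq> 0" using c0 N(1) by (auto simp: power_0_left)
    then obtain a where a: "qpow a = z" by (rule qpow_surj)
    have "2 * a - 2 * l \<in> \<int> \<or> 2 * a + 2 * l \<in> \<int>"
    proof (cases "z ^ (2 * N) = c")
      case True
      then show ?thesis using qpow_2N_eq_iff[of a l] by (simp add: a c_def)
    next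
      case False
      then have "z ^ (2 * N) * c = 1" using z c0 by simp
      then show ?thesis using qpow_2N_mult_eq_1_iff[of a l] by (simp add: a c_def)
    qed
    then have "a \<in> A"
    proof
      assume "2 * a - 2 * l \<in> \<int>"
      then obtain j :: int where "2 * a - 2 * l = of_int j" by (rule Ints_cases)
      then have "a = l + of_int j / 2" by (simp add: field_simps)
      then show ?thesis unfolding A_def by blast
    next
      assume "2 * a + 2 * l \<in> \<int>"
      then obtain j :: int where "2 * a + 2 * l = of_int j" by (rule Ints_cases)
      then have "a = - l + of_int j / 2" by (simp add: field_simps)
      then show ?thesis unfolding A_def by blast
    qed
    then show "z \<in> qpow ` A" using a by blast
  qed
  have cR: "card (?Rt b) = 2 * N" "finite (?Rt b)" if "b \<noteq> 0" for b
    using that N(1) by (auto intro: card_nth_roots finite_nth_roots)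
  have cc: "qpow l ^ (4 * N) = c * c" by (simp add: c_def power_add[symmetric])
  show ?thesis
  proof (cases "c = inverse c")
    case True
    then have "c * c = 1" using c0 by (metis right_inverse)
    then show ?thesis using card True cR(1)[OF c0] N(1) unfolding regular_def im cc by simp
  next
    case False
    then have "?Rt c \<inter> ?Rt (inverse c) = {}" by auto
    then have "card (qpow ` A) = 4 * N"
      unfolding im using cR[OF c0] cR[of "inverse c"] c0 by (simp add: card_Un_disjoint)
    moreover have "c * c \<noteq> 1" using False inverse_unique[of c c] by auto
    ultimately show ?thesis unfolding regular_def card cc by simp
  qed
qed

end

lemma unbroken_dahaI:
  fixes V :: "('v::ab_group_add) daha_rep"
  assumes nz: "qh \<noteq> 0" "th \<noteq> 0" and V: "irreducible_daha_module qh th V"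
    and fin: "finite_dimensional (scal V) (UNIV :: 'v set)"
    and N: "N \<ge> 1" "primitive_root (2 * N) qh" and y: "Y_eigenvalue V y"
    and unb: "th ^ (2 * N) \<noteq> y ^ (2 * N)" "th ^ (2 * N) * y ^ (2 * N) \<noteq> 1"
  obtains Basis where "findim_daha_of qh th N Basis V"
    "unbroken_daha (scal V) qh th (actX V) (inv (actX V)) (actY V) (inv (actY V)) (actT V) Basis N y"
proof -
  have D: "daha_of qh th V"
    and S: "\<And>U. daha.stable (scal V) (actX V) (inv (actX V)) (actY V) (inv (actY V)) (actT V) U \<Longrightarrow> U = {0} \<or> U = UNIV"
    using irreducible_iff[OF nz, of V] V by blast+
  obtain Basis where F: "findim_daha_of qh th N Basis V" by (rule findim_dahaI[OF D fin N])
  have ys: "y \<in> daha.spec (scal V) (actY V) UNIV" using y Y_eigenvalue_iff[OF F] by simp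
  have "unbroken_daha (scal V) qh th (actX V) (inv (actX V)) (actY V) (inv (actY V)) (actT V) Basis N y"
    by (intro unbroken_daha.intro unbroken_daha_axioms.intro F S ys unb)
  then show ?thesis using F by (intro that)
qed

section \<open>The classification\<close>

lemma regular_generic_case:
  fixes V :: "('v::ab_group_add) daha_rep"
  assumes nz: "qh \<noteq> 0" "th \<noteq> 0" and V: "irreducible_daha_module qh th V"
    and fin: "finite_dimensional (scal V) (UNIV :: 'v set)"
    and N: "N \<ge> 1" "primitive_root (2 * N) qh" and y: "Y_eigenvalue V y" "y ^ (4 * N) \<noteq> 1"
    and unb: "th ^ (2 * N) \<noteq> y ^ (2 * N)" "th ^ (2 * N) * y ^ (2 * N) \<noteq> 1"
  shows "Y_principal N qh th V"
proof -
  obtain Basis where F: "findim_daha_of qh th N Basis V"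
    and U: "unbroken_daha (scal V) qh th (actX V) (inv (actX V)) (actY V) (inv (actY V)) (actT V) Basis N y"
    by (rule unbroken_dahaI[OF nz V fin N y(1) unb])
  show ?thesis
    unfolding Y_principal_def
    using V fin unbroken_daha.regular_case[OF U y(2)] dimension_eq[OF F] Y_split_iff[OF F]
      Y_split_imp_simple_spectrum[OF F] by simp
qed

text \<open>V is twisted until its common eigenvector has both eigenvalues equal to the parameter,
  classified there, and twisted back.\<close>

lemma regular_degenerate_case:
  fixes V :: "('v::ab_group_add) daha_rep"
  assumes nz: "qh \<noteq> 0" "th \<noteq> 0" and V: "irreducible_daha_module qh th V"
    and fin: "finite_dimensional (scal V) (UNIV :: 'v set)"
    and N: "N \<ge> 1" "primitive_root (2 * N) qh" and y: "Y_eigenvalue V y"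
      "th ^ (2 * N) = y ^ (2 * N) \<or> th ^ (2 * N) * y ^ (2 * N) = 1" and th: "th ^ (4 * N) \<noteq> 1"
  shows "\<exists>P\<in>poly_rep_images qh th.
    (\<exists>C. C \<noteq> 2 \<and> is_quotient_by P (principal_ideal (trinomial (2 * int N) C)) V \<and> Y_principal N qh th V) \<or>
    is_quotient_by P (principal_ideal (trinomial (int N) 0)) V \<and> \<not> Y_principal N qh th V"
proof -
  have D: "daha_of qh th V" using irreducible_iff[OF nz, of V] V by blast
  obtain Basis where F: "findim_daha_of qh th N Basis V" by (rule findim_dahaI[OF D fin N])
  obtain i j w where w: "w \<noteq> 0" "actT (twist i j V) w = scal V (twist_param i th) w"
      "actY (twist i j V) w = scal V (twist_param i th) w"
    using exists_twisted_character[OF nz V fin N y] by blast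
  let ?V = "twist i j V" and ?th = "twist_param i th"
  have nz': "?th \<noteq> 0" by (rule twist_param_nonzero[OF nz(2)])
  have V': "irreducible_daha_module qh ?th ?V" by (rule irreducible_twist[OF nz V])
  have fin': "finite_dimensional (scal ?V) (UNIV :: 'v set)" using fin by simp
  have th': "?th ^ (4 * N) \<noteq> 1" using th nz(2) by (simp add: twist_param_power)
  have w': "actT ?V w = scal ?V ?th w" "actY ?V w = scal ?V ?th w" using w(2,3) by (simp_all only: twist_simps(1))
  let ?P = "twist i j (poly_rep qh ?th)"
  have P: "?P \<in> poly_rep_images qh th" unfolding poly_rep_images_eq by blast
  have dim: "dimension ?V = dimension V" by (simp add: dimension_def)
  from irreducible_quotient_cases[OF nz(1) nz' V' fin' N w' w(1) th']
  show ?thesis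
  proof (elim disjE exE conjE)
    fix C assume C: "C \<noteq> 2" "is_quotient_by (poly_rep qh ?th) (principal_ideal (trinomial (2 * int N) C)) ?V"
      "dimension ?V = 4 * N" "Y_split ?V"
    have "Y_split (twist i j ?V)" by (rule Y_split_twist[OF daha_of_twist(1)[OF D] C(4)])
    then have "Y_simple_spectrum V" by (intro Y_split_imp_simple_spectrum[OF F]) simp
    then have "Y_principal N qh th V" using V fin C(3) dim by (simp add: Y_principal_def)
    moreover have "is_quotient_by ?P (principal_ideal (trinomial (2 * int N) C)) V"
      unfolding is_quotient_by_twist by (rule C(2))
    ultimately show ?thesis using C(1) P by blast
  next
    assume C: "is_quotient_by (poly_rep qh ?th) (principal_ideal (trinomial (int N) 0)) ?V"
      "dimension ?V = 2 * N"
    have "\<not> Y_principal N qh th V" using C(2) dim N(1) by (simp add: Y_principal_def)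
    moreover have "is_quotient_by ?P (principal_ideal (trinomial (int N) 0)) V"
      unfolding is_quotient_by_twist by (rule C(1))
    ultimately show ?thesis using P by blast
  qed
qed

lemma quotient_converse:
  fixes W :: "('w::ab_group_add) daha_rep"
  assumes nz: "qh \<noteq> 0" "th \<noteq> 0" and N: "N \<ge> 1" "primitive_root (2 * N) qh"
    and th: "th ^ (4 * N) \<noteq> 1" and P: "P \<in> poly_rep_images qh th"
  shows "C \<noteq> 2 \<Longrightarrow> is_quotient_by P (principal_ideal (trinomial (2 * int N) C)) W \<Longrightarrow>
      irreducible_daha_module qh th W \<and> Y_principal N qh th W"
    and "is_quotient_by P (principal_ideal (trinomial (int N) 0)) W \<Longrightarrow>
      irreducible_daha_module qh th W \<and> \<not> Y_principal N qh th W"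
proof -
  obtain i j where P: "P = twist i j (poly_rep qh (twist_param i th))"
    using P unfolding poly_rep_images_eq by blast
  let ?W = "twist i j W" and ?th = "twist_param i th"
  have nz': "?th \<noteq> 0" by (rule twist_param_nonzero[OF nz(2)])
  have th': "?th ^ (4 * N) \<noteq> 1" using th nz(2) by (simp add: twist_param_power)
  have dim: "dimension ?W = dimension W" by (simp add: dimension_def)
  have untwist: "irreducible_daha_module qh th W" if "irreducible_daha_module qh ?th ?W"
    using irreducible_twist[OF nz(1) nz' that, of i j] by simp
  show "irreducible_daha_module qh th W \<and> Y_principal N qh th W"
    if C: "C \<noteq> 2" and q: "is_quotient_by P (principal_ideal (trinomial (2 * int N) C)) W"
  proof -
    have Q: "irreducible_daha_module qh ?th ?W \<and> finite_dimensional (scal ?W) (UNIV :: 'w set)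
        \<and> dimension ?W = 4 * N \<and> Y_split ?W"
      by (rule quotient_by_trinomial(1)[OF nz' N th' C]) (use q in \<open>simp only: P is_quotient_by_twist\<close>)
    then have W: "irreducible_daha_module qh th W" using untwist by blast
    have D: "daha_of qh th W" using irreducible_iff[OF nz, of W] W by blast
    have fin: "finite_dimensional (scal W) (UNIV :: 'w set)" using Q by simp
    obtain Basis where F: "findim_daha_of qh th N Basis W" by (rule findim_dahaI[OF D fin N])
    have "Y_split (twist i j ?W)"
      using Q by (intro Y_split_twist[OF daha_of_twist(1)[OF D]]) blast
    then have "Y_simple_spectrum W" by (intro Y_split_imp_simple_spectrum[OF F]) simp
    then show ?thesis using W fin Q dim by (simp add: Y_principal_def)
  qed
  show "irreducible_daha_module qh th W \<and> \<not> Y_principal N qh th W"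
    if q: "is_quotient_by P (principal_ideal (trinomial (int N) 0)) W"
  proof -
    have Q: "irreducible_daha_module qh ?th ?W \<and> dimension ?W = 2 * N"
      by (rule quotient_by_trinomial(2)[OF nz' N th']) (use q in \<open>simp only: P is_quotient_by_twist\<close>)
    then show ?thesis using untwist dim N(1) by (simp add: Y_principal_def)
  qed
qed

lemma half_singular_generic_case:
  fixes V :: "('v::ab_group_add) daha_rep"
  assumes nz: "qh \<noteq> 0" "th \<noteq> 0" and V: "irreducible_daha_module qh th V"
    and fin: "finite_dimensional (scal V) (UNIV :: 'v set)"
    and N: "N \<ge> 1" "primitive_root (2 * N) qh" and y: "Y_eigenvalue V y" "y ^ (2 * N) = - 1"
    and th: "th ^ (2 * N) \<noteq> - 1"
  shows "Y_semisimple V"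
    and "dimension V = 2 * N \<and> Y_simple_spectrum V \<or>
      dimension V = 4 * N \<and> (\<forall>z. Y_eigenvalue V z \<longrightarrow> Y_multiplicity V z = 2)"
proof -
  have unb: "th ^ (2 * N) \<noteq> y ^ (2 * N)" "th ^ (2 * N) * y ^ (2 * N) \<noteq> 1"
    using th y(2) by (auto simp: minus_equation_iff)
  obtain Basis where F: "findim_daha_of qh th N Basis V"
    and U: "unbroken_daha (scal V) qh th (actX V) (inv (actX V)) (actY V) (inv (actY V)) (actT V) Basis N y"
    by (rule unbroken_dahaI[OF nz V fin N y(1) unb])
  show ss: "Y_semisimple V"
    unfolding Y_semisimple_iff[OF F] by (rule unbroken_daha.nonsingular(2)[OF U]) (simp add: y(2))
  obtain d where d: "d = 1 \<or> d = 2" "dimension V = 2 * N * d"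
      "\<And>z. Y_eigenvalue V z \<Longrightarrow> Y_multiplicity V z = d"
    using unbroken_daha.half_singular_case[OF U y(2)] Y_multiplicity_eq[OF F ss]
    unfolding dimension_eq[OF F] Y_eigenvalue_iff[OF F] Y_eigenspace_eq[OF F] by metis
  then show "dimension V = 2 * N \<and> Y_simple_spectrum V \<or>
      dimension V = 4 * N \<and> (\<forall>z. Y_eigenvalue V z \<longrightarrow> Y_multiplicity V z = 2)"
    by (auto simp: Y_simple_spectrum_def)
qed

lemma singular_generic_case:
  fixes V :: "('v::ab_group_add) daha_rep"
  assumes nz: "qh \<noteq> 0" "th \<noteq> 0" and V: "irreducible_daha_module qh th V"
    and fin: "finite_dimensional (scal V) (UNIV :: 'v set)"
    and N: "N \<ge> 1" "primitive_root (2 * N) qh" and y: "Y_eigenvalue V y" "y ^ (2 * N) = 1"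
    and th: "th ^ (2 * N) \<noteq> 1"
  shows "dimension V = 4 * N \<and> \<not> Y_semisimple V"
proof -
  have unb: "th ^ (2 * N) \<noteq> y ^ (2 * N)" "th ^ (2 * N) * y ^ (2 * N) \<noteq> 1"
    using th y(2) by simp_all
  obtain Basis where F: "findim_daha_of qh th N Basis V"
    and U: "unbroken_daha (scal V) qh th (actX V) (inv (actX V)) (actY V) (inv (actY V)) (actT V) Basis N y"
    by (rule unbroken_dahaI[OF nz V fin N y(1) unb])
  show ?thesis
    using unbroken_daha.singular_case[OF U y(2)] by (simp add: dimension_eq[OF F] Y_semisimple_iff[OF F])
qed

lemma degenerate_is_quotient:
  fixes V :: "('v::ab_group_add) daha_rep"
  assumes nz: "qh \<noteq> 0" "th \<noteq> 0" and V: "irreducible_daha_module qh th V"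
    and fin: "finite_dimensional (scal V) (UNIV :: 'v set)"
    and N: "N \<ge> 1" "primitive_root (2 * N) qh" and y: "Y_eigenvalue V y"
      "th ^ (2 * N) = y ^ (2 * N) \<or> th ^ (2 * N) * y ^ (2 * N) = 1"
  shows "\<exists>P\<in>poly_rep_images qh th. is_quotient P V"
proof -
  obtain i j w where w: "w \<noteq> 0" "actT (twist i j V) w = scal V (twist_param i th) w"
      "actY (twist i j V) w = scal V (twist_param i th) w"
    using exists_twisted_character[OF nz V fin N y] by blast
  let ?V = "twist i j V" and ?th = "twist_param i th"
  have "is_quotient (poly_rep qh ?th) ?V"
    by (rule is_quotient_of_poly_rep[OF nz(1) twist_param_nonzero[OF nz(2)] irreducible_twist[OF nz V] _ _ w(1)])
      (use w in \<open>simp_all only: twist_simps(1)\<close>)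
  then have "is_quotient (twist i j (poly_rep qh ?th)) V" unfolding is_quotient_twist .
  then show ?thesis unfolding poly_rep_images_eq by blast
qed

theorem theorem9p2:
  fixes N :: nat and qh th t k l :: complex and qpow :: "complex \<Rightarrow> complex"
    and V :: "('v::ab_group_add) daha_rep"
  assumes "N \<ge> 1"
    and "primitive_root (2 * N) qh"
    and "compatible_powers N qh qpow"
    and "t = qpow k" and "th = qpow (k / 2)"
    and "irreducible_daha_module qh th V"
    and "finite_dimensional (scal V) (UNIV :: 'v set)"
    and "Y_eigenvalue V (qpow l)"
  shows
    \<comment> \<open>the list exhausts all pairs\<close>
    "(regular N l
       \<or> half_singular l \<and> (2 * k \<notin> \<int> \<or> k \<in> \<int>)
       \<or> singular l \<and> k \<notin> \<int>
       \<or> (half_singular l \<and> k - 1 / 2 \<in> \<int> \<or> singular l \<and> k \<in> \<int>))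
     \<and> \<comment> \<open>(A)\<close>
     (regular N l \<longrightarrow>
       (\<not> (k - 2 * l \<in> \<int> \<or> k + 2 * l \<in> \<int>) \<longrightarrow> Y_principal N qh th V) \<and>
       (k - 2 * l \<in> \<int> \<or> k + 2 * l \<in> \<int> \<longrightarrow>
          2 * k \<notin> \<int> \<and>
          (\<exists>P\<in>poly_rep_images qh th.
             (\<exists>C. C \<noteq> 2 \<and> is_quotient_by P
                (principal_ideal (Xpow (2 * int N) + Xpow (- 2 * int N) + const C)) V \<and>
                Y_principal N qh th V) \<or>
             is_quotient_by P (principal_ideal (Xpow (int N) + Xpow (- int N))) V \<and>
               \<not> Y_principal N qh th V) \<and>
          \<comment> \<open>conversely, the listed quotients are irreducible\<close>
          (\<forall>P\<in>poly_rep_images qh th. \<forall>W :: ('w::ab_group_add) daha_rep.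
             (\<forall>C. C \<noteq> 2 \<and> is_quotient_by P
                (principal_ideal (Xpow (2 * int N) + Xpow (- 2 * int N) + const C)) W \<longrightarrow>
                irreducible_daha_module qh th W \<and> Y_principal N qh th W) \<and>
             (is_quotient_by P (principal_ideal (Xpow (int N) + Xpow (- int N))) W \<longrightarrow>
                irreducible_daha_module qh th W \<and> \<not> Y_principal N qh th W))))
     \<and> \<comment> \<open>(B)\<close>
     (half_singular l \<and> (2 * k \<notin> \<int> \<or> k \<in> \<int>) \<longrightarrow>
       Y_semisimple V \<and>
       (dimension V = 2 * N \<and> Y_simple_spectrum V \<or>
        dimension V = 4 * N \<and> (\<forall>m. Y_eigenvalue V (qpow m) \<longrightarrow> Y_multiplicity V (qpow m) = 2)) \<and>
       \<comment> \<open>both dimensions occur, on any vector space of the given dimension\<close>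
       (\<forall>sc :: complex \<Rightarrow> 'w \<Rightarrow> 'w.
          vector_space sc \<and> finite_dimensional sc UNIV \<and>
          vector_space.dim sc UNIV \<in> {2 * N, 4 * N} \<longrightarrow>
          (\<exists>W. scal W = sc \<and> irreducible_daha_module qh th W \<and> Y_eigenvalue W (qpow l))))
     \<and> \<comment> \<open>(C)\<close>
     (singular l \<and> k \<notin> \<int> \<longrightarrow>
       dimension V = 4 * N \<and> (t \<noteq> 1 \<longrightarrow> \<not> Y_semisimple V))
     \<and> \<comment> \<open>(D)\<close>
     (half_singular l \<and> k - 1 / 2 \<in> \<int> \<or> singular l \<and> k \<in> \<int> \<longrightarrow>
       (\<exists>P\<in>poly_rep_images qh th. is_quotient P V))"
proof -
  note N = assms(1,2) and V = assms(6) and fin = assms(7) and y = assms(8)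
  note qc = assms(1-3)
  let ?y = "qpow l"
  have th_nz: "th \<noteq> 0" unfolding assms(5) by (rule qpow_nonzero[OF qc])
  have qh_nz: "qh \<noteq> 0" using qpow_nonzero[OF qc, of "1 / 2"] qpow_half[OF qc] by simp
  note nz = qh_nz th_nz
  have k2: "2 * (k / 2) = k" by simp
  \<comment> \<open>A dictionary: every condition on the exponents is one on the 2N-th powers of the
    weight and of t^(1/2), which is how the lemmas are phrased.\<close>
  have reg: "regular N l \<longleftrightarrow> ?y ^ (4 * N) \<noteq> 1" by (rule regular_iff[OF qc])
  have sing: "singular l \<longleftrightarrow> ?y ^ (2 * N) = 1"
    unfolding singular_def by (rule qpow_2N_eq_1_iff[OF qc, symmetric])
  have half: "half_singular l \<longleftrightarrow> ?y ^ (2 * N) = - 1"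
    unfolding half_singular_def by (rule qpow_2N_eq_minus_1_iff[OF qc, symmetric])
  have y4: "?y ^ (4 * N) = 1 \<longleftrightarrow> ?y ^ (2 * N) = 1 \<or> ?y ^ (2 * N) = - 1" by (rule qpow_4N_eq_1_iff[OF qc])
  have kZ: "k \<in> \<int> \<longleftrightarrow> th ^ (2 * N) = 1"
    unfolding assms(5) qpow_2N_eq_1_iff[OF qc] k2 ..
  have kH: "k - 1 / 2 \<in> \<int> \<longleftrightarrow> th ^ (2 * N) = - 1"
    unfolding assms(5) qpow_2N_eq_minus_1_iff[OF qc] k2 ..
  have t4: "th ^ (4 * N) = 1 \<longleftrightarrow> th ^ (2 * N) = 1 \<or> th ^ (2 * N) = - 1"
    unfolding assms(5) by (rule qpow_4N_eq_1_iff[OF qc])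
  have k2Z: "2 * k \<in> \<int> \<longleftrightarrow> th ^ (4 * N) = 1"
  proof -
    have "th ^ (4 * N) = qpow k ^ (2 * N)"
      using qpow_of_nat_mult[OF qc, of 2 "k / 2"] unfolding assms(5)
      by (simp add: power_mult[symmetric])
    then show ?thesis using qpow_2N_eq_1_iff[OF qc, of k] by simp
  qed
  have km: "k - 2 * l \<in> \<int> \<longleftrightarrow> th ^ (2 * N) = ?y ^ (2 * N)"
    unfolding assms(5) qpow_2N_eq_iff[OF qc] k2 ..
  have kp: "k + 2 * l \<in> \<int> \<longleftrightarrow> th ^ (2 * N) * ?y ^ (2 * N) = 1"
    unfolding assms(5) qpow_2N_mult_eq_1_iff[OF qc] k2 ..
  have tri: "trinomial (2 * int N) C = Xpow (2 * int N) + Xpow (- 2 * int N) + const C"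
    "trinomial (int N) 0 = Xpow (int N) + Xpow (- int N)" for C by simp_all
  have list: "regular N l
       \<or> half_singular l \<and> (2 * k \<notin> \<int> \<or> k \<in> \<int>)
       \<or> singular l \<and> k \<notin> \<int>
       \<or> (half_singular l \<and> k - 1 / 2 \<in> \<int> \<or> singular l \<and> k \<in> \<int>)"
    unfolding reg sing half kZ kH k2Z y4 t4 by blast
  have A1: "Y_principal N qh th V" if "regular N l" "\<not> (k - 2 * l \<in> \<int> \<or> k + 2 * l \<in> \<int>)"
    using regular_generic_case[OF nz V fin N y] that unfolding reg km kp by blast
  have A2: "2 * k \<notin> \<int>" if "regular N l" "k - 2 * l \<in> \<int> \<or> k + 2 * l \<in> \<int>"
  proof -
    have "th ^ (2 * N) = ?y ^ (2 * N) \<or> th ^ (2 * N) * ?y ^ (2 * N) = 1"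
      using that(2) unfolding km kp .
    moreover have "?y ^ (2 * N) \<noteq> 1" "?y ^ (2 * N) \<noteq> - 1" using that(1) unfolding reg y4 by blast+
    ultimately show ?thesis unfolding k2Z t4 by (auto simp: minus_equation_iff)
  qed
  have A3: "\<exists>P\<in>poly_rep_images qh th.
      (\<exists>C. C \<noteq> 2 \<and> is_quotient_by P (principal_ideal (trinomial (2 * int N) C)) V \<and> Y_principal N qh th V) \<or>
      is_quotient_by P (principal_ideal (trinomial (int N) 0)) V \<and> \<not> Y_principal N qh th V"
    if "regular N l" "k - 2 * l \<in> \<int> \<or> k + 2 * l \<in> \<int>"
  proof (rule regular_degenerate_case[OF nz V fin N y])
    show "th ^ (2 * N) = ?y ^ (2 * N) \<or> th ^ (2 * N) * ?y ^ (2 * N) = 1"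
      using that(2) unfolding km kp .
    show "th ^ (4 * N) \<noteq> 1" using A2[OF that] unfolding k2Z .
  qed
  have A4: "\<forall>P\<in>poly_rep_images qh th. \<forall>W :: 'w daha_rep.
      (\<forall>C. C \<noteq> 2 \<and> is_quotient_by P (principal_ideal (trinomial (2 * int N) C)) W \<longrightarrow>
        irreducible_daha_module qh th W \<and> Y_principal N qh th W) \<and>
      (is_quotient_by P (principal_ideal (trinomial (int N) 0)) W \<longrightarrow>
        irreducible_daha_module qh th W \<and> \<not> Y_principal N qh th W)"
    if "regular N l" "k - 2 * l \<in> \<int> \<or> k + 2 * l \<in> \<int>"
  proof (intro ballI allI)
    fix P and W :: "'w daha_rep"
    assume P: "P \<in> poly_rep_images qh th"
    have "th ^ (4 * N) \<noteq> 1" using A2[OF that] unfolding k2Z .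
    note converse = quotient_converse[OF nz N this P, where W = W]
    show "(\<forall>C. C \<noteq> 2 \<and> is_quotient_by P (principal_ideal (trinomial (2 * int N) C)) W \<longrightarrow>
        irreducible_daha_module qh th W \<and> Y_principal N qh th W) \<and>
      (is_quotient_by P (principal_ideal (trinomial (int N) 0)) W \<longrightarrow>
        irreducible_daha_module qh th W \<and> \<not> Y_principal N qh th W)"
      by (rule conjI[OF allI impI]) (rule impI, erule conjE, erule (1) converse(1), erule converse(2))
  qed
  have A: "(\<not> (k - 2 * l \<in> \<int> \<or> k + 2 * l \<in> \<int>) \<longrightarrow> Y_principal N qh th V) \<and>
       (k - 2 * l \<in> \<int> \<or> k + 2 * l \<in> \<int> \<longrightarrow>
          2 * k \<notin> \<int> \<and>
          (\<exists>P\<in>poly_rep_images qh th.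
             (\<exists>C. C \<noteq> 2 \<and> is_quotient_by P (principal_ideal (trinomial (2 * int N) C)) V \<and>
                Y_principal N qh th V) \<or>
             is_quotient_by P (principal_ideal (trinomial (int N) 0)) V \<and> \<not> Y_principal N qh th V) \<and>
          (\<forall>P\<in>poly_rep_images qh th. \<forall>W :: 'w daha_rep.
             (\<forall>C. C \<noteq> 2 \<and> is_quotient_by P (principal_ideal (trinomial (2 * int N) C)) W \<longrightarrow>
                irreducible_daha_module qh th W \<and> Y_principal N qh th W) \<and>
             (is_quotient_by P (principal_ideal (trinomial (int N) 0)) W \<longrightarrow>
                irreducible_daha_module qh th W \<and> \<not> Y_principal N qh th W)))"
    if "regular N l"
    by (rule conjI[OF impI[OF A1[OF that]] impI[OF conjI[OF A2[OF that] conjI[OF A3[OF that] A4[OF that]]]]])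
  have B: "Y_semisimple V \<and>
       (dimension V = 2 * N \<and> Y_simple_spectrum V \<or>
        dimension V = 4 * N \<and> (\<forall>m. Y_eigenvalue V (qpow m) \<longrightarrow> Y_multiplicity V (qpow m) = 2)) \<and>
       (\<forall>sc :: complex \<Rightarrow> 'w \<Rightarrow> 'w.
          vector_space sc \<and> finite_dimensional sc UNIV \<and>
          vector_space.dim sc UNIV \<in> {2 * N, 4 * N} \<longrightarrow>
          (\<exists>W. scal W = sc \<and> irreducible_daha_module qh th W \<and> Y_eigenvalue W (qpow l)))"
    if h: "half_singular l \<and> (2 * k \<notin> \<int> \<or> k \<in> \<int>)"
  proof -
    have y2: "?y ^ (2 * N) = - 1" using h unfolding half by blast
    have th2: "th ^ (2 * N) \<noteq> - 1" using h unfolding k2Z kZ t4 by auto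
    have "Y_semisimple V" by (rule half_singular_generic_case(1)[OF nz V fin N y y2 th2])
    moreover have "dimension V = 2 * N \<and> Y_simple_spectrum V \<or>
        dimension V = 4 * N \<and> (\<forall>m. Y_eigenvalue V (qpow m) \<longrightarrow> Y_multiplicity V (qpow m) = 2)"
      using half_singular_generic_case(2)[OF nz V fin N y y2 th2] by blast
    moreover have "\<exists>W. scal W = sc \<and> irreducible_daha_module qh th W \<and> Y_eigenvalue W (qpow l)"
      if "vector_space sc" "finite_dimensional sc UNIV" "vector_space.dim sc UNIV \<in> {2 * N, 4 * N}"
      for sc :: "complex \<Rightarrow> 'w \<Rightarrow> 'w"
      by (rule exists_half_singular_module[OF that N nz th2 y2])
    ultimately show ?thesis by blast
  qed
  have C: "dimension V = 4 * N \<and> (t \<noteq> 1 \<longrightarrow> \<not> Y_semisimple V)" if "singular l \<and> k \<notin> \<int>"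
    using singular_generic_case[OF nz V fin N y] that unfolding sing kZ by blast
  have D: "\<exists>P\<in>poly_rep_images qh th. is_quotient P V"
    if "half_singular l \<and> k - 1 / 2 \<in> \<int> \<or> singular l \<and> k \<in> \<int>"
  proof (rule degenerate_is_quotient[OF nz V fin N y])
    show "th ^ (2 * N) = ?y ^ (2 * N) \<or> th ^ (2 * N) * ?y ^ (2 * N) = 1"
      using that unfolding half sing kZ kH by auto
  qed
  show ?thesis
    by (rule conjI[OF list conjI[OF impI[OF A[unfolded tri]] conjI[OF impI[OF B] conjI[OF impI[OF C] impI[OF D]]]]])
qed

end
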